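(* Let $M$ be a subharmonic function on $D$, $M\not\equiv-\infty$, with Riesz measure $\nu_M$, and let $u\not\equiv-\infty$ be a subharmonic function on $D$ with Riesz measure $\nu_u$ such that $u\le M$ on $D\setminus D_0$. Then for every test function $v\in \mathrm{sbh}_0^+(D\setminus D_0)$ the following implication holds: $$\Bigl(\int_{D\setminus D_0} v\,d\nu_M<+\infty\Bigr)\;\Longrightarrow\;\Bigl(\int_{D\setminus D_0} v\,d\nu_u<+\infty\Bigr).$$ In particular, if $f\not\equiv 0$ is a holomorphic function on $D$ that vanishes on a sequence $\mathtt Z=\{\mathtt z_k\}_{k=1,2,\dots}\subset D$ and $\log|f|\le M$ on $D\setminus D_0$, then for every $v\in \mathrm{sbh}_0^+(D\setminus D_0)$ $$\Bigl(\int_{D\setminus D_0} v\,d\nu_M<+\infty\Bigr)\;\Longrightarrow\;\Bigl(\sum_{\mathtt z_k\in D\setminus D_0} v(\mathtt z_k)<+\infty\Bigr).$$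
   Context: $\mathbb C_\infty=\mathbb C\cup\{\infty\}$ is the Riemann sphere; closures and boundaries are taken in $\mathbb C_\infty$; a domain is an open connected subset of $\mathbb C_\infty$; $\Subset$ means relatively compact. Throughout, $D_0,D$ are domains with $\varnothing\ne D_0\Subset D\ne\mathbb C_\infty$. Positive means $\ge 0$. Subharmonicity near $\infty$ is understood via the inversion $z\mapsto 1/\bar z$. For an arbitrary set $S\subset\mathbb C_\infty$, $\mathrm{sbh}(S)$ is the class of restrictions to $S$ of functions subharmonic in some open set containing $S$, and $\mathrm{sbh}^+(S)$ is the subclass of positive functions. The Riesz measure of a subharmonic $u\not\equiv-\infty$ is $\nu_u=\frac1{2\pi}\Delta u$. Test functions: $\mathrm{sbh}_0^+(D\setminus D_0)$ is the class of all $v\in\mathrm{sbh}^+(D\setminus D_0)$ with $\lim_{D\ni z'\to z}v(z')=0$ for every $z\in\partial D$. A holomorphic $f\not\equiv0$ vanishes on a sequence $\mathtt Z$ if at each point $z$ the multiplicity of the zero of $f$ is at least the number of repetitions of $z$ in $\mathtt Z$. *)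

theory Defs
  imports "HOL-Complex_Analysis.Complex_Analysis"
begin

section \<open>The Riemann sphere\<close>

text \<open>The sphere is the one-point compactification of the complex plane: \<open>None\<close> is the point
  at infinity, \<open>Some z\<close> the finite point \<open>z\<close>.\<close>

abbreviation sphere_top :: "complex option topology" where
  "sphere_top \<equiv> Alexandroff_compactification euclidean"

definition sphere_domain :: "complex option set \<Rightarrow> bool" where
  "sphere_domain D \<longleftrightarrow> openin sphere_top D \<and> connectedin sphere_top D"

definition relatively_compact_in :: "complex option set \<Rightarrow> complex option set \<Rightarrow> bool" where
  "relatively_compact_in S T \<longleftrightarrow>
     compactin sphere_top (sphere_top closure_of S) \<and> sphere_top closure_of S \<subseteq> T"

text \<open>The inversion \<open>w \<mapsto> 1 / cnj w\<close>, as a parametrisation of the sphere without \<open>Some 0\<close>.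
  Together with the parametrisation \<open>Some\<close> of the plane it covers the sphere.\<close>

definition inv_chart :: "complex \<Rightarrow> complex option" where
  "inv_chart w = (if w = 0 then None else Some (1 / cnj w))"

section \<open>Subharmonic functions\<close>

text \<open>The mean of \<open>u\<close> over the circle with centre \<open>a\<close> and radius \<open>r\<close>, as the difference of the
  means of the positive and the negative part (\<open>e2ennreal\<close> maps negative numbers to 0). For \<open>u\<close>
  upper semicontinuous with values less than \<open>\<infinity>\<close> the first integral is finite, so the difference
  is meaningful and may be \<open>-\<infinity>\<close>.\<close>

definition circle_mean :: "(complex \<Rightarrow> ereal) \<Rightarrow> complex \<Rightarrow> real \<Rightarrow> ereal" where
  "circle_mean u a r =
     (enn2ereal (\<integral>\<^sup>+t\<in>{0..2*pi}. e2ennreal (u (a + of_real r * cis t)) \<partial>lborel)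
      - enn2ereal (\<integral>\<^sup>+t\<in>{0..2*pi}. e2ennreal (- u (a + of_real r * cis t)) \<partial>lborel))
     / ereal (2 * pi)"

text \<open>The function \<open>-\<infinity>\<close> counts as subharmonic.\<close>

definition subharmonic_plane :: "complex set \<Rightarrow> (complex \<Rightarrow> ereal) \<Rightarrow> bool" where
  "subharmonic_plane U u \<longleftrightarrow>
     open U \<and>
     (\<forall>z\<in>U. u z < \<infinity>) \<and>
     (\<forall>c. open {z \<in> U. u z < c}) \<and>
     (\<forall>a r. 0 < r \<and> cball a r \<subseteq> U \<longrightarrow> u a \<le> circle_mean u a r)"

definition subharmonic :: "complex option set \<Rightarrow> (complex option \<Rightarrow> ereal) \<Rightarrow> bool" where
  "subharmonic U u \<longleftrightarrow>
     openin sphere_top U \<and>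
     subharmonic_plane (Some -` U) (u \<circ> Some) \<and>
     subharmonic_plane (inv_chart -` U) (u \<circ> inv_chart)"

text \<open>Functions on \<open>S\<close> are represented by total functions whose values outside \<open>S\<close> are
  irrelevant.\<close>

definition sbh :: "complex option set \<Rightarrow> (complex option \<Rightarrow> ereal) set" where
  "sbh S = {v. \<exists>U V. S \<subseteq> U \<and> subharmonic U V \<and> (\<forall>p\<in>S. v p = V p)}"

definition sbh_pos :: "complex option set \<Rightarrow> (complex option \<Rightarrow> ereal) set" where
  "sbh_pos S = {v \<in> sbh S. \<forall>p\<in>S. 0 \<le> v p}"

text \<open>The class of test functions. If \<open>D0\<close> is relatively compact in \<open>D\<close>, then near the boundary
  of \<open>D\<close> the limit below only sees points of \<open>D - D0\<close>.\<close>

definition sbh0_pos ::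
  "complex option set \<Rightarrow> complex option set \<Rightarrow> (complex option \<Rightarrow> ereal) set" where
  "sbh0_pos D D0 = {v \<in> sbh_pos (D - D0).
     \<forall>z \<in> sphere_top frontier_of D. (v \<longlongrightarrow> 0) (atin_within sphere_top z D)}"

section \<open>Riesz measures\<close>

definition pderiv_dir :: "complex \<Rightarrow> (complex \<Rightarrow> real) \<Rightarrow> complex \<Rightarrow> real" where
  "pderiv_dir d \<phi> z = frechet_derivative \<phi> (at z) d"

definition laplacian :: "(complex \<Rightarrow> real) \<Rightarrow> complex \<Rightarrow> real" where
  "laplacian \<phi> z = pderiv_dir 1 (pderiv_dir 1 \<phi>) z + pderiv_dir \<i> (pderiv_dir \<i> \<phi>) z"

primrec C_k :: "nat \<Rightarrow> (complex \<Rightarrow> real) \<Rightarrow> bool" where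
  "C_k 0 \<phi> \<longleftrightarrow> continuous_on UNIV \<phi>"
| "C_k (Suc n) \<phi> \<longleftrightarrow>
     (\<forall>z. \<phi> differentiable (at z)) \<and> C_k n (pderiv_dir 1 \<phi>) \<and> C_k n (pderiv_dir \<i> \<phi>)"

definition smooth_compact_support :: "complex set \<Rightarrow> (complex \<Rightarrow> real) \<Rightarrow> bool" where
  "smooth_compact_support W \<phi> \<longleftrightarrow>
     (\<forall>n. C_k n \<phi>) \<and> (\<exists>K. compact K \<and> K \<subseteq> W \<and> (\<forall>z. z \<notin> K \<longrightarrow> \<phi> z = 0))"

definition transport :: "(complex \<Rightarrow> complex option) \<Rightarrow> (complex \<Rightarrow> real) \<Rightarrow> complex option \<Rightarrow> real" where
  "transport c \<phi> p = (if p \<in> range c then \<phi> (inv c p) else 0)"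

text \<open>The distributional equation \<open>\<Delta>u = 2 \<pi> \<nu>\<close> in the coordinate \<open>c\<close>. Values \<open>-\<infinity>\<close> of \<open>u\<close>
  become 0 under \<open>real_of_ereal\<close>; for subharmonic \<open>u\<close> that is not identically \<open>-\<infinity>\<close> on a domain
  they form a null set.\<close>

definition riesz_in_chart ::
  "(complex \<Rightarrow> complex option) \<Rightarrow> complex option set \<Rightarrow> (complex option \<Rightarrow> ereal)
     \<Rightarrow> complex option measure \<Rightarrow> bool" where
  "riesz_in_chart c D u \<nu> \<longleftrightarrow>
     (\<forall>\<phi>. smooth_compact_support (c -` D) \<phi> \<longrightarrow>
        has_bochner_integral lborel (\<lambda>z. real_of_ereal (u (c z)) * laplacian \<phi> z)
          (2 * pi * (\<integral>p. transport c \<phi> p \<partial>\<nu>)))"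

text \<open>\<open>\<nu>\<close> is the Riesz measure of \<open>u\<close> on \<open>D\<close>: a Borel measure on \<open>D\<close>, finite on compact subsets of
  \<open>D\<close>, that equals \<open>\<Delta>u / (2 \<pi>)\<close>. As \<open>\<Delta>\<phi>\<close> times area is invariant under the inversion, the
  equations in the two charts are consistent; they determine \<open>\<nu>\<close> uniquely.\<close>

definition riesz_measure ::
  "complex option set \<Rightarrow> (complex option \<Rightarrow> ereal) \<Rightarrow> complex option measure \<Rightarrow> bool" where
  "riesz_measure D u \<nu> \<longleftrightarrow>
     space \<nu> = D \<and>
     sets \<nu> = sigma_sets D {U. openin sphere_top U \<and> U \<subseteq> D} \<and>
     (\<forall>K. compactin sphere_top K \<and> K \<subseteq> D \<longrightarrow> emeasure \<nu> K < \<infinity>) \<and>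
     riesz_in_chart Some D u \<nu> \<and>
     riesz_in_chart inv_chart D u \<nu>"

section \<open>Holomorphic functions and their zeros\<close>

text \<open>The holomorphic coordinate at infinity is \<open>w \<mapsto> 1 / w\<close>, that is \<open>inv_chart (cnj w)\<close>.\<close>

definition holomorphic_sphere :: "(complex option \<Rightarrow> complex) \<Rightarrow> complex option set \<Rightarrow> bool" where
  "holomorphic_sphere f D \<longleftrightarrow>
     (\<lambda>z. f (Some z)) holomorphic_on {z. Some z \<in> D} \<and>
     (\<lambda>w. f (inv_chart (cnj w))) holomorphic_on {w. inv_chart (cnj w) \<in> D}"

definition zero_multiplicity :: "(complex option \<Rightarrow> complex) \<Rightarrow> complex option \<Rightarrow> int" where
  "zero_multiplicity f p =
     (case p of
        Some z \<Rightarrow> zorder (\<lambda>w. f (Some w)) z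
      | None \<Rightarrow> zorder (\<lambda>w. f (inv_chart (cnj w))) 0)"

definition vanishes_on_sequence ::
  "complex option set \<Rightarrow> (complex option \<Rightarrow> complex) \<Rightarrow> nat set \<Rightarrow> (nat \<Rightarrow> complex option) \<Rightarrow> bool" where
  "vanishes_on_sequence D f I Z \<longleftrightarrow>
     (\<forall>p\<in>D. finite {k \<in> I. Z k = p} \<and> int (card {k \<in> I. Z k = p}) \<le> zero_multiplicity f p)"

definition log_abs :: "(complex option \<Rightarrow> complex) \<Rightarrow> complex option \<Rightarrow> ereal" where
  "log_abs f p = (if f p = 0 then -\<infinity> else ereal (ln (cmod (f p))))"

end

theory Submission
  imports Defs
begin

text \<open>On a compact subset of \<open>D\<close> the integrals are finite because \<open>v\<close> is bounded above there. So only
  the part of \<open>D - D0\<close> outside a compact neighbourhood of the closure of \<open>D0\<close> matters; if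
  \<open>\<infinity> \<in> D\<close>, this neighbourhood may include \<open>\<infinity>\<close>, and everything happens in the plane. There
  \<open>v\<close> is replaced by \<open>w = max 0 (v - \<epsilon> - B \<kappa>)\<close>, where the cutoff \<open>\<kappa>\<close> is 1 near the closure of
  \<open>D0\<close> and \<open>B\<close> bounds \<open>v\<close> on a compact collar. As \<open>v\<close> tends to 0 at the boundary of \<open>D\<close>, the
  function \<open>w\<close> has compact support, and \<open>\<Delta>w\<close> is nonnegative except on the collar, where it is at
  least \<open>-C\<close> with \<open>C\<close> independent of \<open>\<epsilon>\<close>. Testing the Riesz measures with mollifications of
  \<open>w\<close> and using \<open>u \<le> M\<close> gives \<open>2 \<pi> \<integral> w d\<nu>\<^sub>u \<le> 2 \<pi> \<integral> w d\<nu>\<^sub>M + C \<integral> \<bar>M - u\<bar>\<close>, the last integral over the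
  collar; let \<open>\<epsilon> \<rightarrow> 0\<close>. For a holomorphic \<open>f\<close>, by Jensen's formula the counting measure of the sequence is
  at most \<open>\<Delta> log \<bar>f\<bar> / (2 \<pi>)\<close> in the sense of distributions, which is all that the argument uses.\<close>

section \<open>Smooth test functions\<close>

text \<open>Circle means replace it. For a smooth function, the mean over radius s minus the value
  is s^2/4 times the Laplacian up to O(s^3), and averaging over circles is symmetric by Fubini.
  Hence a Laplacian can be moved from a test function to any integrable \<open>w\<close>, and a
  lower bound for the circle means of \<open>w\<close> bounds the Laplacian of its mollification
  from below. The submean inequality of \<open>v\<close> gives such a bound; the maximum with 0
  preserves it because \<open>w\<close> has nonnegative means. The cutoff costs little because
  \<kappa> is a truncated squared distance: its circle means exceed its value by at most
  s^2/\<eta>^2, whatever the shape of \<open>D0\<close>. This gives C = 4 * B / \<eta>^2. Local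
  integrability of \<open>u\<close> and \<open>M\<close> is itself extracted from the Riesz
  equation, and the set where \<open>u\<close> is -\<infinity> has to be shown null, since
  \<open>real_of_ereal\<close> turns -\<infinity> into 0 there.\<close>

lemma pderiv_dir_eqI: "(f has_derivative f') (at z) \<Longrightarrow> pderiv_dir d f z = f' d"
  unfolding pderiv_dir_def using frechet_derivative_at by metis

lemma C_k_SucD: "C_k (Suc n) f \<Longrightarrow> C_k n f"
proof (induction n arbitrary: f)
  case 0
  then show ?case
    by (auto simp: continuous_on_eq_continuous_at intro!: differentiable_imp_continuous_within)
next
  case (Suc n)
  have "C_k n (pderiv_dir 1 f)" "C_k n (pderiv_dir \<i> f)"
    by (rule Suc.IH, use Suc.prems in simp)+
  moreover have "\<forall>z. f differentiable (at z)" using Suc.prems by simp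
  ultimately show ?case by simp
qed

lemma C_k_differentiable:
  assumes "\<And>n. C_k n f" shows "f differentiable (at z)"
  using assms[of "Suc 0"] by simp

lemma C_k_has_derivative:
  assumes "C_k (Suc n) f"
  shows "(f has_derivative (\<lambda>h. Re h * pderiv_dir 1 f z + Im h * pderiv_dir \<i> f z)) (at z)"
proof -
  from assms have "f differentiable (at z)" by simp
  then have D: "(f has_derivative frechet_derivative f (at z)) (at z)"
    by (simp add: frechet_derivative_works)
  then have lin: "linear (frechet_derivative f (at z))"
    by (simp add: has_derivative_linear)
  have "frechet_derivative f (at z) h = Re h * pderiv_dir 1 f z + Im h * pderiv_dir \<i> f z" for h
  proof -
    have "h = Re h *\<^sub>R 1 + Im h *\<^sub>R \<i>" by (simp add: complex_eq_iff)
    then have "frechet_derivative f (at z) h = frechet_derivative f (at z) (Re h *\<^sub>R 1 + Im h *\<^sub>R \<i>)"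
      by simp
    also have "\<dots> = Re h * pderiv_dir 1 f z + Im h * pderiv_dir \<i> f z"
      using lin by (simp add: linear_add linear_scale pderiv_dir_def)
    finally show ?thesis .
  qed
  then have "frechet_derivative f (at z) = (\<lambda>h. Re h * pderiv_dir 1 f z + Im h * pderiv_dir \<i> f z)"
    by auto
  with D show ?thesis by simp
qed

lemma pderiv_dir_const: "pderiv_dir d (\<lambda>_. c) = (\<lambda>_. 0)"
  by (rule ext, rule pderiv_dir_eqI) simp

lemma C_k_const: "C_k n (\<lambda>_. c)"
  by (induction n arbitrary: c) (auto simp: pderiv_dir_const)

lemma C_k_Re: "C_k n Re"
proof (cases n)
  case (Suc m)
  have D: "(Re has_derivative Re) (at z)" for z
    using bounded_linear_Re bounded_linear_imp_has_derivative by blast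
  have "pderiv_dir d Re = (\<lambda>_. Re d)" for d
    by (rule ext, rule pderiv_dir_eqI[OF D])
  with Suc D show ?thesis by (auto simp: C_k_const differentiable_def)
qed (auto intro!: continuous_intros)

lemma C_k_Im: "C_k n Im"
proof (cases n)
  case (Suc m)
  have D: "(Im has_derivative Im) (at z)" for z
    using bounded_linear_Im bounded_linear_imp_has_derivative by blast
  have "pderiv_dir d Im = (\<lambda>_. Im d)" for d
    by (rule ext, rule pderiv_dir_eqI[OF D])
  with Suc D show ?thesis by (auto simp: C_k_const differentiable_def)
qed (auto intro!: continuous_intros)

lemma pderiv_dir_add:
  assumes "\<And>z. f differentiable (at z)" "\<And>z. g differentiable (at z)"
  shows "pderiv_dir d (\<lambda>z. f z + g z) = (\<lambda>z. pderiv_dir d f z + pderiv_dir d g z)"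
proof
  fix z
  have "((\<lambda>z. f z + g z) has_derivative
      (\<lambda>h. frechet_derivative f (at z) h + frechet_derivative g (at z) h)) (at z)"
    using assms by (intro derivative_intros) (auto simp: frechet_derivative_works[symmetric])
  from pderiv_dir_eqI[OF this, of d]
  show "pderiv_dir d (\<lambda>z. f z + g z) z = pderiv_dir d f z + pderiv_dir d g z"
    by (simp add: pderiv_dir_def)
qed

lemma pderiv_dir_mult:
  assumes "\<And>z. f differentiable (at z)" "\<And>z. g differentiable (at z)"
  shows "pderiv_dir d (\<lambda>z. f z * g z) = (\<lambda>z. f z * pderiv_dir d g z + pderiv_dir d f z * g z)"
proof
  fix z
  have "((\<lambda>z. f z * g z) has_derivative
      (\<lambda>h. f z * frechet_derivative g (at z) h + frechet_derivative f (at z) h * g z)) (at z)"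
    using assms by (intro derivative_intros) (auto simp: frechet_derivative_works[symmetric])
  from pderiv_dir_eqI[OF this, of d]
  show "pderiv_dir d (\<lambda>z. f z * g z) z = f z * pderiv_dir d g z + pderiv_dir d f z * g z"
    by (simp add: pderiv_dir_def)
qed

lemma C_k_add: "C_k n f \<Longrightarrow> C_k n g \<Longrightarrow> C_k n (\<lambda>z. f z + g z)"
  by (induction n arbitrary: f g) (auto simp: pderiv_dir_add intro!: continuous_intros)

lemma C_k_mult: "C_k n f \<Longrightarrow> C_k n g \<Longrightarrow> C_k n (\<lambda>z. f z * g z)"
proof (induction n arbitrary: f g)
  case (Suc n)
  then have "C_k n f" "C_k n g" by (auto dest: C_k_SucD simp del: C_k.simps)
  with Suc show ?case by (auto simp: pderiv_dir_mult intro!: C_k_add)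
qed (auto intro!: continuous_intros)

text \<open>The exponent \<open>m\<close> is carried along because differentiating exp (-1/t)
  produces negative powers of t; the whole family is closed under differentiation up to linear
  combinations, so smoothness follows by induction.\<close>

definition flat_exp :: "nat \<Rightarrow> real \<Rightarrow> real" where
  "flat_exp m t = (if 0 < t then exp (- (1 / t)) / t ^ m else 0)"

text \<open>A single term of the exponential series of 1/t, the one of index m + 2, already
  dominates. The surplus factor t^2 makes the difference quotients at 0 tend to 0.\<close>

lemma flat_exp_le: "\<bar>flat_exp m t\<bar> \<le> fact (m + 2) * t\<^sup>2"
proof (cases "0 < t")
  case True
  have "exp (- (1 / t)) \<le> fact n * t ^ n" for n
  proof -
    have "(\<Sum>k\<in>{n}. (1 / t) ^ k /\<^sub>R fact k) \<le> (\<Sum>k. (1 / t) ^ k /\<^sub>R fact k)"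
      using True by (intro sum_le_suminf summable_exp_generic) auto
    then have "(1 / t) ^ n / fact n \<le> exp (1 / t)"
      by (simp add: exp_def divide_inverse mult.commute)
    then show ?thesis
      using True by (simp add: exp_minus field_simps)
  qed
  from this[of "m + 2"]
  show ?thesis
    using True by (simp add: flat_exp_def divide_le_eq power_add power2_eq_square mult_ac del: fact_Suc)
qed (simp add: flat_exp_def)

lemma flat_exp_has_derivative:
  "(flat_exp m has_real_derivative (flat_exp (m + 2) t - m * flat_exp (Suc m) t)) (at t)"
proof -
  consider "t > 0" | "t = 0" | "t < 0" by linarith
  then show ?thesis
  proof cases
    case 1
    \<comment> \<open>For \<open>m = 0\<close> the truncated subtraction gives exponent 0, but the
      factor \<open>m\<close> vanishes as well, so one formula covers all \<open>m\<close>.\<close>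
    have P: "real m * t ^ (m - Suc 0) = real m * t ^ m / t" using 1 by (cases m) auto
    have "((\<lambda>t. exp (- (1 / t)) / t ^ m) has_real_derivative
        (exp (- (1 / t)) * (1 / t\<^sup>2) * t ^ m - exp (- (1 / t)) * (real m * t ^ (m - Suc 0)))
          / (t ^ m * t ^ m)) (at t)"
      using 1 by (auto intro!: derivative_eq_intros simp: power2_eq_square)
    also have "(exp (- (1 / t)) * (1 / t\<^sup>2) * t ^ m - exp (- (1 / t)) * (real m * t ^ (m - Suc 0)))
          / (t ^ m * t ^ m) = flat_exp (m + 2) t - m * flat_exp (Suc m) t"
      unfolding P using 1 by (simp add: flat_exp_def field_simps power2_eq_square)
    finally have "((\<lambda>t. exp (- (1 / t)) / t ^ m) has_real_derivative
       (flat_exp (m + 2) t - m * flat_exp (Suc m) t)) (at t)" .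
    then show ?thesis
      by (rule has_field_derivative_transform_within_open[where S = "{0<..}"])
         (use 1 in \<open>auto simp: flat_exp_def\<close>)
  next
    case 3
    have "((\<lambda>t. 0) has_real_derivative (flat_exp (m + 2) t - m * flat_exp (Suc m) t)) (at t)"
      using 3 by (auto simp: flat_exp_def)
    then show ?thesis
      by (rule has_field_derivative_transform_within_open[where S = "{..<0}"])
         (use 3 in \<open>auto simp: flat_exp_def\<close>)
  next
    case 2
    have "((\<lambda>h. (flat_exp m (0 + h) - flat_exp m 0) / h) \<longlongrightarrow> 0) (at 0)"
    proof (rule Lim_null_comparison)
      show "\<forall>\<^sub>F h in at 0. norm ((flat_exp m (0 + h) - flat_exp m 0) / h) \<le> fact (m + 2) * \<bar>h\<bar>"
      proof (rule always_eventually, rule allI)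
        fix h :: real
        show "norm ((flat_exp m (0 + h) - flat_exp m 0) / h) \<le> fact (m + 2) * \<bar>h\<bar>"
        proof (cases "h = 0")
          case False
          have "norm ((flat_exp m (0 + h) - flat_exp m 0) / h) = \<bar>flat_exp m h\<bar> / \<bar>h\<bar>"
            by (simp add: flat_exp_def)
          also have "\<dots> \<le> fact (m + 2) * h\<^sup>2 / \<bar>h\<bar>"
            by (intro divide_right_mono flat_exp_le) simp
          also have "h\<^sup>2 / \<bar>h\<bar> = \<bar>h\<bar>"
            using False by (simp add: power2_eq_square abs_if)
          then have "fact (m + 2) * h\<^sup>2 / \<bar>h\<bar> = fact (m + 2) * \<bar>h\<bar>"
            by (simp only: times_divide_eq_right[symmetric])
          finally show ?thesis .
        qed simp
      qed
      show "((\<lambda>h::real. fact (m + 2) * \<bar>h\<bar>) \<longlongrightarrow> 0) (at 0)"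
        by (auto intro!: tendsto_eq_intros)
    qed
    then show ?thesis using 2 by (simp add: DERIV_def flat_exp_def)
  qed
qed

lemma C_k_flat_exp:
  assumes "\<And>n. C_k n g"
  shows "C_k n (\<lambda>z. flat_exp m (g z))"
proof (induction n arbitrary: m)
  case 0
  have "isCont (flat_exp m) t" for t
    using flat_exp_has_derivative DERIV_isCont by blast
  then show ?case
    using assms[of 0] by (auto intro: continuous_on_compose2 continuous_at_imp_continuous_on)
next
  case (Suc n)
  have D: "((\<lambda>z. flat_exp m (g z)) has_derivative (\<lambda>h. frechet_derivative g (at z) h *
       (flat_exp (m + 2) (g z) - m * flat_exp (Suc m) (g z)))) (at z)" for z
    using C_k_differentiable[OF assms]
    by (intro DERIV_compose_FDERIV[OF flat_exp_has_derivative]) (simp add: frechet_derivative_works[symmetric])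
  have "pderiv_dir d (\<lambda>z. flat_exp m (g z)) =
      (\<lambda>z. pderiv_dir d g z * (flat_exp (m + 2) (g z) + (- real m) * flat_exp (Suc m) (g z)))" for d
    by (rule ext, subst pderiv_dir_eqI[OF D]) (simp add: pderiv_dir_def)
  moreover have "C_k n (pderiv_dir 1 g)" "C_k n (pderiv_dir \<i> g)"
    using assms[of "Suc n"] by auto
  ultimately have "C_k n (pderiv_dir 1 (\<lambda>z. flat_exp m (g z)))" "C_k n (pderiv_dir \<i> (\<lambda>z. flat_exp m (g z)))"
    by (simp_all only:) (intro C_k_mult C_k_add C_k_const Suc; assumption)+
  then show ?case
    using D by (auto simp: differentiable_def)
qed

text \<open>The squared modulus is a polynomial in \<open>Re\<close> and \<open>Im\<close>, so
  composing it with \<open>flat_exp 0\<close> is smooth at the origin too, where \<open>cmod\<close>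
  itself is not differentiable.\<close>

lemma ex_radial_bump:
  assumes "\<delta> > (0::real)"
  obtains \<rho> :: "complex \<Rightarrow> real"
  where "\<And>n. C_k n \<rho>" "\<And>z. 0 \<le> \<rho> z" "\<And>z. \<delta> \<le> cmod z \<Longrightarrow> \<rho> z = 0"
    "\<And>z w. cmod z = cmod w \<Longrightarrow> \<rho> z = \<rho> w" "integrable lborel \<rho>" "(\<integral>z. \<rho> z \<partial>lborel) = 1"
proof -
  define b where "b z = flat_exp 0 (\<delta>\<^sup>2 - (cmod z)\<^sup>2)" for z
  have C: "C_k n b" for n
  proof -
    have "C_k n (\<lambda>z. flat_exp 0 (\<delta>\<^sup>2 + (-1) * (Re z * Re z + Im z * Im z)))"
      by (intro C_k_flat_exp C_k_add C_k_mult C_k_const C_k_Re C_k_Im)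
    moreover have "b = (\<lambda>z. flat_exp 0 (\<delta>\<^sup>2 + (-1) * (Re z * Re z + Im z * Im z)))"
      by (simp add: b_def fun_eq_iff cmod_power2) (simp add: power2_eq_square algebra_simps)
    ultimately show ?thesis by simp
  qed
  have b0: "b z \<ge> 0" for z by (simp add: b_def flat_exp_def)
  have bz: "b z = 0" if "\<delta> \<le> cmod z" for z
  proof -
    have "\<delta>\<^sup>2 \<le> (cmod z)\<^sup>2" using that assms by (intro power_mono) auto
    then show ?thesis by (simp add: b_def flat_exp_def)
  qed
  have bp: "b z > 0" if "cmod z < \<delta>" for z
    using that assms by (simp add: b_def flat_exp_def power_strict_mono)
  have cont: "continuous_on UNIV b" using C[of 0] by simp
  have int: "integrable lborel b"
  proof -
    have "integrable lborel (\<lambda>x. indicator (cball 0 \<delta>) x *\<^sub>R b x)"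
      using cont by (intro borel_integrable_compact) (auto intro: continuous_on_subset)
    moreover have "(\<lambda>x. indicator (cball 0 \<delta>) x *\<^sub>R b x) = b"
      using bz by (auto simp: fun_eq_iff indicator_def)
    ultimately show ?thesis by simp
  qed
  \<comment> \<open>Otherwise \<open>b\<close> would vanish almost everywhere, although it is
    positive on a disc of positive area.\<close>
  have "(\<integral>z. b z \<partial>lborel) \<noteq> 0"
  proof
    assume "(\<integral>z. b z \<partial>lborel) = 0"
    then have "AE z in lborel. b z = 0"
      using int b0 by (simp add: integral_nonneg_eq_0_iff_AE)
    then have "AE z in lborel. z \<notin> ball (0::complex) \<delta>"
    proof eventually_elim
      case (elim z)
      then show ?case using bp[of z] by auto
    qed
    then have "emeasure lborel (ball (0::complex) \<delta>) = 0"
      by (subst (asm) AE_iff_measurable[OF _ refl]) (auto simp: ball_def)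
    then show False
      using assms pi_gt3 by (simp add: emeasure_ball unit_ball_vol_2 ennreal_eq_0_iff mult_le_0_iff)
  qed
  moreover have "(\<integral>z. b z \<partial>lborel) \<ge> 0" using b0 by simp
  ultimately have pos: "(\<integral>z. b z \<partial>lborel) > 0" by simp
  define c where "c = 1 / (\<integral>z. b z \<partial>lborel)"
  show ?thesis
  proof (rule that[of "\<lambda>z. c * b z"])
    show "C_k n (\<lambda>z. c * b z)" for n by (intro C_k_mult C_k_const C)
    show "c * b z = c * b w" if "cmod z = cmod w" for z w using that by (simp add: b_def)
  qed (use pos b0 bz int in \<open>auto simp: c_def\<close>)
qed

section \<open>Circle means\<close>

text \<open>Normalised arc length on the unit circle, as a probability measure on the Borel sets of
  the plane. Means over circles of varying centre and radius thus become integrals over one fixed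
  measure, to which Fubini and rotations apply.\<close>

definition circ :: "complex measure" where
  "circ = distr (density lborel (\<lambda>t. ennreal (indicator {0..2*pi} t / (2*pi)))) borel cis"

lemma sets_circ [simp, measurable_cong]: "sets circ = sets borel"
  by (simp add: circ_def)

lemma space_circ [simp]: "space circ = UNIV"
  by (simp add: circ_def)

lemma cis_measurable [measurable]: "cis \<in> borel_measurable borel"
  by (intro borel_measurable_continuous_onI continuous_intros)

lemma nn_integral_circ:
  assumes [measurable]: "f \<in> borel_measurable borel"
  shows "(\<integral>\<^sup>+x. f x \<partial>circ) = ennreal (1 / (2*pi)) * (\<integral>\<^sup>+t\<in>{0..2*pi}. f (cis t) \<partial>lborel)"
proof -
  have "(\<integral>\<^sup>+x. f x \<partial>circ) = (\<integral>\<^sup>+t. ennreal (indicator {0..2*pi} t / (2*pi)) * f (cis t) \<partial>lborel)"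
    unfolding circ_def by (subst nn_integral_distr, simp, simp, subst nn_integral_density) auto
  also have "\<dots> = (\<integral>\<^sup>+t. ennreal (1 / (2*pi)) * (f (cis t) * indicator {0..2*pi} t) \<partial>lborel)"
    by (intro nn_integral_cong) (auto simp: indicator_def)
  also have "\<dots> = ennreal (1 / (2*pi)) * (\<integral>\<^sup>+t\<in>{0..2*pi}. f (cis t) \<partial>lborel)"
    by (rule nn_integral_cmult) auto
  finally show ?thesis .
qed

lemma integral_circ:
  fixes f :: "complex \<Rightarrow> real"
  assumes [measurable]: "f \<in> borel_measurable borel"
  shows "(\<integral>x. f x \<partial>circ) = (\<integral>t. indicator {0..2*pi} t *\<^sub>R f (cis t) \<partial>lborel) / (2*pi)"
proof -
  have "(\<integral>x. f x \<partial>circ) = (\<integral>t. (indicator {0..2*pi} t / (2*pi)) *\<^sub>R f (cis t) \<partial>lborel)"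
    unfolding circ_def by (subst integral_distr, simp, simp, subst integral_density) auto
  also have "\<dots> = (\<integral>t. indicator {0..2*pi} t *\<^sub>R f (cis t) \<partial>lborel) / (2*pi)"
    by (simp flip: integral_divide_zero)
  finally show ?thesis .
qed

lemma emeasure_circ_UNIV [simp]: "emeasure circ UNIV = 1"
proof -
  have "emeasure circ UNIV = (\<integral>\<^sup>+x. 1 \<partial>circ)" by simp
  also have "\<dots> = 1"
    by (subst nn_integral_circ) (auto simp: ennreal_mult[symmetric])
  finally show ?thesis .
qed

lemma measure_circ_UNIV [simp]: "measure circ UNIV = 1"
  by (simp add: measure_def)

interpretation circ: finite_measure circ
  by standard simp

lemma AE_circ: "AE x in circ. cmod x = 1"
proof -
  have "{x::complex. cmod x = 1} \<in> sets borel" by measurable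
  then show ?thesis unfolding circ_def by (subst AE_distr_iff) auto
qed

lemma integrable_circ:
  fixes f :: "complex \<Rightarrow> 'b::{banach, second_countable_topology}"
  assumes "f \<in> borel_measurable borel" "\<And>x. cmod x = 1 \<Longrightarrow> norm (f x) \<le> B"
  shows "integrable circ f"
  using assms AE_circ
  by (intro circ.integrable_const_bound[where B = B]) (auto simp: cong: measurable_cong_sets)

text \<open>These are the moments met when a second-order Taylor polynomial is averaged over a
  circle: only the two pure squares survive.\<close>

lemma circ_moments:
  shows "(\<integral>x. Re x \<partial>circ) = 0" "(\<integral>x. Im x \<partial>circ) = 0"
    "(\<integral>x. (Re x)\<^sup>2 \<partial>circ) = 1 / 2" "(\<integral>x. (Im x)\<^sup>2 \<partial>circ) = 1 / 2"
    "(\<integral>x. Re x * Im x \<partial>circ) = 0"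
proof -
  have *: "(\<integral>x. f x \<partial>circ) = (F (2*pi) - F 0) / (2*pi)"
    if [measurable]: "f \<in> borel_measurable borel"
      and "\<And>t. (F has_real_derivative f (cis t)) (at t)" "continuous_on UNIV (\<lambda>t. f (cis t))"
    for f :: "complex \<Rightarrow> real" and F :: "real \<Rightarrow> real"
  proof -
    have "(\<integral>t. indicator {0..2*pi} t *\<^sub>R f (cis t) \<partial>lborel) = F (2*pi) - F 0"
      using that by (intro integral_FTC_Icc)
        (auto simp: has_real_derivative_iff_has_vector_derivative
          intro: has_vector_derivative_at_within continuous_on_subset)
    then show ?thesis by (simp add: integral_circ)
  qed
  show "(\<integral>x. Re x \<partial>circ) = 0"
    by (rule trans[OF *[of Re sin]]) (auto intro!: derivative_eq_intros continuous_intros)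
  show "(\<integral>x. Im x \<partial>circ) = 0"
    by (rule trans[OF *[of Im "\<lambda>t. - cos t"]]) (auto intro!: derivative_eq_intros continuous_intros)
  have sc: "(sin t)\<^sup>2 = 1 - (cos t)\<^sup>2" for t :: real by (simp add: sin_squared_eq)
  show "(\<integral>x. (Re x)\<^sup>2 \<partial>circ) = 1 / 2"
    by (rule trans[OF *[of "\<lambda>x. (Re x)\<^sup>2" "\<lambda>t. (t + sin t * cos t) / 2"]])
       (auto intro!: derivative_eq_intros continuous_intros simp: power2_eq_square[symmetric] sc)
  show "(\<integral>x. (Im x)\<^sup>2 \<partial>circ) = 1 / 2"
    by (rule trans[OF *[of "\<lambda>x. (Im x)\<^sup>2" "\<lambda>t. (t - sin t * cos t) / 2"]])
       (auto intro!: derivative_eq_intros continuous_intros simp: power2_eq_square[symmetric] sc)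
  show "(\<integral>x. Re x * Im x \<partial>circ) = 0"
    by (rule trans[OF *[of "\<lambda>x. Re x * Im x" "\<lambda>t. sin t * sin t / 2"]])
       (auto intro!: derivative_eq_intros continuous_intros)
qed

text \<open>\<open>measure_orthogonal_image\<close> gives invariance of Lebesgue measure on
  \<open>real ^ 2\<close>; the linear maps \<open>T\<close> and \<open>V\<close> identify that space
  with the plane, taking boxes to boxes.\<close>

lemma lborel_distr_rotate:
  fixes a :: complex
  assumes "cmod a = 1"
  shows "distr lborel borel ((*) a) = lborel"
proof -
  define T :: "real ^ 2 \<Rightarrow> complex" where "T x = Complex (x $ 1) (x $ 2)" for x
  define V :: "complex \<Rightarrow> real ^ 2" where "V z = vector [Re z, Im z]" for z
  have VT: "V (T x) = x" for x by (simp add: V_def T_def vec_eq_iff forall_2)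
  have TV: "T (V z) = z" for z by (simp add: V_def T_def)
  have Tlin: "linear T" by (rule linearI) (auto simp: T_def complex_eq_iff)
  have Tm[measurable]: "T \<in> borel_measurable borel"
    using Tlin by (intro borel_measurable_continuous_onI linear_continuous_on) (simp add: linear_linear)
  have V1: "V 1 = axis 1 1" "V \<i> = axis 2 1" by (auto simp: V_def vec_eq_iff forall_2 axis_def)
  have Tbox: "T -` box l u = box (V l) (V u)" for l u
    by (auto simp: box_def Basis_complex_def Basis_vec_def inner_axis' inner_axis T_def V_def forall_2 UNIV_2)
  have T: "(lborel :: complex measure) = distr lborel borel T"
  proof (rule lborel_eqI)
    fix l u :: complex assume le: "\<And>b. b \<in> Basis \<Longrightarrow> l \<bullet> b \<le> u \<bullet> b"
    have le': "Re l \<le> Re u" "Im l \<le> Im u" using le[of 1] le[of \<i>] by (auto simp: Basis_complex_def)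
    have "emeasure (distr lborel borel T) (box l u) = emeasure lborel (box (V l) (V u))"
      by (simp add: emeasure_distr Tbox)
    also have "\<dots> = ennreal ((Re u - Re l) * (Im u - Im l))"
      using le' by (subst emeasure_lborel_box)
        (auto simp: Basis_vec_def inner_axis V_def UNIV_2 axis_eq_axis forall_2)
    finally show "emeasure (distr lborel borel T) (box l u) = (\<Prod>b\<in>Basis. (u - l) \<bullet> b)"
      by (simp add: Basis_complex_def)
  qed simp
  have inv: "cnj a * a = 1" "a * cnj a = 1" using assms by (simp_all add: complex_norm_square[symmetric] mult.commute)
  show ?thesis
  proof (rule lborel_eqI[symmetric])
    fix l u :: complex assume le: "\<And>b. b \<in> Basis \<Longrightarrow> l \<bullet> b \<le> u \<bullet> b"
    \<comment> \<open>The preimage of a box under multiplication by \<open>a\<close> is its image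
      under multiplication by \<open>cnj a\<close>, which is the inverse because
      \<open>cmod a = 1\<close>.\<close>
    define f where "f x = V (cnj a * T x)" for x
    have "f ` (T -` box l u) = T -` ((*) a -` box l u)"
    proof (intro equalityI subsetI)
      fix y assume "y \<in> f ` (T -` box l u)"
      then obtain x where "T x \<in> box l u" "y = f x" by auto
      then show "y \<in> T -` ((*) a -` box l u)" by (simp add: f_def TV mult.assoc[symmetric] inv)
    next
      fix x assume "x \<in> T -` ((*) a -` box l u)"
      then show "x \<in> f ` (T -` box l u)"
        by (intro image_eqI[of _ _ "V (a * T x)"]) (auto simp: f_def TV VT mult.assoc[symmetric] inv)
    qed
    moreover have "orthogonal_transformation f"
    proof -
      have "linear f" unfolding f_def
        by (rule linearI) (auto simp: T_def V_def vec_eq_iff forall_2 algebra_simps)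
      moreover have "norm (f x) = norm x" for x
      proof -
        have nT: "norm y = cmod (T y)" for y
          by (simp add: norm_vec_def L2_set_def UNIV_2 T_def cmod_def)
        show ?thesis by (simp add: nT[of "f x"] nT[of x]) (simp add: f_def TV norm_mult assms)
      qed
      ultimately show ?thesis by (simp add: orthogonal_transformation)
    qed
    moreover have bl: "T -` box l u \<in> lmeasurable" by (simp add: Tbox)
    ultimately have ms: "T -` ((*) a -` box l u) \<in> lmeasurable"
      "measure lebesgue (T -` ((*) a -` box l u)) = measure lebesgue (T -` box l u)"
      using measurable_orthogonal_image[of f, OF _ bl] measure_orthogonal_image[of f, OF _ bl] by auto
    have bm: "T -` ((*) a -` box l u) \<in> sets borel"
      using measurable_sets_borel[OF Tm, of "(*) a -` box l u"]
        measurable_sets_borel[of "(*) a" borel "box l u"] by simp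
    have "emeasure (distr lborel borel ((*) a)) (box l u) = emeasure lborel (T -` ((*) a -` box l u))"
    proof -
      have A: "(*) a -` box l u \<in> sets borel"
        using measurable_sets_borel[of "(*) a" borel "box l u"] by simp
      then have "emeasure (distr lborel borel ((*) a)) (box l u) = emeasure lborel ((*) a -` box l u)"
        by (simp add: emeasure_distr)
      also have "\<dots> = emeasure (distr lborel borel T) ((*) a -` box l u)"
        by (rule arg_cong[OF T, of "\<lambda>M. emeasure M ((*) a -` box l u)"])
      also have "\<dots> = emeasure lborel (T -` ((*) a -` box l u))"
        using A by (simp add: emeasure_distr)
      finally show ?thesis .
    qed
    also have "\<dots> = emeasure lebesgue (T -` ((*) a -` box l u))" using bm by simp
    also have "\<dots> = ennreal (measure lebesgue (T -` ((*) a -` box l u)))"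
      using ms by (simp add: emeasure_eq_measure2)
    also have "\<dots> = emeasure lebesgue (T -` box l u)"
      using ms bl by (simp add: emeasure_eq_measure2)
    also have "\<dots> = emeasure (distr lborel borel T) (box l u)"
      by (simp add: emeasure_distr Tbox)
    also have "\<dots> = (\<Prod>b\<in>Basis. (u - l) \<bullet> b)"
      using le by (simp add: T[symmetric])
    finally show "emeasure (distr lborel borel ((*) a)) (box l u) = (\<Prod>b\<in>Basis. (u - l) \<bullet> b)" .
  qed simp
qed

text \<open>A rotation is a shift of the angle, which turns [0, 2 pi] into [b, b + 2 pi]; by
  periodicity the part beyond 2 pi can be moved back to [0, b].\<close>

lemma circ_distr_rotate:
  assumes "cmod a = 1"
  shows "distr circ borel ((*) a) = circ"
proof (rule measure_eqI)
  fix A :: "complex set" assume "A \<in> sets (distr circ borel ((*) a))"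
  then have A[measurable]: "A \<in> sets borel" by simp
  obtain b where b: "a = cis b" "0 \<le> b" "b < 2*pi"
  proof (rule that[of "Arg2pi a"])
    show "a = cis (Arg2pi a)" using Arg2pi_eq[of a] assms by (simp add: cis_conv_exp)
  qed (simp_all add: Arg2pi_ge_0 Arg2pi_lt_2pi)
  define g where "g t = (indicator A (cis t) :: ennreal)" for t
  have gm[measurable]: "g \<in> borel_measurable borel" unfolding g_def by measurable
  have "(\<integral>\<^sup>+t\<in>{0..2*pi}. indicator A (a * cis t) \<partial>lborel)
      = (\<integral>\<^sup>+t. g (b + t) * indicator {b..b+2*pi} (b + t) \<partial>lborel)"
    by (intro nn_integral_cong) (auto simp: g_def b cis_mult indicator_def)
  also have "\<dots> = (\<integral>\<^sup>+t. g t * indicator {b..b+2*pi} t \<partial>distr lborel borel ((+) b))"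
    by (subst nn_integral_distr) auto
  also have "\<dots> = (\<integral>\<^sup>+t. g t * indicator {b..b+2*pi} t \<partial>lborel)"
    by (simp only: lborel_distr_plus)
  \<comment> \<open>Both intervals contain the end point 2 pi, so the two integrands agree only off
    this single point.\<close>
  also have "\<dots> = (\<integral>\<^sup>+t. g t * indicator {b..2*pi} t + g t * indicator {2*pi..b+2*pi} t \<partial>lborel)"
    using AE_lborel_singleton[of "2*pi"]
    by (intro nn_integral_cong_AE, eventually_elim) (use b in \<open>auto simp: indicator_def\<close>)
  also have "\<dots> = (\<integral>\<^sup>+t. g t * indicator {b..2*pi} t \<partial>lborel)
      + (\<integral>\<^sup>+t. g t * indicator {2*pi..b+2*pi} t \<partial>distr lborel borel ((+) (2*pi)))"
    by (subst nn_integral_add) (auto simp: lborel_distr_plus)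
  also have "(\<integral>\<^sup>+t. g t * indicator {2*pi..b+2*pi} t \<partial>distr lborel borel ((+) (2*pi)))
      = (\<integral>\<^sup>+t. g (2*pi + t) * indicator {2*pi..b+2*pi} (2*pi + t) \<partial>lborel)"
    by (subst nn_integral_distr) auto
  also have "\<dots> = (\<integral>\<^sup>+t. g t * indicator {0..b} t \<partial>lborel)"
    by (intro nn_integral_cong) (auto simp: g_def indicator_def cis_mult[symmetric])
  also have "(\<integral>\<^sup>+t. g t * indicator {b..2*pi} t \<partial>lborel) + (\<integral>\<^sup>+t. g t * indicator {0..b} t \<partial>lborel)
      = (\<integral>\<^sup>+t. g t * indicator {b..2*pi} t + g t * indicator {0..b} t \<partial>lborel)"
    by (subst nn_integral_add) auto
  also have "\<dots> = (\<integral>\<^sup>+t\<in>{0..2*pi}. g t \<partial>lborel)"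
    using AE_lborel_singleton[of b]
    by (intro nn_integral_cong_AE, eventually_elim) (use b in \<open>auto simp: indicator_def\<close>)
  finally have "(\<integral>\<^sup>+x. indicator A (a * x) \<partial>circ) = (\<integral>\<^sup>+x. indicator A x \<partial>circ)"
    by (subst (1 2) nn_integral_circ) (auto simp: g_def)
  moreover have "emeasure (distr circ borel ((*) a)) A = (\<integral>\<^sup>+x. indicator A (a * x) \<partial>circ)"
    by (subst nn_integral_indicator[symmetric], simp, subst nn_integral_distr) auto
  ultimately show "emeasure (distr circ borel ((*) a)) A = emeasure circ A" by simp
qed simp

text \<open>Multiplication by \<open>y\<close> is a scaling by \<open>cmod y\<close> followed by a
  rotation, and \<open>circ\<close> is invariant under rotations.\<close>

lemma circ_mean_rotate:
  fixes f :: "complex \<Rightarrow> real"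
  assumes [measurable]: "f \<in> borel_measurable borel"
  shows "(\<integral>x. f (z + y * x) \<partial>circ) = (\<integral>x. f (z + of_real (cmod y) * x) \<partial>circ)"
proof (cases "y = 0")
  case False
  define a where "a = y / of_real (cmod y)"
  have a: "cmod a = 1" using False by (simp add: a_def norm_divide)
  have "(\<integral>x. f (z + of_real (cmod y) * x) \<partial>circ) = (\<integral>x. f (z + of_real (cmod y) * x) \<partial>distr circ borel ((*) a))"
    by (simp add: circ_distr_rotate[OF a])
  also have "\<dots> = (\<integral>x. f (z + of_real (cmod y) * (a * x)) \<partial>circ)"
    by (subst integral_distr) auto
  also have "\<dots> = (\<integral>x. f (z + y * x) \<partial>circ)"
    using False by (simp add: a_def)
  finally show ?thesis by simp
qed simp

section \<open>Smooth functions of compact support and their circle means\<close>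

lemma pderiv_dir_affine:
  assumes "\<And>z. f differentiable (at z)"
  shows "pderiv_dir d (\<lambda>z. f (a + of_real c * z)) = (\<lambda>z. c * pderiv_dir d f (a + of_real c * z))"
    and "(\<lambda>z. f (a + of_real c * z)) differentiable (at z)"
proof -
  have D: "((\<lambda>z. f (a + of_real c * z)) has_derivative
      (\<lambda>h. frechet_derivative f (at (a + of_real c * z)) (of_real c * h))) (at z)" for z
  proof (rule has_derivative_compose[of "\<lambda>z. a + of_real c * z"])
    show "((\<lambda>z. a + of_real c * z) has_derivative (\<lambda>h. of_real c * h)) (at z)"
      by (auto intro!: derivative_eq_intros)
    show "(f has_derivative frechet_derivative f (at (a + of_real c * z))) (at (a + of_real c * z))"
      using assms by (simp add: frechet_derivative_works[symmetric])
  qed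
  have lin: "linear (frechet_derivative f (at w))" for w
    using assms by (simp add: linear_frechet_derivative)
  show "pderiv_dir d (\<lambda>z. f (a + of_real c * z)) = (\<lambda>z. c * pderiv_dir d f (a + of_real c * z))"
    by (rule ext, subst pderiv_dir_eqI[OF D])
      (use linear_scale[OF lin] in \<open>simp add: pderiv_dir_def flip: scaleR_conv_of_real\<close>)
  show "(\<lambda>z. f (a + of_real c * z)) differentiable (at z)"
    using D by (auto simp: differentiable_def)
qed

lemma C_k_affine: "C_k n f \<Longrightarrow> C_k n (\<lambda>z. f (a + of_real c * z))"
proof (induction n arbitrary: f)
  case 0
  then show ?case by (auto intro!: continuous_on_compose2[of UNIV f] continuous_intros)
next
  case (Suc n)
  then have "\<And>z. f differentiable (at z)" by simp
  with Suc show ?case by (simp add: pderiv_dir_affine C_k_mult C_k_const)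
qed

lemma laplacian_affine:
  assumes "\<And>n. C_k n f"
  shows "laplacian (\<lambda>z. f (a + of_real c * z)) z = c\<^sup>2 * laplacian f (a + of_real c * z)"
proof -
  have d: "\<And>z. f differentiable (at z)" "\<And>z. pderiv_dir 1 f differentiable (at z)"
    "\<And>z. pderiv_dir \<i> f differentiable (at z)"
    using assms[of 2] by (auto simp: numeral_2_eq_2)
  have "pderiv_dir e (\<lambda>z. c * pderiv_dir e f (a + of_real c * z))
      = (\<lambda>z. c * (c * pderiv_dir e (pderiv_dir e f) (a + of_real c * z)))"
    if "\<And>z. pderiv_dir e f differentiable (at z)" for e
    using that by (subst pderiv_dir_mult) (auto simp: pderiv_dir_affine pderiv_dir_const)
  from this[OF d(2)] this[OF d(3)] show ?thesis
    by (simp add: laplacian_def pderiv_dir_affine(1)[OF d(1)] power2_eq_square distrib_left mult.assoc)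
qed

lemma pderiv_dir_zero_outside:
  assumes "closed K" "\<And>z. z \<notin> K \<Longrightarrow> f z = 0" "z \<notin> K"
  shows "pderiv_dir d f z = 0"
proof -
  have "(f has_derivative (\<lambda>_. 0)) (at z)"
    by (rule has_derivative_transform_within_open[of "\<lambda>_. 0" _ _ _ "- K"]) (use assms in auto)
  then show ?thesis by (rule pderiv_dir_eqI)
qed

lemma laplacian_zero_outside:
  assumes "closed K" "\<And>z. z \<notin> K \<Longrightarrow> f z = 0" "z \<notin> K"
  shows "laplacian f z = 0"
proof -
  have "pderiv_dir d (pderiv_dir d f) z = 0" for d
    using pderiv_dir_zero_outside[OF assms(1,2)]
    by (rule pderiv_dir_zero_outside[OF assms(1) _ assms(3)])
  then show ?thesis by (simp add: laplacian_def)
qed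

lemma C_k_bounded:
  assumes "C_k 0 f" "compact K" "\<And>z. z \<notin> K \<Longrightarrow> f z = 0"
  obtains B where "\<And>z. \<bar>f z\<bar> \<le> B" "0 \<le> B"
proof -
  have "bounded (f ` K)"
    using assms by (intro compact_imp_bounded compact_continuous_image) (auto intro: continuous_on_subset)
  then obtain B where B: "\<And>z. z \<in> K \<Longrightarrow> \<bar>f z\<bar> \<le> B"
    by (auto simp: bounded_iff)
  have "\<bar>f z\<bar> \<le> max B 0" for z using B[of z] assms(3)[of z] by (cases "z \<in> K") auto
  then show ?thesis using that[of "max B 0"] by auto
qed

lemma C_k_line_derivative:
  assumes "C_k (Suc n) f"
  shows "((\<lambda>t. f (z + of_real t * h)) has_real_derivative
     Re h * pderiv_dir 1 f (z + of_real t * h) + Im h * pderiv_dir \<i> f (z + of_real t * h)) (at t)"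
proof -
  have "((\<lambda>t. f (z + of_real t * h)) has_derivative
    (\<lambda>s. Re (of_real s * h) * pderiv_dir 1 f (z + of_real t * h)
      + Im (of_real s * h) * pderiv_dir \<i> f (z + of_real t * h))) (at t)"
    by (rule has_derivative_compose[OF _ C_k_has_derivative[OF assms]]) (auto intro!: derivative_eq_intros)
  then show ?thesis
    by (rule has_derivative_imp_has_field_derivative) (simp add: algebra_simps)
qed

lemma C_k_Lipschitz:
  assumes "C_k 1 f" "compact K" "\<And>z. z \<notin> K \<Longrightarrow> f z = 0"
  obtains B where "0 \<le> B" "\<And>z h. \<bar>f (z + h) - f z\<bar> \<le> B * cmod h"
proof -
  have "C_k 0 (pderiv_dir 1 f)" "C_k 0 (pderiv_dir \<i> f)" using assms(1) by auto
  moreover have "pderiv_dir d f z = 0" if "z \<notin> K" for d z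
    using that assms by (intro pderiv_dir_zero_outside[of K]) (auto intro: compact_imp_closed)
  ultimately obtain B1 B2 where B: "\<And>z. \<bar>pderiv_dir 1 f z\<bar> \<le> B1" "0 \<le> B1" "\<And>z. \<bar>pderiv_dir \<i> f z\<bar> \<le> B2" "0 \<le> B2"
    using C_k_bounded[OF _ assms(2)] by metis
  have "\<bar>f (z + h) - f z\<bar> \<le> (B1 + B2) * cmod h" for z h
  proof -
    let ?g = "\<lambda>t. f (z + of_real t * h)"
    have D: "DERIV ?g t :> Re h * pderiv_dir 1 f (z + of_real t * h) + Im h * pderiv_dir \<i> f (z + of_real t * h)" for t
      using C_k_line_derivative[of 0 f] assms(1) by simp
    obtain t where "?g 1 - ?g 0 = (1 - 0) * (Re h * pderiv_dir 1 f (z + of_real t * h) + Im h * pderiv_dir \<i> f (z + of_real t * h))"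
      using MVT2[of 0 1 ?g, OF _ D] by auto
    then have "\<bar>f (z + h) - f z\<bar> \<le> \<bar>Re h\<bar> * \<bar>pderiv_dir 1 f (z + of_real t * h)\<bar> + \<bar>Im h\<bar> * \<bar>pderiv_dir \<i> f (z + of_real t * h)\<bar>"
      by (simp add: abs_mult[symmetric])
    also have "\<dots> \<le> cmod h * B1 + cmod h * B2"
      by (intro add_mono mult_mono B abs_Re_le_cmod abs_Im_le_cmod) auto
    finally show ?thesis by (simp add: algebra_simps)
  qed
  then show ?thesis using that[of "B1 + B2"] B by auto
qed

text \<open>In the Taylor polynomial of order two the linear and mixed terms average to 0 and the
  pure squares to 1/2 each, leaving s^2/4 times the Laplacian. Compact support makes the second
  derivatives globally Lipschitz, hence the cubic remainder uniform in \<open>z\<close>.\<close>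

lemma circ_mean_laplacian:
  assumes "\<And>n. C_k n f" "compact K" "\<And>z. z \<notin> K \<Longrightarrow> f z = 0"
  obtains C where "0 \<le> C"
    "\<And>z s. s \<noteq> 0 \<Longrightarrow> \<bar>4 / s\<^sup>2 * ((\<integral>x. f (z + of_real s * x) \<partial>circ) - f z) - laplacian f z\<bar> \<le> C * \<bar>s\<bar>"
proof -
  let ?P = "pderiv_dir 1" and ?Q = "pderiv_dir \<i>"
  have cl: "closed K" using assms(2) by (rule compact_imp_closed)
  have C: "C_k n (?P f)" "C_k n (?Q f)" "C_k n (?P (?P f))" "C_k n (?Q (?P f))" "C_k n (?P (?Q f))" "C_k n (?Q (?Q f))" for n
    using assms(1)[of "Suc (Suc n)"] assms(1)[of "Suc n"] by auto
  have Z: "pderiv_dir d f z = 0" "pderiv_dir e (pderiv_dir d f) z = 0" if "z \<notin> K" for d e z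
    using pderiv_dir_zero_outside[OF cl assms(3)] pderiv_dir_zero_outside[OF cl _ that, of "pderiv_dir d f"] that
    by auto
  obtain B1 where B1: "0 \<le> B1" "\<And>z h. \<bar>?P (?P f) (z + h) - ?P (?P f) z\<bar> \<le> B1 * cmod h"
    using C_k_Lipschitz[of "?P (?P f)" K] C Z assms(2) by metis
  obtain B2 where B2: "0 \<le> B2" "\<And>z h. \<bar>?Q (?P f) (z + h) - ?Q (?P f) z\<bar> \<le> B2 * cmod h"
    using C_k_Lipschitz[of "?Q (?P f)" K] C Z assms(2) by metis
  obtain B3 where B3: "0 \<le> B3" "\<And>z h. \<bar>?P (?Q f) (z + h) - ?P (?Q f) z\<bar> \<le> B3 * cmod h"
    using C_k_Lipschitz[of "?P (?Q f)" K] C Z assms(2) by metis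
  obtain B4 where B4: "0 \<le> B4" "\<And>z h. \<bar>?Q (?Q f) (z + h) - ?Q (?Q f) z\<bar> \<le> B4 * cmod h"
    using C_k_Lipschitz[of "?Q (?Q f)" K] C Z assms(2) by metis
  define B where "B = B1 + B2 + B3 + B4"
  define T2 where "T2 h w = Re h * (Re h * ?P (?P f) w + Im h * ?Q (?P f) w) + Im h * (Re h * ?P (?Q f) w + Im h * ?Q (?Q f) w)" for h w
  define T where "T z h = f z + (Re h * ?P f z + Im h * ?Q f z) + T2 h z / 2" for z h
  \<comment> \<open>The Lagrange remainder evaluates the second-order form \<open>T2\<close> at an
    intermediate point; replacing that point by \<open>z\<close> costs one Lipschitz factor, which
    makes the error cubic in h.\<close>
  have taylor: "\<bar>f (z + h) - T z h\<bar> \<le> B / 2 * cmod h ^ 3" for z h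
  proof -
    define diff where "diff m = (\<lambda>t. if m = (0::nat) then f (z + of_real t * h)
       else if m = 1 then Re h * ?P f (z + of_real t * h) + Im h * ?Q f (z + of_real t * h)
       else T2 h (z + of_real t * h))" for m
    have "\<forall>m t. m < 2 \<and> 0 \<le> t \<and> t \<le> 1 \<longrightarrow> DERIV (diff m) t :> diff (Suc m) t"
    proof (intro allI impI, elim conjE)
      fix m :: nat and t :: real assume "m < 2"
      then consider "m = 0" | "m = 1" by linarith
      then show "DERIV (diff m) t :> diff (Suc m) t"
      proof cases
        case 1
        then show ?thesis using C_k_line_derivative[OF assms(1)] by (simp add: diff_def)
      next
        case 2
        then show ?thesis
          by (auto simp: diff_def T2_def intro!: derivative_eq_intros C_k_line_derivative C) 
      qed
    qed
    then obtain t where t: "0 < t" "t < 1"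
      "f (z + of_real 1 * h) = (\<Sum>m<2. diff m 0 / fact m * 1 ^ m) + diff 2 t / fact 2 * 1 ^ 2"
      using Maclaurin[of 1 2 diff "\<lambda>t. f (z + of_real t * h)"] by (auto simp: diff_def)
    then have e1: "f (z + h) - T z h = (T2 h (z + of_real t * h) - T2 h z) / 2"
      by (simp add: diff_def T_def numeral_2_eq_2 diff_divide_distrib)
    have e2: "T2 h (z + of_real t * h) - T2 h z =
       Re h * Re h * (?P (?P f) (z + of_real t * h) - ?P (?P f) z) + Re h * Im h * (?Q (?P f) (z + of_real t * h) - ?Q (?P f) z)
       + Im h * Re h * (?P (?Q f) (z + of_real t * h) - ?P (?Q f) z) + Im h * Im h * (?Q (?Q f) (z + of_real t * h) - ?Q (?Q f) z)"
      by (simp add: T2_def algebra_simps)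
    have "\<bar>f (z + h) - T z h\<bar> \<le> (cmod h * cmod h * (B1 * cmod h) + cmod h * cmod h * (B2 * cmod h)
        + cmod h * cmod h * (B3 * cmod h) + cmod h * cmod h * (B4 * cmod h)) / 2"
    proof -
      have th: "cmod (of_real t * h) \<le> cmod h" using t by (simp add: norm_mult mult_left_le_one_le)
      have *: "\<bar>a * b * c\<bar> \<le> cmod h * cmod h * (D * cmod h)"
        if "\<bar>a\<bar> \<le> cmod h" "\<bar>b\<bar> \<le> cmod h" "\<bar>c\<bar> \<le> D * cmod (of_real t * h)" "0 \<le> D" for a b c D
      proof -
        have "\<bar>c\<bar> \<le> D * cmod h" using that th by (meson mult_left_mono order_trans)
        then show ?thesis unfolding abs_mult using that by (intro mult_mono) auto
      qed
      note a = abs_Re_le_cmod[of h] abs_Im_le_cmod[of h]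
      have sum4: "\<bar>(p + q + r + s) / 2\<bar> \<le> (P + Q + R + S) / 2"
        if "\<bar>p\<bar> \<le> P" "\<bar>q\<bar> \<le> Q" "\<bar>r\<bar> \<le> R" "\<bar>s\<bar> \<le> S" for p q r s P Q R S :: real
        using that by (auto simp: abs_le_iff)
      show ?thesis
        unfolding e1 e2
        by (rule sum4[OF *[OF a(1) a(1) B1(2) B1(1)] *[OF a(1) a(2) B2(2) B2(1)]
              *[OF a(2) a(1) B3(2) B3(1)] *[OF a(2) a(2) B4(2) B4(1)]])
    qed
    also have "\<dots> = B / 2 * cmod h ^ 3" by (simp add: B_def power3_eq_cube algebra_simps)
    finally show ?thesis .
  qed
  have cont: "continuous_on UNIV f" using assms(1)[of 0] by simp
  then have fm[measurable]: "f \<in> borel_measurable borel" by (rule borel_measurable_continuous_onI)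
  obtain Bf where Bf: "\<And>z. \<bar>f z\<bar> \<le> Bf" using C_k_bounded[OF assms(1) assms(2,3)] by metis
  \<comment> \<open>The cubic error B/2 * \<bar>s\<bar>^3, multiplied by 4/s^2, is where 2 * B *
    \<bar>s\<bar> comes from.\<close>
  have bd: "\<bar>4 / s\<^sup>2 * ((\<integral>x. f (z + of_real s * x) \<partial>circ) - f z) - laplacian f z\<bar> \<le> 2 * B * \<bar>s\<bar>"
    if s: "s \<noteq> 0" for z s
  proof -
    have i1: "integrable circ (\<lambda>x. f (z + of_real s * x))"
      using Bf by (intro integrable_circ[of _ Bf]) auto
    have ii: "integrable circ Re" "integrable circ Im" "integrable circ (\<lambda>x. (Re x)\<^sup>2)" "integrable circ (\<lambda>x. (Im x)\<^sup>2)" "integrable circ (\<lambda>x. Re x * Im x)"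
    proof -
      have n: "\<bar>Re x\<bar> \<le> 1" "\<bar>Im x\<bar> \<le> 1" if "cmod x = 1" for x
        using that abs_Re_le_cmod[of x] abs_Im_le_cmod[of x] by auto
      have m: "Re x * Re x \<le> 1" "Im x * Im x \<le> 1" "\<bar>Re x\<bar> * \<bar>Im x\<bar> \<le> 1" if "cmod x = 1" for x
        using mult_le_one[OF n(1)[OF that] _ n(1)[OF that]] mult_le_one[OF n(2)[OF that] _ n(2)[OF that]]
          mult_le_one[OF n(1)[OF that] _ n(2)[OF that]] by auto
      show "integrable circ Re" "integrable circ Im" "integrable circ (\<lambda>x. (Re x)\<^sup>2)" "integrable circ (\<lambda>x. (Im x)\<^sup>2)" "integrable circ (\<lambda>x. Re x * Im x)"
        by (auto intro!: integrable_circ[of _ 1] n m simp: abs_mult power2_eq_square)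
    qed
    have Texp: "T z (of_real s * x) = f z + s * ?P f z * Re x + s * ?Q f z * Im x + s\<^sup>2 / 2 * ?P (?P f) z * (Re x)\<^sup>2
        + s\<^sup>2 / 2 * (?Q (?P f) z + ?P (?Q f) z) * (Re x * Im x) + s\<^sup>2 / 2 * ?Q (?Q f) z * (Im x)\<^sup>2" for x
      by (simp add: T_def T2_def power2_eq_square algebra_simps add_divide_distrib)
    have i2: "integrable circ (\<lambda>x. T z (of_real s * x))"
      unfolding Texp by (intro Bochner_Integration.integrable_add integrable_mult_right ii) auto
    have "(\<integral>x. T z (of_real s * x) \<partial>circ) = f z + s\<^sup>2 / 4 * laplacian f z"
    proof -
      have "(\<integral>x. T z (of_real s * x) \<partial>circ) = f z + s * ?P f z * (\<integral>x. Re x \<partial>circ) + s * ?Q f z * (\<integral>x. Im x \<partial>circ)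
          + s\<^sup>2 / 2 * ?P (?P f) z * (\<integral>x. (Re x)\<^sup>2 \<partial>circ)
          + s\<^sup>2 / 2 * (?Q (?P f) z + ?P (?Q f) z) * (\<integral>x. Re x * Im x \<partial>circ)
          + s\<^sup>2 / 2 * ?Q (?Q f) z * (\<integral>x. (Im x)\<^sup>2 \<partial>circ)"
        unfolding Texp using ii by simp
      then show ?thesis unfolding circ_moments by (simp add: laplacian_def algebra_simps)
    qed
    then have "(\<integral>x. f (z + of_real s * x) \<partial>circ) - f z - s\<^sup>2 / 4 * laplacian f z
        = (\<integral>x. f (z + of_real s * x) - T z (of_real s * x) \<partial>circ)"
      using i1 i2 by simp
    also have "\<bar>\<dots>\<bar> \<le> (\<integral>x. \<bar>f (z + of_real s * x) - T z (of_real s * x)\<bar> \<partial>circ)"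
      by (rule integral_abs_bound)
    also have "\<dots> \<le> (\<integral>x. B / 2 * \<bar>s\<bar> ^ 3 \<partial>circ)"
    proof (rule integral_mono_AE)
      show "AE x in circ. \<bar>f (z + of_real s * x) - T z (of_real s * x)\<bar> \<le> B / 2 * \<bar>s\<bar> ^ 3"
        using AE_circ
      proof eventually_elim
        case (elim x)
        then show ?case using taylor[of z "of_real s * x"] by (simp add: norm_mult)
      qed
    qed (use i1 i2 in auto)
    also have "\<dots> = B / 2 * \<bar>s\<bar> ^ 3" by simp
    finally have "\<bar>(\<integral>x. f (z + of_real s * x) \<partial>circ) - f z - s\<^sup>2 / 4 * laplacian f z\<bar> \<le> B / 2 * \<bar>s\<bar> ^ 3" .
    then have "4 / s\<^sup>2 * \<bar>(\<integral>x. f (z + of_real s * x) \<partial>circ) - f z - s\<^sup>2 / 4 * laplacian f z\<bar> \<le> 4 / s\<^sup>2 * (B / 2 * \<bar>s\<bar> ^ 3)"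
      by (intro mult_left_mono) auto
    also have "\<dots> = 2 * B * \<bar>s\<bar>"
      using s by (simp add: power3_eq_cube power2_eq_square abs_if field_simps)
    also have "4 / s\<^sup>2 * \<bar>(\<integral>x. f (z + of_real s * x) \<partial>circ) - f z - s\<^sup>2 / 4 * laplacian f z\<bar>
        = \<bar>4 / s\<^sup>2 * ((\<integral>x. f (z + of_real s * x) \<partial>circ) - f z - s\<^sup>2 / 4 * laplacian f z)\<bar>"
      by (simp only: abs_mult) simp
    also have "4 / s\<^sup>2 * ((\<integral>x. f (z + of_real s * x) \<partial>circ) - f z - s\<^sup>2 / 4 * laplacian f z)
        = 4 / s\<^sup>2 * ((\<integral>x. f (z + of_real s * x) \<partial>circ) - f z) - laplacian f z"
      using s by (simp add: field_simps)
    finally show ?thesis .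
  qed
  have "0 \<le> 2 * B" using B1 B2 B3 B4 by (simp add: B_def)
  then show ?thesis using that bd by blast
qed

section \<open>Circle means and the Laplacian\<close>

lemma integrable_lborel_translate:
  fixes f :: "'a::euclidean_space \<Rightarrow> real"
  assumes "integrable lborel f"
  shows "integrable lborel (\<lambda>y. f (y + a))"
proof -
  have "integrable (distr lborel borel ((+) a)) f"
    using assms by (simp add: lborel_distr_plus)
  then show ?thesis by (subst (asm) integrable_distr_eq) (use assms in \<open>auto simp: add.commute\<close>)
qed

lemma integral_lborel_translate:
  fixes f :: "'a::euclidean_space \<Rightarrow> real"
  assumes "f \<in> borel_measurable borel"
  shows "(\<integral>y. f (y + a) \<partial>lborel) = (\<integral>y. f y \<partial>lborel)"
proof -
  have "(\<integral>y. f y \<partial>distr lborel borel ((+) a)) = (\<integral>y. f (a + y) \<partial>lborel)"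
    by (rule integral_distr) (use assms in auto)
  then show ?thesis by (simp add: lborel_distr_plus add.commute)
qed

interpretation circ_lborel: pair_sigma_finite circ "lborel :: complex measure"
  by (intro pair_sigma_finite.intro circ.sigma_finite_measure_axioms lborel.sigma_finite_measure_axioms)

text \<open>Both factors carry a shift so that one statement serves the two sides of
  \<open>circ_mean_swap\<close>: setting one of the shifts to 0 leaves only the other factor
  translated.\<close>

lemma integrable_circ_lborel:
  fixes w f :: "complex \<Rightarrow> real"
  assumes w: "integrable lborel w" and f[measurable]: "f \<in> borel_measurable borel" and B: "\<And>z. \<bar>f z\<bar> \<le> B"
  shows "integrable (circ \<Otimes>\<^sub>M lborel) (\<lambda>(x, y). w (y + s * x) * f (y + r * x))"
proof (rule circ_lborel.Fubini_integrable)
  have wm[measurable]: "w \<in> borel_measurable borel" using w by auto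
  show "(\<lambda>(x, y). w (y + s * x) * f (y + r * x)) \<in> borel_measurable (circ \<Otimes>\<^sub>M lborel)"
    by measurable
  have i: "integrable lborel (\<lambda>y. w (y + s * x) * f (y + r * x))" for x
  proof (rule Bochner_Integration.integrable_bound)
    show "integrable lborel (\<lambda>y. B * \<bar>w (y + s * x)\<bar>)"
      using integrable_lborel_translate[OF w, of "s * x"] by auto
    show "AE y in lborel. norm (w (y + s * x) * f (y + r * x)) \<le> norm (B * \<bar>w (y + s * x)\<bar>)"
    proof (rule AE_I2)
      fix y
      have "B \<ge> 0" using B[of 0] by linarith
      then show "norm (w (y + s * x) * f (y + r * x)) \<le> norm (B * \<bar>w (y + s * x)\<bar>)"
        using B[of "y + r * x"] by (simp add: abs_mult mult.commute mult_right_mono)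
    qed
  qed measurable
  then show "AE x in circ. integrable lborel (\<lambda>y. case (x, y) of (x, y) \<Rightarrow> w (y + s * x) * f (y + r * x))"
    by simp
  show "integrable circ (\<lambda>x. \<integral>y. norm (case (x, y) of (x, y) \<Rightarrow> w (y + s * x) * f (y + r * x)) \<partial>lborel)"
  proof (rule integrable_circ[of _ "B * (\<integral>y. \<bar>w y\<bar> \<partial>lborel)"])
    show "(\<lambda>x. \<integral>y. norm (case (x, y) of (x, y) \<Rightarrow> w (y + s * x) * f (y + r * x)) \<partial>lborel) \<in> borel_measurable borel"
      by measurable
    fix x :: complex
    have "(\<integral>y. \<bar>w (y + s * x) * f (y + r * x)\<bar> \<partial>lborel) \<le> (\<integral>y. B * \<bar>w (y + s * x)\<bar> \<partial>lborel)"
    proof (rule integral_mono)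
      show "integrable lborel (\<lambda>y. B * \<bar>w (y + s * x)\<bar>)"
        using integrable_lborel_translate[OF w, of "s * x"] by auto
      show "\<bar>w (y + s * x) * f (y + r * x)\<bar> \<le> B * \<bar>w (y + s * x)\<bar>" for y
        using B[of "y + r * x"] by (simp add: abs_mult mult.commute mult_right_mono)
    qed (use i in auto)
    also have "\<dots> = B * (\<integral>y. \<bar>w y\<bar> \<partial>lborel)"
      by (simp add: integral_lborel_translate[of "\<lambda>y. \<bar>w y\<bar>"])
    finally show "norm (\<integral>y. norm (case (x, y) of (x, y) \<Rightarrow> w (y + s * x) * f (y + r * x)) \<partial>lborel) \<le> B * (\<integral>y. \<bar>w y\<bar> \<partial>lborel)"
      by simp
  qed
qed

text \<open>After Fubini, for fixed \<open>x\<close> the substitution y -> y + s * x moves the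
  translation from \<open>f\<close> to \<open>w\<close>. This is the symmetry of the averaging
  operator.\<close>

lemma circ_mean_swap:
  fixes w f :: "complex \<Rightarrow> real"
  assumes w: "integrable lborel w" and f[measurable]: "f \<in> borel_measurable borel" and B: "\<And>z. \<bar>f z\<bar> \<le> B"
  shows "(\<integral>y. w y * (\<integral>x. f (y + (- s) * x) \<partial>circ) \<partial>lborel) = (\<integral>y. f y * (\<integral>x. w (y + s * x) \<partial>circ) \<partial>lborel)"
    and "integrable lborel (\<lambda>y. f y * (\<integral>x. w (y + s * x) \<partial>circ))"
    and "integrable lborel (\<lambda>y. w y * (\<integral>x. f (y + s * x) \<partial>circ))"
proof -
  have wm[measurable]: "w \<in> borel_measurable borel" using w by auto
  have i1: "integrable (circ \<Otimes>\<^sub>M lborel) (\<lambda>(x, y). w y * f (y + r * x))" for r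
    using integrable_circ_lborel[OF w f B, of 0 r] by simp
  have i2: "integrable (circ \<Otimes>\<^sub>M lborel) (\<lambda>(x, y). f y * w (y + s * x))"
    using integrable_circ_lborel[OF w f B, of s 0] by (simp add: mult.commute)
  have "(\<integral>y. w y * (\<integral>x. f (y + (- s) * x) \<partial>circ) \<partial>lborel) = (\<integral>y. (\<integral>x. w y * f (y + (- s) * x) \<partial>circ) \<partial>lborel)"
    by simp
  also have "\<dots> = (\<integral>x. (\<integral>y. w y * f (y + (- s) * x) \<partial>lborel) \<partial>circ)"
    by (rule circ_lborel.Fubini_integral[OF i1])
  also have "\<dots> = (\<integral>x. (\<integral>y. f y * w (y + s * x) \<partial>lborel) \<partial>circ)"
  proof (rule Bochner_Integration.integral_cong[OF refl])
    fix x
    show "(\<integral>y. w y * f (y + (- s) * x) \<partial>lborel) = (\<integral>y. f y * w (y + s * x) \<partial>lborel)"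
      by (subst integral_lborel_translate[symmetric, of _ "s * x"]) (auto simp: mult.commute)
  qed
  also have "\<dots> = (\<integral>y. (\<integral>x. f y * w (y + s * x) \<partial>circ) \<partial>lborel)"
    by (rule circ_lborel.Fubini_integral[OF i2, symmetric])
  finally show "(\<integral>y. w y * (\<integral>x. f (y + (- s) * x) \<partial>circ) \<partial>lborel) = (\<integral>y. f y * (\<integral>x. w (y + s * x) \<partial>circ) \<partial>lborel)"
    by simp
  show "integrable lborel (\<lambda>y. f y * (\<integral>x. w (y + s * x) \<partial>circ))"
    using circ_lborel.integrable_snd[OF i2] by simp
  show "integrable lborel (\<lambda>y. w y * (\<integral>x. f (y + s * x) \<partial>circ))"
    using circ_lborel.integrable_snd[OF i1] by simp
qed

lemma integrable_mult_bounded: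
  fixes w f :: "'a \<Rightarrow> real"
  assumes "integrable M w" "f \<in> borel_measurable M" "\<And>z. \<bar>f z\<bar> \<le> B"
  shows "integrable M (\<lambda>z. w z * f z)"
proof (rule Bochner_Integration.integrable_bound)
  show "integrable M (\<lambda>y. B * w y)" using assms(1) by simp
  show "AE y in M. norm (w y * f y) \<le> norm (B * w y)"
  proof (rule AE_I2)
    fix y
    have "0 \<le> \<bar>f y\<bar>" "\<bar>f y\<bar> \<le> B" using assms(3) by auto
    then show "norm (w y * f y) \<le> norm (B * w y)"
      by (simp add: abs_mult mult.commute mult_right_mono)
  qed
qed (use assms in measurable)

lemma smooth_compact_support_facts:
  assumes "smooth_compact_support W f"
  obtains K B where "\<And>n. C_k n f" "compact K" "K \<subseteq> W" "\<And>z. z \<notin> K \<Longrightarrow> f z = 0"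
    "f \<in> borel_measurable borel" "\<And>z. \<bar>f z\<bar> \<le> B" "laplacian f \<in> borel_measurable borel" "\<And>z. \<bar>laplacian f z\<bar> \<le> B"
proof -
  obtain K where K: "\<And>n. C_k n f" "compact K" "K \<subseteq> W" "\<And>z. z \<notin> K \<Longrightarrow> f z = 0"
    using assms by (auto simp: smooth_compact_support_def)
  have c: "continuous_on UNIV f" using K(1)[of 0] by simp
  have "C_k 0 (pderiv_dir 1 (pderiv_dir 1 f))" "C_k 0 (pderiv_dir \<i> (pderiv_dir \<i> f))"
    using K(1)[of 2] by (auto simp: numeral_2_eq_2)
  then have l: "C_k 0 (laplacian f)"
    unfolding laplacian_def[abs_def] by (rule C_k_add)
  have z: "laplacian f z = 0" if "z \<notin> K" for z
    by (rule laplacian_zero_outside[OF compact_imp_closed[OF K(2)] K(4) that])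
  obtain B1 where B1: "\<And>z. \<bar>f z\<bar> \<le> B1" "0 \<le> B1" using C_k_bounded[OF K(1) K(2) K(4)] by metis
  obtain B2 where B2: "\<And>z. \<bar>laplacian f z\<bar> \<le> B2" "0 \<le> B2" using C_k_bounded[OF l K(2) z] by metis
  show ?thesis
  proof (rule that[OF K, of "max B1 B2"])
    show "f \<in> borel_measurable borel" "laplacian f \<in> borel_measurable borel"
      using c l by (auto intro: borel_measurable_continuous_onI)
    show "\<bar>f z\<bar> \<le> max B1 B2" "\<bar>laplacian f z\<bar> \<le> max B1 B2" for z
      using B1(1)[of z] B2(1)[of z] by auto
  qed
qed

text \<open>The Laplacian is the limit of \<open>4 / s\<^sup>2\<close> times (circle mean minus identity), and this operator
  is symmetric. So the Laplacian of a test function can be moved to an arbitrary integrable \<open>w\<close>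
  in the form of circle means.\<close>

lemma integral_laplacian_limit:
  fixes w f :: "complex \<Rightarrow> real"
  assumes w: "integrable lborel w" and f: "smooth_compact_support W f"
  shows "((\<lambda>s. 4 / s\<^sup>2 * (\<integral>y. f y * ((\<integral>x. w (y + of_real s * x) \<partial>circ) - w y) \<partial>lborel))
           \<longlongrightarrow> (\<integral>y. w y * laplacian f y \<partial>lborel)) (at_right 0)"
proof -
  obtain K B where K: "\<And>n. C_k n f" "compact K" "\<And>z. z \<notin> K \<Longrightarrow> f z = 0"
    and fm[measurable]: "f \<in> borel_measurable borel" and B: "\<And>z. \<bar>f z\<bar> \<le> B"
    and lm[measurable]: "laplacian f \<in> borel_measurable borel" and lB: "\<And>z. \<bar>laplacian f z\<bar> \<le> B"
    using smooth_compact_support_facts[OF f] by metis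
  obtain C where C: "0 \<le> C"
    "\<And>z s. s \<noteq> 0 \<Longrightarrow> \<bar>4 / s\<^sup>2 * ((\<integral>x. f (z + of_real s * x) \<partial>circ) - f z) - laplacian f z\<bar> \<le> C * \<bar>s\<bar>"
    using circ_mean_laplacian[OF K] by metis
  have wm[measurable]: "w \<in> borel_measurable borel" using w by auto
  have il: "integrable lborel (\<lambda>y. w y * laplacian f y)"
    by (rule integrable_mult_bounded[OF w _ lB]) simp
  have iF: "integrable lborel (\<lambda>y. w y * f y)"
    by (rule integrable_mult_bounded[OF w _ B]) simp
  define A where "A = (\<integral>y. w y * laplacian f y \<partial>lborel)"
  define G where "G s = 4 / s\<^sup>2 * (\<integral>y. f y * ((\<integral>x. w (y + of_real s * x) \<partial>circ) - w y) \<partial>lborel)" for s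
  have bd: "\<bar>G s - A\<bar> \<le> C * s * (\<integral>y. \<bar>w y\<bar> \<partial>lborel)" if s: "0 < s" for s
  proof -
    have i3: "integrable lborel (\<lambda>y. w y * (\<integral>x. f (y + of_real (- s) * x) \<partial>circ))"
      by (rule circ_mean_swap(3)[OF w fm B])
    have "(\<integral>y. f y * ((\<integral>x. w (y + of_real s * x) \<partial>circ) - w y) \<partial>lborel)
       = (\<integral>y. f y * (\<integral>x. w (y + of_real s * x) \<partial>circ) - f y * w y \<partial>lborel)"
      by (simp add: right_diff_distrib)
    also have "\<dots> = (\<integral>y. f y * (\<integral>x. w (y + of_real s * x) \<partial>circ) \<partial>lborel) - (\<integral>y. f y * w y \<partial>lborel)"
      by (rule Bochner_Integration.integral_diff[OF circ_mean_swap(2)[OF w fm B]])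
         (use iF in \<open>simp add: mult.commute\<close>)
    also have "\<dots> = (\<integral>y. w y * (\<integral>x. f (y + of_real (- s) * x) \<partial>circ) \<partial>lborel) - (\<integral>y. w y * f y \<partial>lborel)"
      using circ_mean_swap(1)[OF w fm B, of "of_real s"] by (simp add: mult.commute)
    also have "\<dots> = (\<integral>y. w y * ((\<integral>x. f (y + of_real (- s) * x) \<partial>circ) - f y) \<partial>lborel)"
      using i3 iF by (simp add: right_diff_distrib)
    \<comment> \<open>The mean now falls on the smooth \<open>f\<close>, where the error is uniform.
      The radius has become -s, but the normalising factor depends on s^2 only and the error on
      \<bar>s\<bar>.\<close>
    finally have "G s = (\<integral>y. w y * (4 / s\<^sup>2 * ((\<integral>x. f (y + of_real (- s) * x) \<partial>circ) - f y)) \<partial>lborel)"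
      unfolding G_def by (simp flip: integral_mult_right_zero add: mult_ac)
    moreover have i4: "integrable lborel (\<lambda>y. w y * (4 / s\<^sup>2 * ((\<integral>x. f (y + of_real (- s) * x) \<partial>circ) - f y)))"
    proof -
      have "integrable lborel (\<lambda>y. 4 / s\<^sup>2 * (w y * (\<integral>x. f (y + of_real (- s) * x) \<partial>circ) - w y * f y))"
        using i3 iF by auto
      then show ?thesis by (simp add: algebra_simps)
    qed
    ultimately have eq: "G s - A = (\<integral>y. w y * (4 / s\<^sup>2 * ((\<integral>x. f (y + of_real (- s) * x) \<partial>circ) - f y) - laplacian f y) \<partial>lborel)"
      using il unfolding A_def by (simp add: right_diff_distrib)
    have i5: "integrable lborel (\<lambda>y. w y * (4 / s\<^sup>2 * ((\<integral>x. f (y + of_real (- s) * x) \<partial>circ) - f y) - laplacian f y))"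
      using i4 il by (subst right_diff_distrib) auto
    have "\<bar>G s - A\<bar> \<le> (\<integral>y. \<bar>w y * (4 / s\<^sup>2 * ((\<integral>x. f (y + of_real (- s) * x) \<partial>circ) - f y) - laplacian f y)\<bar> \<partial>lborel)"
      unfolding eq by (rule integral_abs_bound)
    also have "\<dots> \<le> (\<integral>y. C * s * \<bar>w y\<bar> \<partial>lborel)"
    proof (rule integral_mono)
      fix y
      have "\<bar>4 / s\<^sup>2 * ((\<integral>x. f (y + of_real (- s) * x) \<partial>circ) - f y) - laplacian f y\<bar> \<le> C * s"
        using C(2)[of "- s" y] s by simp
      then show "\<bar>w y * (4 / s\<^sup>2 * ((\<integral>x. f (y + of_real (- s) * x) \<partial>circ) - f y) - laplacian f y)\<bar> \<le> C * s * \<bar>w y\<bar>"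
        by (simp add: abs_mult mult.commute mult_left_mono)
    qed (use i5 w in auto)
    also have "\<dots> = C * s * (\<integral>y. \<bar>w y\<bar> \<partial>lborel)" by simp
    finally show ?thesis .
  qed
  have "((\<lambda>s. G s - A) \<longlongrightarrow> 0) (at_right 0)"
  proof (rule Lim_null_comparison)
    show "\<forall>\<^sub>F s in at_right 0. norm (G s - A) \<le> C * s * (\<integral>y. \<bar>w y\<bar> \<partial>lborel)"
      using eventually_at_right_less[of 0] by eventually_elim (use bd in simp)
    show "((\<lambda>s. C * s * (\<integral>y. \<bar>w y\<bar> \<partial>lborel)) \<longlongrightarrow> 0) (at_right 0)"
      by (auto intro!: tendsto_eq_intros)
  qed
  then show ?thesis unfolding G_def A_def by (rule LIM_zero_cancel)
qed

section \<open>Mollification\<close>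

text \<open>Two uses are intended: \<open>M\<close> a finite measure with \<open>g = 1\<close> and a
  mollifier \<open>k\<close>, and \<open>M = lborel\<close> with \<open>g\<close> one of the
  functions \<open>U1\<close>, \<open>U2\<close> and \<open>k\<close> the Laplacian of a
  mollifier.\<close>

lemma convolution_Fubini:
  fixes g w k :: "complex \<Rightarrow> real" and M :: "complex measure"
  assumes M: "sigma_finite_measure M" and sM[measurable_cong]: "sets M = sets borel"
    and g: "integrable M g" and w: "integrable lborel w"
    and k[measurable]: "k \<in> borel_measurable borel" and B: "\<And>z. \<bar>k z\<bar> \<le> B"
  shows "(\<integral>z. g z * (\<integral>y. w y * k (y - z) \<partial>lborel) \<partial>M) = (\<integral>y. w y * (\<integral>z. g z * k (y - z) \<partial>M) \<partial>lborel)"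
    and "integrable M (\<lambda>z. g z * (\<integral>y. w y * k (y - z) \<partial>lborel))"
    and "integrable lborel (\<lambda>y. w y * (\<integral>z. g z * k (y - z) \<partial>M))"
proof -
  interpret M: sigma_finite_measure M by (rule M)
  interpret P: pair_sigma_finite M "lborel :: complex measure"
    by (intro pair_sigma_finite.intro M lborel.sigma_finite_measure_axioms)
  have wm[measurable]: "w \<in> borel_measurable borel" using w by auto
  have gm[measurable]: "g \<in> borel_measurable M" using g by auto
  have i0: "integrable lborel (\<lambda>y. w y * k (y - z))" for z
    by (rule integrable_mult_bounded[OF w _ B]) measurable
  have I: "integrable (M \<Otimes>\<^sub>M lborel) (\<lambda>(z, y). g z * (w y * k (y - z)))"
  proof (rule P.Fubini_integrable)
    show "AE z in M. integrable lborel (\<lambda>y. case (z, y) of (z, y) \<Rightarrow> g z * (w y * k (y - z)))"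
      using i0 by simp
    have "integrable M (\<lambda>z. g z * (\<integral>y. \<bar>w y * k (y - z)\<bar> \<partial>lborel))"
    proof (rule integrable_mult_bounded[OF g])
      show "(\<lambda>z. \<integral>y. \<bar>w y * k (y - z)\<bar> \<partial>lborel) \<in> borel_measurable M"
        by measurable
      fix z
      have "(\<integral>y. \<bar>w y * k (y - z)\<bar> \<partial>lborel) \<le> (\<integral>y. B * \<bar>w y\<bar> \<partial>lborel)"
      proof (rule integral_mono)
        show "integrable lborel (\<lambda>y. \<bar>w y * k (y - z)\<bar>)" by (intro integrable_abs i0)
        show "\<bar>w y * k (y - z)\<bar> \<le> B * \<bar>w y\<bar>" for y
          using mult_right_mono[OF B[of "y - z"], of "\<bar>w y\<bar>"] by (simp add: abs_mult mult.commute)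
      qed (use w in auto)
      then show "\<bar>\<integral>y. \<bar>w y * k (y - z)\<bar> \<partial>lborel\<bar> \<le> (\<integral>y. B * \<bar>w y\<bar> \<partial>lborel)"
        by simp
    qed
    then have "integrable M (\<lambda>z. \<bar>g z * (\<integral>y. \<bar>w y * k (y - z)\<bar> \<partial>lborel)\<bar>)" by auto
    then show "integrable M (\<lambda>z. \<integral>y. norm (case (z, y) of (z, y) \<Rightarrow> g z * (w y * k (y - z))) \<partial>lborel)"
      by (simp add: abs_mult)
  qed measurable
  then have I': "integrable (M \<Otimes>\<^sub>M lborel) (\<lambda>(z, y). w y * (g z * k (y - z)))"
    by (simp add: mult.left_commute)
  show "(\<integral>z. g z * (\<integral>y. w y * k (y - z) \<partial>lborel) \<partial>M) = (\<integral>y. w y * (\<integral>z. g z * k (y - z) \<partial>M) \<partial>lborel)"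
  proof -
    have "(\<integral>y. w y * (\<integral>z. g z * k (y - z) \<partial>M) \<partial>lborel) = (\<integral>y. (\<integral>z. w y * (g z * k (y - z)) \<partial>M) \<partial>lborel)"
      by simp
    also have "\<dots> = (\<integral>y. (\<integral>z. g z * (w y * k (y - z)) \<partial>M) \<partial>lborel)"
      by (intro Bochner_Integration.integral_cong refl mult.left_commute)
    also have "\<dots> = (\<integral>z. (\<integral>y. g z * (w y * k (y - z)) \<partial>lborel) \<partial>M)"
      by (rule P.Fubini_integral[OF I])
    finally show ?thesis by simp
  qed
  show "integrable M (\<lambda>z. g z * (\<integral>y. w y * k (y - z) \<partial>lborel))"
    using P.integrable_fst[OF I] by simp
  show "integrable lborel (\<lambda>y. w y * (\<integral>z. g z * k (y - z) \<partial>M))"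
    using P.integrable_snd[OF I'] by simp
qed

text \<open>As \<open>\<rho>\<close> is radial, the convolution does not change when the integrand is rotated about \<open>z\<close>;
  averaging over all rotations turns it into an average of circle means.\<close>

lemma mollify_ge:
  fixes w \<rho> :: "complex \<Rightarrow> real"
  assumes w[measurable]: "w \<in> borel_measurable borel" and wb: "\<And>z. 0 \<le> w z" "\<And>z. w z \<le> C"
    and \<rho>: "integrable lborel \<rho>" "\<And>z. 0 \<le> \<rho> z" "\<And>z. \<delta> \<le> cmod z \<Longrightarrow> \<rho> z = 0"
      "\<And>z w. cmod z = cmod w \<Longrightarrow> \<rho> z = \<rho> w" "(\<integral>z. \<rho> z \<partial>lborel) = 1"
    and c0: "0 \<le> c0" and mean: "\<And>s. 0 < s \<Longrightarrow> s < \<delta> \<Longrightarrow> w z - c0 * s\<^sup>2 \<le> (\<integral>x. w (z + of_real s * x) \<partial>circ)"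
  shows "w z - c0 * \<delta>\<^sup>2 \<le> (\<integral>y. w y * \<rho> (y - z) \<partial>lborel)"
proof -
  have \<rho>m[measurable]: "\<rho> \<in> borel_measurable borel" using \<rho>(1) by auto
  have rot: "(\<integral>y. w (z + x * y) * \<rho> y \<partial>lborel) = (\<integral>y. w (z + y) * \<rho> y \<partial>lborel)" if "cmod x = 1" for x
  proof -
    have "(\<integral>y. w (z + y) * \<rho> y \<partial>lborel) = (\<integral>y. w (z + y) * \<rho> y \<partial>distr lborel borel ((*) x))"
      by (simp add: lborel_distr_rotate[OF that])
    also have "\<dots> = (\<integral>y. w (z + x * y) * \<rho> (x * y) \<partial>lborel)"
      by (subst integral_distr) auto
    also have "\<dots> = (\<integral>y. w (z + x * y) * \<rho> y \<partial>lborel)"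
      using \<rho>(4)[of "x * y" y for y] that by (simp add: norm_mult)
    finally show ?thesis by simp
  qed
  have I: "integrable (circ \<Otimes>\<^sub>M lborel) (\<lambda>(x, y). w (z + x * y) * \<rho> y)"
  proof (rule Bochner_Integration.integrable_bound)
    show "integrable (circ \<Otimes>\<^sub>M lborel) (\<lambda>(x, y). C * \<rho> y)"
      using integrable_circ_lborel[of "\<lambda>y. C * \<rho> y" "\<lambda>_. 1" 1 0 0] \<rho>(1) by simp
    show "AE p in circ \<Otimes>\<^sub>M lborel. norm (case p of (x, y) \<Rightarrow> w (z + x * y) * \<rho> y) \<le> norm (case p of (x, y) \<Rightarrow> C * \<rho> y)"
      using wb \<rho>(2) by (intro AE_I2) (auto simp: abs_mult intro!: mult_right_mono order_trans[OF wb(2) abs_ge_self])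
  qed measurable
  have "(\<integral>y. w y * \<rho> (y - z) \<partial>lborel) = (\<integral>y. w (z + y) * \<rho> y \<partial>lborel)"
    by (subst integral_lborel_translate[symmetric, of _ z]) (auto simp: add.commute)
  also have "\<dots> = (\<integral>x. (\<integral>y. w (z + y) * \<rho> y \<partial>lborel) \<partial>circ)" by simp
  also have "\<dots> = (\<integral>x. (\<integral>y. w (z + x * y) * \<rho> y \<partial>lborel) \<partial>circ)"
  proof (rule integral_cong_AE)
    show "AE x in circ. (\<integral>y. w (z + y) * \<rho> y \<partial>lborel) = (\<integral>y. w (z + x * y) * \<rho> y \<partial>lborel)"
      using AE_circ by eventually_elim (simp add: rot)
  qed measurable
  also have "\<dots> = (\<integral>y. (\<integral>x. w (z + x * y) * \<rho> y \<partial>circ) \<partial>lborel)"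
    by (rule circ_lborel.Fubini_integral[OF I, symmetric])
  also have "\<dots> \<ge> (\<integral>y. (w z - c0 * \<delta>\<^sup>2) * \<rho> y \<partial>lborel)"
  proof (rule integral_mono)
    show "integrable lborel (\<lambda>y. (w z - c0 * \<delta>\<^sup>2) * \<rho> y)" using \<rho>(1) by simp
    show "integrable lborel (\<lambda>y. \<integral>x. w (z + x * y) * \<rho> y \<partial>circ)"
      using circ_lborel.integrable_snd[OF I] by simp
    fix y
    show "(w z - c0 * \<delta>\<^sup>2) * \<rho> y \<le> (\<integral>x. w (z + x * y) * \<rho> y \<partial>circ)"
    proof (cases "cmod y < \<delta>")
      case True
      \<comment> \<open>At \<open>y = 0\<close> the circle shrinks to \<open>z\<close>, whereas
        \<open>mean\<close> speaks of positive radii; there the claim reduces to c0 * \<delta>^2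
        being nonnegative.\<close>
      have "w z - c0 * \<delta>\<^sup>2 \<le> (\<integral>x. w (z + of_real (cmod y) * x) \<partial>circ)"
      proof (cases "y = 0")
        case False
        then have "w z - c0 * (cmod y)\<^sup>2 \<le> (\<integral>x. w (z + of_real (cmod y) * x) \<partial>circ)"
          using mean True by simp
        moreover have "c0 * (cmod y)\<^sup>2 \<le> c0 * \<delta>\<^sup>2"
          using True c0 by (intro mult_left_mono power_mono) auto
        ultimately show ?thesis by linarith
      qed (use c0 in simp)
      also have "\<dots> = (\<integral>x. w (z + x * y) \<partial>circ)"
        by (subst circ_mean_rotate[symmetric]) (auto simp: mult.commute)
      finally show ?thesis using \<rho>(2)[of y] by (simp add: mult_right_mono)
    qed (use \<rho>(3)[of y] in simp)
  qed
  finally show ?thesis using \<rho>(5) by simp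
qed

text \<open>The integral is the limit from \<open>integral_laplacian_limit\<close> for the
  translated test function \<rho>(y - z). Each approximating integral sees a defect of at most c0 *
  s^2, and only for points of \<open>Q\<close>; multiplied by 4/s^2 this gives 4 * c0. Since \<rho>
  lives on a disc of radius \<delta>, the set \<open>Q\<close> is felt only from the slightly larger
  \<open>Q'\<close>.\<close>

lemma laplacian_mollify_ge:
  fixes w \<rho> :: "complex \<Rightarrow> real"
  assumes w: "integrable lborel w"
    and \<rho>: "\<And>n. C_k n \<rho>" "\<And>z. 0 \<le> \<rho> z" "\<And>z. \<delta> \<le> cmod z \<Longrightarrow> \<rho> z = 0" "integrable lborel \<rho>" "(\<integral>z. \<rho> z \<partial>lborel) = 1"
    and c0: "0 \<le> c0" and s0: "0 < s0"
    and mean: "\<And>z s. 0 < s \<Longrightarrow> s < s0 \<Longrightarrow> w z - c0 * s\<^sup>2 * indicator Q z \<le> (\<integral>x. w (z + of_real s * x) \<partial>circ)"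
    and Q: "Q \<in> sets borel" and Q': "\<And>y. y \<in> Q \<Longrightarrow> dist y z < \<delta> \<Longrightarrow> z \<in> Q'"
  shows "- (4 * c0 * indicator Q' z) \<le> (\<integral>y. w y * laplacian \<rho> (y - z) \<partial>lborel)"
proof -
  define f where "f y = \<rho> (- z + of_real 1 * y)" for y
  have f_eq: "f y = \<rho> (y - z)" for y by (simp add: f_def)
  have fs: "smooth_compact_support UNIV f"
    unfolding smooth_compact_support_def
  proof (intro conjI allI exI[of _ "cball z \<delta>"] impI)
    show "C_k n f" for n unfolding f_def by (intro C_k_affine \<rho>(1))
    show "f y = 0" if "y \<notin> cball z \<delta>" for y using that \<rho>(3)[of "y - z"] by (simp add: f_eq dist_norm norm_minus_commute)
  qed auto
  then obtain B where B: "\<And>y. \<bar>f y\<bar> \<le> B" and fm[measurable]: "f \<in> borel_measurable borel"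
    using smooth_compact_support_facts by metis
  have wm[measurable]: "w \<in> borel_measurable borel" using w by auto
  have lap: "laplacian f y = laplacian \<rho> (y - z)" for y
    unfolding f_def[abs_def] using laplacian_affine[OF \<rho>(1), of "- z" 1 y] by simp
  have \<rho>m[measurable]: "\<rho> \<in> borel_measurable borel" using \<rho>(4) by auto
  have fi: "integrable lborel f" "(\<integral>y. f y \<partial>lborel) = 1"
    using integrable_lborel_translate[OF \<rho>(4), of "- z"] integral_lborel_translate[of \<rho> "- z"] \<rho>(5)
    by (simp_all add: f_eq[abs_def])
  have "- (4 * c0 * indicator Q' z) \<le> (\<integral>y. w y * laplacian f y \<partial>lborel)"
  proof (rule tendsto_lowerbound[OF integral_laplacian_limit[OF w fs]])
    have "\<forall>\<^sub>F s in at_right 0. 0 < s \<and> s < s0"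
      using eventually_at_right_real[OF s0] by (rule eventually_mono) auto
    then show "\<forall>\<^sub>F s in at_right 0. - (4 * c0 * indicator Q' z) \<le>
       4 / s\<^sup>2 * (\<integral>y. f y * ((\<integral>x. w (y + of_real s * x) \<partial>circ) - w y) \<partial>lborel)"
    proof eventually_elim
      case (elim s)
      have i1: "integrable lborel (\<lambda>y. f y * ((\<integral>x. w (y + of_real s * x) \<partial>circ) - w y))"
      proof -
        have "integrable lborel (\<lambda>y. f y * (\<integral>x. w (y + of_real s * x) \<partial>circ) - w y * f y)"
          using circ_mean_swap(2)[OF w fm B, of "of_real s"] integrable_mult_bounded[OF w _ B] by auto
        then show ?thesis by (simp add: algebra_simps)
      qed
      have "(\<integral>y. - (c0 * s\<^sup>2 * indicator Q' z) * f y \<partial>lborel) \<le> (\<integral>y. f y * ((\<integral>x. w (y + of_real s * x) \<partial>circ) - w y) \<partial>lborel)"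
      proof (rule integral_mono[OF _ i1])
        fix y
        have "f y * (c0 * s\<^sup>2 * indicator Q y) \<le> f y * (c0 * s\<^sup>2 * indicator Q' z)"
        proof (cases "y \<in> Q \<and> f y \<noteq> 0")
          case True
          then have "dist y z < \<delta>" using \<rho>(3)[of "y - z"] by (auto simp: f_eq dist_norm not_le[symmetric])
          with True Q' show ?thesis by auto
        qed (use c0 \<rho>(2) in \<open>auto simp: f_eq indicator_def\<close>)
        moreover have "f y * (- (c0 * s\<^sup>2 * indicator Q y)) \<le> f y * ((\<integral>x. w (y + of_real s * x) \<partial>circ) - w y)"
          using mean[of s y] elim \<rho>(2) by (intro mult_left_mono) (auto simp: f_eq)
        ultimately show "- (c0 * s\<^sup>2 * indicator Q' z) * f y \<le> f y * ((\<integral>x. w (y + of_real s * x) \<partial>circ) - w y)"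
          by (simp add: mult.commute)
      qed (use fi in auto)
      then have "- (c0 * s\<^sup>2 * indicator Q' z) \<le> (\<integral>y. f y * ((\<integral>x. w (y + of_real s * x) \<partial>circ) - w y) \<partial>lborel)"
        using fi by simp
      then have "4 / s\<^sup>2 * (- (c0 * s\<^sup>2 * indicator Q' z)) \<le> 4 / s\<^sup>2 * (\<integral>y. f y * ((\<integral>x. w (y + of_real s * x) \<partial>circ) - w y) \<partial>lborel)"
        by (intro mult_left_mono) auto
      moreover have "4 / s\<^sup>2 * (- (c0 * s\<^sup>2 * indicator Q' z)) = - (4 * c0 * indicator Q' z)"
        using elim by simp
      ultimately show ?case by (simp only:)
    qed
  qed simp
  then show ?thesis by (simp add: lap)
qed

text \<open>With \<phi> the mollification of \<open>w\<close> and \<open>A\<close> its Laplacian,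
  the chain is 2 pi \<integral> \<phi> d\<mu>1 \<le> \<integral> U1 A \<le> \<integral> U2 A + E
  \<le> 2 pi \<integral> \<phi> d\<mu>2 + E, where the middle step combines U1 \<le> U2 with the
  lower bound for \<open>A\<close>. When the kernel shrinks, the near-submean property controls
  \<phi> from below on the left and upper semicontinuity controls it from above on the
  right.\<close>

lemma mollified_comparison:
  fixes w U1 U2 :: "complex \<Rightarrow> real" and \<mu>1 \<mu>2 :: "complex measure"
  assumes \<mu>1: "finite_measure \<mu>1" and s1[measurable_cong]: "sets \<mu>1 = sets borel"
    and \<mu>2: "finite_measure \<mu>2" and s2[measurable_cong]: "sets \<mu>2 = sets borel"
    and wm[measurable]: "w \<in> borel_measurable borel" and wb: "\<And>z. 0 \<le> w z" "\<And>z. w z \<le> C"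
    and T: "compact T" "\<And>z. z \<notin> T \<Longrightarrow> w z = 0"
    and usc: "\<And>z a. w z < a \<Longrightarrow> \<exists>r>0. \<forall>y\<in>ball z r. w y < a"
    and \<delta>0: "0 < \<delta>0" "\<And>y. y \<in> T \<Longrightarrow> cball y \<delta>0 \<subseteq> L"
    and c0: "0 \<le> c0" and s0: "0 < s0"
    and mean: "\<And>z s. 0 < s \<Longrightarrow> s < s0 \<Longrightarrow> w z - c0 * s\<^sup>2 * indicator Q z \<le> (\<integral>x. w (z + of_real s * x) \<partial>circ)"
    and Q: "Q \<in> sets borel" "Q' \<in> sets borel" "\<And>y z. y \<in> Q \<Longrightarrow> dist y z < \<delta>0 \<Longrightarrow> z \<in> Q'"
    and U: "integrable lborel U1" "integrable lborel U2" "AE z in lborel. U1 z \<le> U2 z"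
    and R1: "\<And>\<phi>. smooth_compact_support L \<phi> \<Longrightarrow> (\<And>z. 0 \<le> \<phi> z) \<Longrightarrow> 2 * pi * (\<integral>z. \<phi> z \<partial>\<mu>1) \<le> (\<integral>z. U1 z * laplacian \<phi> z \<partial>lborel)"
    and R2: "\<And>\<phi>. smooth_compact_support L \<phi> \<Longrightarrow> (\<And>z. 0 \<le> \<phi> z) \<Longrightarrow> (\<integral>z. U2 z * laplacian \<phi> z \<partial>lborel) \<le> 2 * pi * (\<integral>z. \<phi> z \<partial>\<mu>2)"
  shows "2 * pi * (\<integral>z. w z \<partial>\<mu>1) \<le> 2 * pi * (\<integral>z. w z \<partial>\<mu>2) + 4 * c0 * (\<integral>z. indicator Q' z * (U2 z - U1 z) \<partial>lborel)"
proof -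
  interpret m1: finite_measure \<mu>1 by (rule \<mu>1)
  interpret m2: finite_measure \<mu>2 by (rule \<mu>2)
  have sp: "space \<mu>1 = UNIV" "space \<mu>2 = UNIV" using s1 s2 by (auto dest: sets_eq_imp_space_eq)
  have C0: "0 \<le> C" using wb[of 0] by linarith
  have wi: "integrable lborel w"
  proof (rule Bochner_Integration.integrable_bound)
    show "integrable lborel (\<lambda>z. C * indicator T z)"
      using T(1) emeasure_compact_finite[OF T(1)] by (auto simp: borel_compact)
    show "AE z in lborel. norm (w z) \<le> norm (C * indicator T z)"
      using wb T(2) C0 by (intro AE_I2) (auto simp: indicator_def)
  qed measurable
  have w1: "integrable \<mu>1 w" and w2: "integrable \<mu>2 w"
    using wb by (auto intro!: m1.integrable_const_bound[of _ C] m2.integrable_const_bound[of _ C])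
  define E where "E = 4 * c0 * (\<integral>z. indicator Q' z * (U2 z - U1 z) \<partial>lborel)"
  \<comment> \<open>The divisor is at least 2, which keeps every \<open>d n\<close> strictly below
    both \<delta>0 and s0.\<close>
  define d where "d n = min \<delta>0 s0 / (Suc (Suc n))" for n
  have d: "0 < d n" "d n < \<delta>0" "d n < s0" for n
  proof -
    have m: "0 < min \<delta>0 s0" using \<delta>0 s0 by simp
    moreover have "x / real (Suc (Suc n)) < x" if "0 < x" for x :: real
      using that by (simp add: divide_less_eq)
    ultimately have "d n < min \<delta>0 s0" unfolding d_def by blast
    then show "d n < \<delta>0" "d n < s0" by auto
    show "0 < d n" using m by (simp add: d_def)
  qed
  have d0: "d \<longlonglongrightarrow> 0"
    unfolding d_def using LIMSEQ_Suc[OF LIMSEQ_Suc[OF lim_const_over_n[of "min \<delta>0 s0"]]] by simp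
  have "\<exists>\<rho>. (\<forall>n. C_k n \<rho>) \<and> (\<forall>z. 0 \<le> \<rho> z) \<and> (\<forall>z. d m \<le> cmod z \<longrightarrow> \<rho> z = 0) \<and>
    (\<forall>z w. cmod z = cmod w \<longrightarrow> \<rho> z = \<rho> w) \<and> integrable lborel \<rho> \<and> (\<integral>z. \<rho> z \<partial>lborel) = 1" for m
    using ex_radial_bump[OF d(1)[of m]] by metis
  then obtain \<rho> where \<rho>: "\<And>m n. C_k n (\<rho> m)" "\<And>m z. 0 \<le> \<rho> m z" "\<And>m z. d m \<le> cmod z \<Longrightarrow> \<rho> m z = 0"
    "\<And>m z w. cmod z = cmod w \<Longrightarrow> \<rho> m z = \<rho> m w" "\<And>m. integrable lborel (\<rho> m)" "\<And>m. (\<integral>z. \<rho> m z \<partial>lborel) = 1"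
    by metis
  have \<rho>m[measurable]: "\<rho> m \<in> borel_measurable borel" for m using \<rho>(5)[of m] by auto
  have \<rho>s: "smooth_compact_support UNIV (\<rho> m)" for m
    unfolding smooth_compact_support_def using \<rho>(1) \<rho>(3)[of m]
    by (intro conjI allI exI[of _ "cball 0 (d m)"]) (auto simp: dist_norm)
  define \<phi> where "\<phi> m z = (\<integral>y. w y * \<rho> m (y - z) \<partial>lborel)" for m z
  \<comment> \<open>The maximum with \<open>w\<close> makes the lower half of the pointwise
    convergence on the right trivial; only the upper half is left to upper semicontinuity.\<close>
  have step: "2 * pi * (\<integral>z. w z - c0 * (d m)\<^sup>2 \<partial>\<mu>1) \<le> 2 * pi * (\<integral>z. max (\<phi> m z) (w z) \<partial>\<mu>2) + E"
    and \<phi>le: "\<And>z a. (\<And>y. dist z y < d m \<Longrightarrow> w y \<le> a) \<Longrightarrow> \<phi> m z \<le> a" 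
    and \<phi>m: "\<phi> m \<in> borel_measurable borel" for m
  proof -
    obtain B where B: "\<And>z. \<bar>\<rho> m z\<bar> \<le> B" "\<And>z. \<bar>laplacian (\<rho> m) z\<bar> \<le> B"
      and lm[measurable]: "laplacian (\<rho> m) \<in> borel_measurable borel"
      using smooth_compact_support_facts[OF \<rho>s[of m]] by metis
    show m1[measurable]: "\<phi> m \<in> borel_measurable borel"
      unfolding \<phi>_def[abs_def] by measurable
    have iw: "integrable lborel (\<lambda>y. w y * \<rho> m (y - z))" for z
      by (rule integrable_mult_bounded[OF wi _ B(1)]) measurable
    have \<rho>t: "integrable lborel (\<lambda>y. \<rho> m (y - z))" "(\<integral>y. \<rho> m (y - z) \<partial>lborel) = 1" for z
      using integrable_lborel_translate[OF \<rho>(5)[of m], of "- z"] integral_lborel_translate[of "\<rho> m" "- z"] \<rho>(6)[of m] by simp_all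
    show ple: "\<phi> m z \<le> a" if "\<And>y. dist z y < d m \<Longrightarrow> w y \<le> a" for z a
    proof -
      have "\<phi> m z \<le> (\<integral>y. a * \<rho> m (y - z) \<partial>lborel)"
        unfolding \<phi>_def
      proof (rule integral_mono[OF iw])
        show "w y * \<rho> m (y - z) \<le> a * \<rho> m (y - z)" for y
          using \<rho>(2)[of m "y - z"] \<rho>(3)[of m "y - z"] that[of y]
          by (cases "dist z y < d m") (auto simp: dist_norm norm_minus_commute intro: mult_right_mono)
      qed (use \<rho>t in auto)
      then show ?thesis using \<rho>t by simp
    qed
    have pb: "0 \<le> \<phi> m z" "\<phi> m z \<le> C" for z
      using ple[of z C] wb \<rho>(2) by (auto simp: \<phi>_def)
    have pge: "w z - c0 * (d m)\<^sup>2 \<le> \<phi> m z" for z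
      unfolding \<phi>_def
    proof (rule mollify_ge[OF wm wb \<rho>(5,2,3,4,6) c0])
      fix s assume s: "0 < s" "s < d m"
      have "c0 * s\<^sup>2 * indicator Q z \<le> c0 * s\<^sup>2 * 1"
        using c0 by (intro mult_left_mono) (auto simp: indicator_def)
      then show "w z - c0 * s\<^sup>2 \<le> (\<integral>x. w (z + of_real s * x) \<partial>circ)"
        using mean[of s z] s d[of m] by simp
    qed auto
    have p1: "integrable \<mu>1 (\<phi> m)" and p2: "integrable \<mu>2 (\<phi> m)" and mx: "integrable \<mu>2 (\<lambda>z. max (\<phi> m z) (w z))"
    proof -
      have "\<bar>max (\<phi> m z) (w z)\<bar> \<le> C" for z using pb[of z] wb(1)[of z] wb(2)[of z] by auto
      then show "integrable \<mu>1 (\<phi> m)" "integrable \<mu>2 (\<phi> m)" "integrable \<mu>2 (\<lambda>z. max (\<phi> m z) (w z))"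
        using pb by (auto intro!: m1.integrable_const_bound[of _ C] m2.integrable_const_bound[of _ C])
    qed
    define A where "A z = (\<integral>y. w y * laplacian (\<rho> m) (y - z) \<partial>lborel)" for z
    have Am[measurable]: "A \<in> borel_measurable borel" unfolding A_def[abs_def] by measurable
    have Age: "- (4 * c0 * indicator Q' z) \<le> A z" for z
      unfolding A_def
    proof (rule laplacian_mollify_ge[OF wi \<rho>(1,2,3,5,6) c0 s0 mean Q(1)])
      show "z \<in> Q'" if "y \<in> Q" "dist y z < d m" for y using Q(3)[OF that(1), of z] that(2) d[of m] by linarith
    qed auto
    have Uneg: "2 * pi * (\<integral>z. \<phi> m z \<partial>\<mu>1) \<le> (\<integral>z. U1 z * A z \<partial>lborel)"
      and Upos: "(\<integral>z. U2 z * A z \<partial>lborel) \<le> 2 * pi * (\<integral>z. \<phi> m z \<partial>\<mu>2)"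
      and UA: "integrable lborel (\<lambda>z. U1 z * A z)" "integrable lborel (\<lambda>z. U2 z * A z)"
    proof -
      \<comment> \<open>The test functions are z -> \<rho>(y - z), one for each \<open>y\<close>,
        written in the affine form with factor -1 whose square leaves the Laplacian unchanged. For
        \<open>y\<close> in \<open>T\<close> the support lies in \<open>L\<close>; other
        \<open>y\<close> have weight \<open>w y = 0\<close>.\<close>
      define t where "t y = (\<lambda>z. \<rho> m (y + of_real (-1) * z))" for y
      have t_eq: "t y z = \<rho> m (y - z)" for y z by (simp add: t_def)
      have ts: "smooth_compact_support L (t y)" if "y \<in> T" for y
        unfolding smooth_compact_support_def
      proof (intro conjI allI exI[of _ "cball y (d m)"] impI)
        show "C_k n (t y)" for n unfolding t_def by (intro C_k_affine \<rho>(1))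
        show "cball y (d m) \<subseteq> L" using \<delta>0(2)[OF that] d(2)[of m] by auto
        show "t y z = 0" if "z \<notin> cball y (d m)" for z
          using that \<rho>(3)[of m "y - z"] by (simp add: t_eq dist_norm)
      qed auto
      have tl: "laplacian (t y) z = laplacian (\<rho> m) (y - z)" for y z
        unfolding t_def by (rule trans[OF laplacian_affine[of "\<rho> m" y "-1" z, OF \<rho>(1)]]) simp
      have t0: "0 \<le> t y z" for y z by (simp add: t_eq \<rho>(2))
      note F1 = convolution_Fubini[OF m1.sigma_finite_measure_axioms s1 _ wi \<rho>m B(1), of "\<lambda>_. 1"]
      note F2 = convolution_Fubini[OF m2.sigma_finite_measure_axioms s2 _ wi \<rho>m B(1), of "\<lambda>_. 1"]
      note FU1 = convolution_Fubini[OF lborel.sigma_finite_measure_axioms _ U(1) wi lm B(2)]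
      note FU2 = convolution_Fubini[OF lborel.sigma_finite_measure_axioms _ U(2) wi lm B(2)]
      show "integrable lborel (\<lambda>z. U1 z * A z)" "integrable lborel (\<lambda>z. U2 z * A z)"
        using FU1(2) FU2(2) by (simp_all add: A_def)
      have "2 * pi * (\<integral>z. \<phi> m z \<partial>\<mu>1) = (\<integral>y. w y * (2 * pi * (\<integral>z. \<rho> m (y - z) \<partial>\<mu>1)) \<partial>lborel)"
        using F1(1) by (simp add: \<phi>_def mult.left_commute[of _ "2 * pi"])
      also have "\<dots> \<le> (\<integral>y. w y * (\<integral>z. U1 z * laplacian (\<rho> m) (y - z) \<partial>lborel) \<partial>lborel)"
      proof (rule integral_mono)
        show "integrable lborel (\<lambda>y. w y * (2 * pi * (\<integral>z. \<rho> m (y - z) \<partial>\<mu>1)))"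
          using F1(3) by (simp add: mult.left_commute[of _ "2 * pi"])
        show "w y * (2 * pi * (\<integral>z. \<rho> m (y - z) \<partial>\<mu>1)) \<le> w y * (\<integral>z. U1 z * laplacian (\<rho> m) (y - z) \<partial>lborel)" for y
          using R1[OF ts t0, of y, unfolded tl, unfolded t_eq] wb T(2)[of y] by (cases "y \<in> T") (auto intro!: mult_left_mono)
      qed (use FU1(3) in simp)
      also have "\<dots> = (\<integral>z. U1 z * A z \<partial>lborel)"
        using FU1(1) by (simp add: A_def)
      finally show "2 * pi * (\<integral>z. \<phi> m z \<partial>\<mu>1) \<le> (\<integral>z. U1 z * A z \<partial>lborel)" .
      have "(\<integral>z. U2 z * A z \<partial>lborel) = (\<integral>y. w y * (\<integral>z. U2 z * laplacian (\<rho> m) (y - z) \<partial>lborel) \<partial>lborel)"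
        using FU2(1) by (simp add: A_def)
      also have "\<dots> \<le> (\<integral>y. w y * (2 * pi * (\<integral>z. \<rho> m (y - z) \<partial>\<mu>2)) \<partial>lborel)"
      proof (rule integral_mono)
        show "integrable lborel (\<lambda>y. w y * (2 * pi * (\<integral>z. \<rho> m (y - z) \<partial>\<mu>2)))"
          using F2(3) by (simp add: mult.left_commute[of _ "2 * pi"])
        show "w y * (\<integral>z. U2 z * laplacian (\<rho> m) (y - z) \<partial>lborel) \<le> w y * (2 * pi * (\<integral>z. \<rho> m (y - z) \<partial>\<mu>2))" for y
          using R2[OF ts t0, of y, unfolded tl, unfolded t_eq] wb T(2)[of y] by (cases "y \<in> T") (auto intro!: mult_left_mono)
      qed (use FU2(3) in simp)
      also have "\<dots> = 2 * pi * (\<integral>z. \<phi> m z \<partial>\<mu>2)"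
        using F2(1) by (simp add: \<phi>_def mult.left_commute[of _ "2 * pi"])
      finally show "(\<integral>z. U2 z * A z \<partial>lborel) \<le> 2 * pi * (\<integral>z. \<phi> m z \<partial>\<mu>2)" .
    qed
    \<comment> \<open>As \<open>U2 - U1\<close> is nonnegative, a lower bound for \<open>A\<close>
      is enough: off \<open>Q'\<close> the difference has the right sign, and on \<open>Q'\<close>
      the loss is at most 4 * c0 * (U2 - U1).\<close>
    have "(\<integral>z. U1 z * A z - U2 z * A z \<partial>lborel) \<le> (\<integral>z. 4 * c0 * (indicator Q' z * (U2 z - U1 z)) \<partial>lborel)"
    proof (rule integral_mono_AE)
      have "integrable lborel (\<lambda>z. indicator Q' z *\<^sub>R (U2 z - U1 z))"
        using U Q(2) by (intro integrable_mult_indicator) auto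
      then show "integrable lborel (\<lambda>z. 4 * c0 * (indicator Q' z * (U2 z - U1 z)))" by simp
      show "AE z in lborel. U1 z * A z - U2 z * A z \<le> 4 * c0 * (indicator Q' z * (U2 z - U1 z))"
        using U(3)
      proof eventually_elim
        case (elim z)
        then have "(U2 z - U1 z) * - (A z) \<le> (U2 z - U1 z) * (4 * c0 * indicator Q' z)"
          using Age[of z] by (intro mult_left_mono) auto
        then show ?case by (simp add: algebra_simps)
      qed
    qed (use UA in auto)
    then have "(\<integral>z. U1 z * A z \<partial>lborel) \<le> (\<integral>z. U2 z * A z \<partial>lborel) + E"
      using UA by (simp add: E_def)
    moreover have "(\<integral>z. w z - c0 * (d m)\<^sup>2 \<partial>\<mu>1) \<le> (\<integral>z. \<phi> m z \<partial>\<mu>1)"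
      by (rule integral_mono) (use pge p1 w1 in auto)
    moreover have "(\<integral>z. \<phi> m z \<partial>\<mu>2) \<le> (\<integral>z. max (\<phi> m z) (w z) \<partial>\<mu>2)"
      by (rule integral_mono) (use p2 mx in auto)
    ultimately show "2 * pi * (\<integral>z. w z - c0 * (d m)\<^sup>2 \<partial>\<mu>1) \<le> 2 * pi * (\<integral>z. max (\<phi> m z) (w z) \<partial>\<mu>2) + E"
      using Uneg Upos pi_gt_zero by (smt (verit) mult_left_mono)
  qed
  have "(\<lambda>m. \<integral>z. w z - c0 * (d m)\<^sup>2 \<partial>\<mu>1) \<longlonglongrightarrow> (\<integral>z. w z \<partial>\<mu>1)"
  proof -
    have "(\<integral>z. w z - c0 * (d m)\<^sup>2 \<partial>\<mu>1) = (\<integral>z. w z \<partial>\<mu>1) - c0 * (d m)\<^sup>2 * measure \<mu>1 UNIV" for m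
      using w1 sp by simp
    moreover have "(\<lambda>m. (\<integral>z. w z \<partial>\<mu>1) - c0 * (d m)\<^sup>2 * measure \<mu>1 UNIV) \<longlonglongrightarrow> (\<integral>z. w z \<partial>\<mu>1) - c0 * 0\<^sup>2 * measure \<mu>1 UNIV"
      by (intro tendsto_intros d0)
    ultimately show ?thesis by simp
  qed
  moreover have "(\<lambda>m. \<integral>z. max (\<phi> m z) (w z) \<partial>\<mu>2) \<longlonglongrightarrow> (\<integral>z. w z \<partial>\<mu>2)"
  proof (rule integral_dominated_convergence[where w = "\<lambda>_. C"])
    show "AE z in \<mu>2. (\<lambda>m. max (\<phi> m z) (w z)) \<longlonglongrightarrow> w z"
    proof (rule AE_I2)
      fix z
      show "(\<lambda>m. max (\<phi> m z) (w z)) \<longlonglongrightarrow> w z"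
      proof (rule order_tendstoI)
        fix a assume "a < w z"
        then show "\<forall>\<^sub>F m in sequentially. a < max (\<phi> m z) (w z)" by (simp add: less_max_iff_disj)
      next
        fix a assume "w z < a"
        then obtain a' where a': "w z < a'" "a' < a" using dense by blast
        obtain r where r: "r > 0" "\<forall>y\<in>ball z r. w y < a'" using usc[OF a'(1)] by auto
        have "\<forall>\<^sub>F m in sequentially. d m < r" using d0 r(1) by (simp add: order_tendstoD)
        then show "\<forall>\<^sub>F m in sequentially. max (\<phi> m z) (w z) < a"
        proof eventually_elim
          case (elim m)
          have "\<phi> m z \<le> a'"
            by (rule \<phi>le) (use r(2) elim in \<open>auto intro!: less_imp_le\<close>)
          then show ?case using a' by auto
        qed
      qed
    qed
    have "\<phi> m z \<le> C" for m z by (rule \<phi>le) (rule wb)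
    then have "\<bar>max (\<phi> m z) (w z)\<bar> \<le> C" for m z
      using wb(1)[of z] wb(2)[of z] by (auto simp: abs_le_iff max_def dest: order_trans)
    then show "AE z in \<mu>2. norm (max (\<phi> m z) (w z)) \<le> C" for m
      by simp
  qed (use \<phi>m in auto)
  ultimately have "2 * pi * (\<integral>z. w z \<partial>\<mu>1) \<le> 2 * pi * (\<integral>z. w z \<partial>\<mu>2) + E"
    by (intro LIMSEQ_le[of "\<lambda>m. 2 * pi * (\<integral>z. w z - c0 * (d m)\<^sup>2 \<partial>\<mu>1)" _ "\<lambda>m. 2 * pi * (\<integral>z. max (\<phi> m z) (w z) \<partial>\<mu>2) + E"])
       (auto intro!: tendsto_intros step)
  then show ?thesis by (simp add: E_def)
qed

section \<open>The estimate in the plane\<close>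

lemma usc_bounded_on_compact:
  fixes f :: "'a::metric_space \<Rightarrow> real"
  assumes "compact K" and usc: "\<And>z a. z \<in> K \<Longrightarrow> f z < a \<Longrightarrow> \<exists>r>0. \<forall>y\<in>ball z r. f y < a"
  obtains C where "\<And>z. z \<in> K \<Longrightarrow> f z \<le> C" "0 \<le> C"
proof -
  have "\<exists>r>0. \<forall>y\<in>ball z r. f y < f z + 1" if "z \<in> K" for z
    using usc[OF that, of "f z + 1"] by simp
  then obtain r where r: "\<And>z. z \<in> K \<Longrightarrow> r z > 0 \<and> (\<forall>y\<in>ball z (r z). f y < f z + 1)"
    by metis
  have "K \<subseteq> (\<Union>z\<in>K. ball z (r z))" using r by force
  then obtain A where A: "A \<subseteq> K" "finite A" "K \<subseteq> (\<Union>z\<in>A. ball z (r z))"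
    using compactE_image[OF assms(1), of K "\<lambda>z. ball z (r z)"] by auto
  \<comment> \<open>The sum of absolute values dominates each local bound and is a nonnegative
    constant even if \<open>A\<close> is empty.\<close>
  define C where "C = (\<Sum>z\<in>A. \<bar>f z + 1\<bar>)"
  have "f y \<le> C" if "y \<in> K" for y
  proof -
    have "y \<in> (\<Union>z\<in>A. ball z (r z))" using A(3) that by blast
    then obtain z where z: "z \<in> A" "y \<in> ball z (r z)" by blast
    then have "f y \<le> \<bar>f z + 1\<bar>" using r[of z] A(1) by fastforce
    also have "\<dots> \<le> C" unfolding C_def by (rule member_le_sum) (use z A in auto)
    finally show ?thesis .
  qed
  then show ?thesis using that[of C] by (auto simp: C_def intro: sum_nonneg)
qed

text \<open>The squared distance to \<open>S\<close> is an infimum of paraboloids \<open>\<bar>z - p\<bar>\<^sup>2\<close>, all with the same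
  second-order term.\<close>

lemma infdist_squared_semiconcave:
  fixes S :: "complex set"
  assumes "closed S" "S \<noteq> {}" "\<eta> > 0"
  defines "\<kappa> z \<equiv> min 1 ((infdist z S / \<eta>)\<^sup>2)"
  shows "\<exists>a b. \<forall>h. \<kappa> (z + h) \<le> \<kappa> z + (a * Re h + b * Im h) + (cmod h)\<^sup>2 / \<eta>\<^sup>2"
proof (cases "(infdist z S / \<eta>)\<^sup>2 \<le> 1")
  case True
  \<comment> \<open>At \<open>z\<close> the nearest point \<open>p\<close> gives the exact value of
    \<kappa>; at \<open>z + h\<close> the same \<open>p\<close> still gives an upper bound.
    Expanding the square leaves a linear term and \<bar>h\<bar>^2. In the other case \<kappa>
    already has its maximum 1 at \<open>z\<close>.\<close>
  obtain p where p: "p \<in> S" "infdist z S = dist z p" using infdist_attains_inf[OF assms(1,2)] by metis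
  have "\<kappa> (z + h) \<le> \<kappa> z + (2 * Re (z - p) / \<eta>\<^sup>2 * Re h + 2 * Im (z - p) / \<eta>\<^sup>2 * Im h) + (cmod h)\<^sup>2 / \<eta>\<^sup>2" for h
  proof -
    have "infdist (z + h) S \<le> cmod (z + h - p)"
      using infdist_le[OF p(1), of "z + h"] by (simp add: dist_norm)
    then have "(infdist (z + h) S / \<eta>)\<^sup>2 \<le> (cmod (z + h - p) / \<eta>)\<^sup>2"
      using assms(3) by (intro power_mono divide_right_mono) (auto simp: infdist_nonneg)
    then have "\<kappa> (z + h) \<le> (cmod (z + h - p))\<^sup>2 / \<eta>\<^sup>2"
      by (simp add: \<kappa>_def power_divide)
    also have "(cmod (z + h - p))\<^sup>2 = (cmod (z - p))\<^sup>2 + (2 * Re (z - p) * Re h + 2 * Im (z - p) * Im h) + (cmod h)\<^sup>2"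
      unfolding cmod_power2 by (simp add: power2_eq_square algebra_simps)
    finally show ?thesis
      using True p(2) by (simp add: \<kappa>_def dist_norm power_divide add_divide_distrib)
  qed
  then show ?thesis by blast
next
  case False
  then have "\<kappa> z = 1" by (simp add: \<kappa>_def)
  moreover have "\<kappa> (z + h) \<le> 1" "0 \<le> (cmod h)\<^sup>2 / \<eta>\<^sup>2" for h by (simp_all add: \<kappa>_def)
  ultimately have "\<kappa> (z + h) \<le> \<kappa> z + (0 * Re h + 0 * Im h) + (cmod h)\<^sup>2 / \<eta>\<^sup>2" for h
    by (simp add: add_increasing2)
  then show ?thesis by blast
qed

text \<open>The interface between the plane and the sphere: \<open>F\<close> is the region where the
  test function is available, \<open>N\<close> the region that the cutoff leaves untouched, and
  \<open>L\<close> the compact set that carries \<open>w\<close> and on which the Riesz equations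
  are tested.\<close>

definition cutoff_function ::
  "complex set \<Rightarrow> complex set \<Rightarrow> (complex \<Rightarrow> real) \<Rightarrow> real \<Rightarrow> complex set \<Rightarrow> (complex \<Rightarrow> real) \<Rightarrow> bool" where
  "cutoff_function F N v \<epsilon> L w \<longleftrightarrow> compact L \<and> L \<subseteq> F \<and> w \<in> borel_measurable borel \<and>
     (\<forall>z. 0 \<le> w z) \<and> (\<exists>C. \<forall>z. w z \<le> C) \<and> (\<forall>z. z \<notin> L \<longrightarrow> w z = 0) \<and> (\<forall>z\<in>L. w z \<le> v z) \<and>
     (\<forall>z\<in>N. w z = max 0 (v z - \<epsilon>))"

text \<open>Together with \<open>riesz_ge\<close> this splits the distributional equation into
  inequalities tested on nonnegative functions: here \<mu> is at most \<Delta>U / (2 pi), there at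
  least. The split admits a counting measure that takes only part of the zeros.\<close>

definition riesz_le :: "complex set \<Rightarrow> complex measure \<Rightarrow> (complex \<Rightarrow> real) \<Rightarrow> bool" where
  "riesz_le L \<mu> U \<longleftrightarrow> finite_measure \<mu> \<and> sets \<mu> = sets borel \<and>
     (\<forall>\<phi>. smooth_compact_support L \<phi> \<longrightarrow> (\<forall>z. 0 \<le> \<phi> z) \<longrightarrow>
        2 * pi * (\<integral>z. \<phi> z \<partial>\<mu>) \<le> (\<integral>z. U z * laplacian \<phi> z \<partial>lborel))"

definition riesz_ge :: "complex set \<Rightarrow> complex measure \<Rightarrow> (complex \<Rightarrow> real) \<Rightarrow> bool" where
  "riesz_ge L \<mu> U \<longleftrightarrow> finite_measure \<mu> \<and> sets \<mu> = sets borel \<and>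
     (\<forall>\<phi>. smooth_compact_support L \<phi> \<longrightarrow> (\<forall>z. 0 \<le> \<phi> z) \<longrightarrow>
        (\<integral>z. U z * laplacian \<phi> z \<partial>lborel) \<le> 2 * pi * (\<integral>z. \<phi> z \<partial>\<mu>))"

text \<open>The error \<open>E\<close> depends only on \<open>U1\<close>, \<open>U2\<close> and on the collar, not on \<open>\<epsilon>\<close>; this is what
  survives the limit \<open>\<epsilon> \<rightarrow> 0\<close>. The cutoff \<open>\<kappa>\<close> below equals 1 close to \<open>H\<close>, which forces
  \<open>w = 0\<close> there, and being semiconcave it lowers the circle means of \<open>w\<close> by at most \<open>c0 * s\<^sup>2\<close>.\<close>

lemma planar_estimate:
  fixes G H :: "complex set" and v U1 U2 :: "complex \<Rightarrow> real" and \<eta> :: real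
  defines "dH z \<equiv> infdist z H"
  assumes G: "open G" and H: "closed H" "H \<noteq> {}" and \<eta>: "\<eta> > 0"
    and HG: "\<And>z. dH z \<le> 5 * \<eta> \<Longrightarrow> z \<in> G"
    and band: "compact {z. \<eta> \<le> dH z \<and> dH z \<le> 5 * \<eta>}"
    and S: "{z. 3 * \<eta> \<le> dH z} \<noteq> {}"
    and v0: "\<And>z. z \<in> G \<Longrightarrow> 0 < dH z \<Longrightarrow> 0 \<le> v z"
    and usc: "\<And>z a. z \<in> G \<Longrightarrow> 0 < dH z \<Longrightarrow> v z < a \<Longrightarrow> \<exists>r>0. \<forall>y\<in>ball z r. v y < a"
    and sub: "\<And>z s h B. 0 < s \<Longrightarrow> cball z s \<subseteq> {z \<in> G. 0 < dH z} \<Longrightarrow> h \<in> borel_measurable borel \<Longrightarrow>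
        (\<And>x. 0 \<le> h x \<and> h x \<le> B) \<Longrightarrow> (\<And>x. cmod x = 1 \<Longrightarrow> v (z + of_real s * x) \<le> h x) \<Longrightarrow> v z \<le> (\<integral>x. h x \<partial>circ)"
    and vanish: "\<And>\<epsilon>. 0 < \<epsilon> \<Longrightarrow> \<exists>T. compact T \<and> T \<subseteq> G \<and> (\<forall>z\<in>G. 2 * \<eta> \<le> dH z \<longrightarrow> \<epsilon> \<le> v z \<longrightarrow> z \<in> T)"
    and U: "\<And>K. compact K \<Longrightarrow> K \<subseteq> G \<Longrightarrow> set_integrable lborel K U1" "\<And>K. compact K \<Longrightarrow> K \<subseteq> G \<Longrightarrow> set_integrable lborel K U2"
    and Ule: "AE z in lborel. z \<in> G \<longrightarrow> 0 < dH z \<longrightarrow> U1 z \<le> U2 z"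
  shows "\<exists>E\<ge>0. \<forall>\<epsilon>>0. \<exists>L w.
     cutoff_function {z \<in> G. 0 < dH z} {z \<in> G. 3 * \<eta> \<le> dH z} v \<epsilon> L w \<and>
     (\<forall>\<mu>1 \<mu>2. riesz_le L \<mu>1 U1 \<longrightarrow> riesz_ge L \<mu>2 U2 \<longrightarrow> (\<integral>z. w z \<partial>\<mu>1) \<le> (\<integral>z. w z \<partial>\<mu>2) + E)"
    (is "\<exists>E\<ge>0. \<forall>\<epsilon>>0. \<exists>L w. ?P E \<epsilon> L w")
proof -
  have cdH: "continuous_on UNIV dH" unfolding dH_def by (intro continuous_intros)
  have odH: "open {z. a < dH z}" "open {z. dH z < a}" "closed {z. a \<le> dH z}" for a
    using cdH by (auto intro: open_Collect_less closed_Collect_le continuous_intros)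
  have dHl: "\<bar>dH z - dH y\<bar> \<le> dist z y" for z y
    unfolding dH_def by (rule infdist_triangle_abs)
  \<comment> \<open>The multiples of \<eta> form layers: \<kappa> is 1 up to 2 \<eta> and 0 from 3
    \<eta>; circles of radius below \<eta> centred beyond 4 \<eta> see only \<kappa> = 0, so the
    defect lives in \<open>Q\<close>; mollification widens this to 5 \<eta>. Below \<eta> the
    function \<open>w\<close> is set to 0.\<close>
  define band where "band = {z. \<eta> \<le> dH z \<and> dH z \<le> 5 * \<eta>}"
  have bG: "band \<subseteq> G" "\<And>z. z \<in> band \<Longrightarrow> 0 < dH z" using HG \<eta> by (auto simp: band_def)
  obtain B where B: "\<And>z. z \<in> band \<Longrightarrow> v z \<le> B" "0 \<le> B"
    using usc_bounded_on_compact[of band v] assms(7) usc bG unfolding band_def[symmetric] by (metis subsetD)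
  define S where "S = {z. 3 * \<eta> \<le> dH z}"
  have Scl: "closed S" "S \<noteq> {}" using odH S by (auto simp: S_def)
  define \<kappa> where "\<kappa> z = min 1 ((infdist z S / \<eta>)\<^sup>2)" for z
  have \<kappa>c: "continuous_on UNIV \<kappa>" unfolding \<kappa>_def by (intro continuous_intros) (use \<eta> in auto)
  then have \<kappa>m[measurable]: "\<kappa> \<in> borel_measurable borel" by (rule borel_measurable_continuous_onI)
  have \<kappa>b: "0 \<le> \<kappa> z" "\<kappa> z \<le> 1" for z by (auto simp: \<kappa>_def)
  have \<kappa>S: "\<kappa> z = 0" if "3 * \<eta> \<le> dH z" for z using that by (simp add: \<kappa>_def S_def)
  have \<kappa>1: "\<kappa> z = 1" if "dH z \<le> 2 * \<eta>" for z
  proof -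
    obtain p where p: "p \<in> S" "infdist z S = dist z p" using infdist_attains_inf[OF Scl] by metis
    then have "\<eta> \<le> infdist z S" using that dHl[of p z] by (simp add: S_def dist_commute)
    then have "1 \<le> (infdist z S / \<eta>)\<^sup>2" using \<eta> by (intro one_le_power) simp
    then show ?thesis by (simp add: \<kappa>_def)
  qed
  have \<kappa>int: "integrable circ (\<lambda>x. \<kappa> (z + of_real s * x))" for z s
    using \<kappa>b by (intro integrable_circ[of _ 1]) auto
  \<comment> \<open>The linear part of the semiconcavity bound averages to 0, and the quadratic part
    is the constant s^2/\<eta>^2 on the circle.\<close>
  have \<kappa>mean: "(\<integral>x. \<kappa> (z + of_real s * x) \<partial>circ) \<le> \<kappa> z + s\<^sup>2 / \<eta>\<^sup>2" for z s
  proof -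
    obtain a b where ab: "\<And>h. \<kappa> (z + h) \<le> \<kappa> z + (a * Re h + b * Im h) + (cmod h)\<^sup>2 / \<eta>\<^sup>2"
      using infdist_squared_semiconcave[OF Scl \<eta>, of z] unfolding \<kappa>_def by blast
    have ri: "integrable circ Re" "integrable circ Im"
      using abs_Re_le_cmod abs_Im_le_cmod by (auto intro!: integrable_circ[of _ 1] simp: real_norm_def) (metis)+
    have "(\<integral>x. \<kappa> (z + of_real s * x) \<partial>circ) \<le> (\<integral>x. \<kappa> z + (a * s * Re x + b * s * Im x) + s\<^sup>2 / \<eta>\<^sup>2 \<partial>circ)"
    proof (rule integral_mono_AE[OF \<kappa>int])
      show "AE x in circ. \<kappa> (z + of_real s * x) \<le> \<kappa> z + (a * s * Re x + b * s * Im x) + s\<^sup>2 / \<eta>\<^sup>2"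
        using AE_circ
      proof eventually_elim
        case (elim x)
        then show ?case using ab[of "of_real s * x"] by (simp add: norm_mult mult.assoc)
      qed
    qed (use ri in auto)
    also have "\<dots> = \<kappa> z + s\<^sup>2 / \<eta>\<^sup>2" using ri by (simp add: circ_moments(1,2))
    finally show ?thesis .
  qed
  \<comment> \<open>The factor \<open>B\<close> multiplies \<kappa> in \<open>w\<close>, so the
    defect of \<kappa> is scaled by \<open>B\<close>. In \<open>E\<close> the factor 4 comes from
    the normalisation 4/s^2, and 2 pi from the Riesz equation.\<close>
  define c0 where "c0 = B / \<eta>\<^sup>2"
  define E where "E = 4 * c0 * (LINT z:band|lborel. \<bar>U2 z - U1 z\<bar>) / (2 * pi)"
  have c00: "0 \<le> c0" using B by (simp add: c0_def)
  have bi: "set_integrable lborel band (\<lambda>z. \<bar>U2 z - U1 z\<bar>)"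
    using U[of band] assms(7) bG by (intro set_integrable_abs set_integral_diff) (auto simp: band_def)
  have E0: "0 \<le> E" unfolding E_def set_lebesgue_integral_def using c00 by simp
  have main: "\<exists>L w. ?P E \<epsilon> L w" if \<epsilon>: "0 < \<epsilon>" for \<epsilon>
  proof -
    obtain T0 where T0: "compact T0" "T0 \<subseteq> G" "\<And>z. z \<in> G \<Longrightarrow> 2 * \<eta> \<le> dH z \<Longrightarrow> \<epsilon> \<le> v z \<Longrightarrow> z \<in> T0"
      using vanish[OF \<epsilon>] by blast
    define T where "T = T0 \<inter> {z. 2 * \<eta> \<le> dH z}"
    have T: "compact T" "T \<subseteq> G" "\<And>z. z \<in> T \<Longrightarrow> 2 * \<eta> \<le> dH z"
      using T0 odH by (auto simp: T_def compact_Int_closed)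
    have Tp: "0 < dH z" if "z \<in> T" for z using T(3)[OF that] \<eta> by linarith
    \<comment> \<open>The seam at distance \<eta> is invisible: between \<eta> and 2 \<eta> the
      cutoff is 1 and \<open>v\<close> is at most \<open>B\<close>, so the first branch vanishes
      there too.\<close>
    define w where "w z = (if z \<in> G \<and> \<eta> < dH z then max 0 (v z - \<epsilon> - B * \<kappa> z) else 0)" for z
    have w0: "0 \<le> w z" for z by (simp add: w_def)
    have wT: "w z = 0" if "z \<notin> T" for z
    proof (rule ccontr)
      assume "w z \<noteq> 0"
      then have z: "z \<in> G" "\<eta> < dH z" "v z - \<epsilon> - B * \<kappa> z > 0" by (auto simp: w_def max_def split: if_splits)
      then have "\<epsilon> \<le> v z" using B(2) \<kappa>b(1)[of z] mult_nonneg_nonneg[of B "\<kappa> z"] by linarith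
      moreover have "2 * \<eta> \<le> dH z"
      proof (rule ccontr)
        assume n: "\<not> 2 * \<eta> \<le> dH z"
        then have "\<kappa> z = 1" "z \<in> band" using \<kappa>1[of z] z \<eta> by (auto simp: band_def)
        then show False using z(3) B(1)[of z] \<epsilon> by simp
      qed
      ultimately show False using T0(3) z that by (auto simp: T_def)
    qed
    obtain C where C: "\<And>z. z \<in> T \<Longrightarrow> v z \<le> C" "0 \<le> C"
      using usc_bounded_on_compact[OF T(1), of v] usc T(2) Tp by (metis subsetD)
    have wv: "w z \<le> v z" if "z \<in> G" "0 < dH z" for z
    proof -
      have "0 \<le> B * \<kappa> z" using B(2) \<kappa>b(1) by (rule mult_nonneg_nonneg)
      then have "v z - \<epsilon> - B * \<kappa> z \<le> v z" using \<epsilon> by linarith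
      then show ?thesis using v0[OF that] by (simp add: w_def)
    qed
    have wC: "w z \<le> C" for z
      using wv[of z] C(1)[of z] C(2) wT[of z] T(2) Tp[of z] by (cases "z \<in> T") (auto intro: order_trans)
    have wusc: "\<exists>r>0. \<forall>y\<in>ball z r. w y < a" if a: "w z < a" for z a
    proof (cases "z \<in> T")
      case False
      then obtain r where "r > 0" "ball z r \<subseteq> - T"
        using T(1) open_contains_ball[of "- T"] by (auto dest: compact_imp_closed simp: open_Compl)
      moreover have "0 < a" using a w0[of z] by linarith
      ultimately show ?thesis using wT by (intro exI[of _ r]) auto
    next
      case True
      then have z: "z \<in> G" "\<eta> < dH z" using T(2) T(3)[OF True] \<eta> by auto
      have a0: "0 < a" using a w0[of z] by linarith
      have va: "v z - \<epsilon> - B * \<kappa> z < a" using a z by (simp add: w_def)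
      define e where "e = (a - (v z - \<epsilon> - B * \<kappa> z)) / 2"
      have e: "e > 0" using va by (simp add: e_def)
      obtain r1 where r1: "r1 > 0" "\<forall>y\<in>ball z r1. v y < v z + e"
        using usc[of z "v z + e"] z e \<eta> by force
      have "isCont (\<lambda>y. B * \<kappa> y) z"
        using \<kappa>c by (intro continuous_intros) (simp add: continuous_on_eq_continuous_at)
      then obtain r2 where r2: "r2 > 0" "\<And>y. dist y z < r2 \<Longrightarrow> dist (B * \<kappa> y) (B * \<kappa> z) < e"
        unfolding continuous_at_eps_delta using e by blast
      show ?thesis
      proof (intro exI[of _ "min r1 r2"] conjI ballI)
        fix y assume y: "y \<in> ball z (min r1 r2)"
        have "v y < v z + e" using r1 y by simp
        moreover have "B * \<kappa> z - e < B * \<kappa> y" using r2(2)[of y] y by (auto simp: dist_real_def dist_commute)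
        moreover have "2 * e = a - (v z - \<epsilon> - B * \<kappa> z)" by (simp add: e_def)
        ultimately have "v y - \<epsilon> - B * \<kappa> y < a" by linarith
        then show "w y < a" using a0 by (simp add: w_def)
      qed (use r1 r2 in auto)
    qed
    have wm[measurable]: "w \<in> borel_measurable borel"
    proof (rule borel_measurableI_less)
      fix a
      have "open {z. w z < a}"
        unfolding open_contains_ball
      proof
        fix z assume "z \<in> {z. w z < a}"
        then obtain r where "r > 0" "\<forall>y\<in>ball z r. w y < a" using wusc[of z a] by auto
        then show "\<exists>e>0. ball z e \<subseteq> {z. w z < a}" by (intro exI[of _ r]) auto
      qed
      then show "{z \<in> space borel. w z < a} \<in> sets borel" by simp
    qed
    obtain s1 where s1: "s1 > 0" "\<And>z. z \<in> T \<Longrightarrow> cball z s1 \<subseteq> G"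
    proof -
      obtain d where d: "d > 0" "\<And>x y. x \<in> T \<Longrightarrow> y \<in> - G \<Longrightarrow> d \<le> dist x y"
      proof -
        have "T \<inter> - G = {}" using T(2) by auto
        then show ?thesis
          using separate_compact_closed[OF T(1), of "- G"] G that by (auto simp: closed_Compl)
      qed
      have "cball z (d / 2) \<subseteq> G" if "z \<in> T" for z
      proof
        fix y assume "y \<in> cball z (d / 2)"
        then have "dist z y < d" using d(1) by simp
        then show "y \<in> G" using d(2)[OF that, of y] by force
      qed
      with d(1) show ?thesis by (intro that[of "d / 2"]) auto
    qed
    \<comment> \<open>Points of \<open>T\<close> have distance at least 2 \<eta> from
      \<open>H\<close>. A step of length at most \<eta>/2 therefore stays beyond \<eta>, and one of
      length at most s1 stays in \<open>G\<close>, so the first branch of \<open>w\<close>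
      applies.\<close>
    define s0 where "s0 = min s1 (\<eta> / 2)"
    have s0: "0 < s0" "s0 < \<eta>" "s0 \<le> s1" using s1 \<eta> by (auto simp: s0_def)
    have near: "y \<in> G \<and> \<eta> < dH y" if "z \<in> T" "dist z y \<le> s0" for z y
    proof
      show "y \<in> G" using s1(2)[OF that(1)] that(2) s0 by auto
      show "\<eta> < dH y" using T(3)[OF that(1)] that(2) s0 dHl[of z y] by linarith
    qed
    define Q where "Q = {z. dH z < 4 * \<eta>}"
    define Q' where "Q' = {z. dH z < 5 * \<eta>}"
    have mean: "w z - c0 * s\<^sup>2 * indicator Q z \<le> (\<integral>x. w (z + of_real s * x) \<partial>circ)"
      if s: "0 < s" "s < s0" for z s
    proof (cases "w z = 0")
      case True
      have "0 \<le> (\<integral>x. w (z + of_real s * x) \<partial>circ)" using w0 by simp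
      moreover have "0 \<le> c0 * s\<^sup>2 * indicator Q z" using c00 by simp
      ultimately show ?thesis using True by linarith
    next
      case False
      then have zT: "z \<in> T" using wT by blast
      have z: "z \<in> G" "\<eta> < dH z" using near[OF zT, of z] s0 by auto
      have wz: "w z = v z - \<epsilon> - B * \<kappa> z" using False z by (auto simp: w_def max_def split: if_splits)
      have wi: "integrable circ (\<lambda>x. w (z + of_real s * x))"
        using w0 wC by (intro integrable_circ[of _ C]) auto
      \<comment> \<open>The submean inequality is applied with the majorant w + \<epsilon> + B
        \<kappa> of \<open>v\<close> on the circle; unlike \<open>v\<close>, it is bounded,
        nonnegative and Borel on the whole plane.\<close>
      have "v z \<le> (\<integral>x. w (z + of_real s * x) + \<epsilon> + B * \<kappa> (z + of_real s * x) \<partial>circ)"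
      proof (rule sub[OF s(1), where B = "C + \<epsilon> + B"])
        show "cball z s \<subseteq> {z \<in> G. 0 < dH z}"
        proof
          fix y assume "y \<in> cball z s"
          then have "dist z y \<le> s0" using s by simp
          from near[OF zT this] show "y \<in> {z \<in> G. 0 < dH z}" using \<eta> by simp
        qed
        fix x
        show "0 \<le> w (z + of_real s * x) + \<epsilon> + B * \<kappa> (z + of_real s * x) \<and>
            w (z + of_real s * x) + \<epsilon> + B * \<kappa> (z + of_real s * x) \<le> C + \<epsilon> + B"
          using w0[of "z + of_real s * x"] wC[of "z + of_real s * x"] \<epsilon> B(2) \<kappa>b[of "z + of_real s * x"]
            mult_nonneg_nonneg[of B "\<kappa> (z + of_real s * x)"] mult_left_mono[of "\<kappa> (z + of_real s * x)" 1 B] by auto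
        assume "cmod x = 1"
        then have "dist z (z + of_real s * x) \<le> s0" using s by (simp add: dist_norm norm_mult)
        from near[OF zT this] show "v (z + of_real s * x) \<le> w (z + of_real s * x) + \<epsilon> + B * \<kappa> (z + of_real s * x)"
          by (simp add: w_def)
      qed measurable
      also have "\<dots> = (\<integral>x. w (z + of_real s * x) \<partial>circ) + \<epsilon> + B * (\<integral>x. \<kappa> (z + of_real s * x) \<partial>circ)"
        using wi \<kappa>int[of z s] by simp
      also have "B * (\<integral>x. \<kappa> (z + of_real s * x) \<partial>circ) \<le> B * \<kappa> z + c0 * s\<^sup>2 * indicator Q z"
      proof (cases "z \<in> Q")
        case True
        have "B * (\<integral>x. \<kappa> (z + of_real s * x) \<partial>circ) \<le> B * (\<kappa> z + s\<^sup>2 / \<eta>\<^sup>2)"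
          by (intro mult_left_mono \<kappa>mean B)
        then show ?thesis using True by (simp add: c0_def algebra_simps)
      next
        case nQ: False
        have "(\<integral>x. \<kappa> (z + of_real s * x) \<partial>circ) = (\<integral>x. 0 \<partial>circ)"
        proof (rule integral_cong_AE)
          show "AE x in circ. \<kappa> (z + of_real s * x) = 0"
            using AE_circ
          proof eventually_elim
            case (elim x)
            then have "dist z (z + of_real s * x) \<le> s0" using s by (simp add: dist_norm norm_mult)
            then show ?case using nQ dHl[of z "z + of_real s * x"] s0 by (intro \<kappa>S) (auto simp: Q_def)
          qed
        qed auto
        then show ?thesis using B(2) \<kappa>b(1)[of z] nQ by simp
      qed
      finally show ?thesis using wz by linarith
    qed
    define \<delta>0 where "\<delta>0 = s0"
    define L where "L = {x + y | x y. x \<in> T \<and> y \<in> cball 0 \<delta>0}"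
    have L: "compact L" unfolding L_def by (intro compact_sums T compact_cball)
    have LG: "z \<in> G \<and> \<eta> < dH z" if "z \<in> L" for z
    proof -
      obtain x y where "z = x + y" "x \<in> T" "cmod y \<le> s0" using \<open>z \<in> L\<close> by (auto simp: L_def \<delta>0_def)
      then show ?thesis using near[of x z] by (simp add: dist_norm)
    qed
    have TL: "cball y \<delta>0 \<subseteq> L" if "y \<in> T" for y
    proof
      fix z assume "z \<in> cball y \<delta>0"
      then have "z = y + (z - y)" "z - y \<in> cball 0 \<delta>0" by (auto simp: dist_norm norm_minus_commute)
      then show "z \<in> L" using that unfolding L_def by blast
    qed
    have cmp: "(\<integral>z. w z \<partial>\<mu>1) \<le> (\<integral>z. w z \<partial>\<mu>2) + E"
      if le: "riesz_le L \<mu>1 U1" and ge: "riesz_ge L \<mu>2 U2"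
      for \<mu>1 \<mu>2
    proof -
      have m: "finite_measure \<mu>1" "sets \<mu>1 = sets borel" "finite_measure \<mu>2" "sets \<mu>2 = sets borel"
        using le ge by (auto simp: riesz_le_def riesz_ge_def)
      have R1: "2 * pi * (\<integral>z. \<phi> z \<partial>\<mu>1) \<le> (\<integral>z. U1 z * laplacian \<phi> z \<partial>lborel)"
        and R2: "(\<integral>z. U2 z * laplacian \<phi> z \<partial>lborel) \<le> 2 * pi * (\<integral>z. \<phi> z \<partial>\<mu>2)"
        if "smooth_compact_support L \<phi>" "\<And>z. 0 \<le> \<phi> z" for \<phi>
        using le ge that by (auto simp: riesz_le_def riesz_ge_def)
      \<comment> \<open>Truncation to \<open>L\<close> turns local into global integrability; it
        changes no test integral, because the Laplacian of a test function supported in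
        \<open>L\<close> vanishes off \<open>L\<close>.\<close>
      define V1 where "V1 z = indicator L z *\<^sub>R U1 z" for z
      define V2 where "V2 z = indicator L z *\<^sub>R U2 z" for z
      have LG': "L \<subseteq> G" using LG by auto
      have V: "integrable lborel V1" "integrable lborel V2"
        using U[OF L LG'] by (simp_all add: V1_def[abs_def] V2_def[abs_def] set_integrable_def)
      have Vle: "AE z in lborel. V1 z \<le> V2 z"
        using Ule
      proof eventually_elim
        case (elim z)
        then show ?case using LG[of z] \<eta> by (auto simp: V1_def V2_def indicator_def)
      qed
      have eq: "(\<integral>z. indicator L z *\<^sub>R f z * laplacian \<phi> z \<partial>lborel) = (\<integral>z. f z * laplacian \<phi> z \<partial>lborel)"
        if sm: "smooth_compact_support L \<phi>" for \<phi> and f :: "complex \<Rightarrow> real"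
      proof -
        obtain K where K: "compact K" "K \<subseteq> L" "\<And>z. z \<notin> K \<Longrightarrow> \<phi> z = 0"
          using sm by (auto simp: smooth_compact_support_def)
        have "laplacian \<phi> z = 0" if "z \<notin> L" for z
          by (rule laplacian_zero_outside[of K]) (use K that in \<open>auto intro: compact_imp_closed\<close>)
        then show ?thesis by (intro Bochner_Integration.integral_cong) (auto simp: indicator_def)
      qed
      have "2 * pi * (\<integral>z. w z \<partial>\<mu>1) \<le> 2 * pi * (\<integral>z. w z \<partial>\<mu>2) + 4 * c0 * (\<integral>z. indicator Q' z * (V2 z - V1 z) \<partial>lborel)"
      proof (rule mollified_comparison[OF m wm w0 wC T(1) wT wusc _ TL c00 s0(1) mean _ _ _ V Vle])
        show "0 < \<delta>0" using s0 by (simp add: \<delta>0_def)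
        show "Q \<in> sets borel" "Q' \<in> sets borel" using odH by (auto simp: Q_def Q'_def)
        show "z \<in> Q'" if "y \<in> Q" "dist y z < \<delta>0" for y z
          using that dHl[of y z] s0 by (auto simp: Q_def Q'_def \<delta>0_def)
        show "2 * pi * (\<integral>z. \<phi> z \<partial>\<mu>1) \<le> (\<integral>z. V1 z * laplacian \<phi> z \<partial>lborel)"
          if "smooth_compact_support L \<phi>" "\<And>z. 0 \<le> \<phi> z" for \<phi>
          using R1[OF that] eq[OF that(1), of U1] by (simp add: V1_def)
        show "(\<integral>z. V2 z * laplacian \<phi> z \<partial>lborel) \<le> 2 * pi * (\<integral>z. \<phi> z \<partial>\<mu>2)"
          if "smooth_compact_support L \<phi>" "\<And>z. 0 \<le> \<phi> z" for \<phi>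
          using R2[OF that] eq[OF that(1), of U2] by (simp add: V2_def)
      qed
      \<comment> \<open>\<open>L\<close> depends on \<epsilon>, but it stays beyond distance \<eta>,
        so its part in \<open>Q'\<close> lies in the fixed collar. This removes \<epsilon> from the
        error.\<close>
      also have "4 * c0 * (\<integral>z. indicator Q' z * (V2 z - V1 z) \<partial>lborel) \<le> 4 * c0 * (LINT z:band|lborel. \<bar>U2 z - U1 z\<bar>)"
        unfolding set_lebesgue_integral_def
      proof (intro mult_left_mono integral_mono)
        have "integrable lborel (\<lambda>z. indicator Q' z *\<^sub>R (V2 z - V1 z))"
          using V odH by (intro integrable_mult_indicator) (auto simp: Q'_def)
        then show "integrable lborel (\<lambda>z. indicator Q' z * (V2 z - V1 z))" by simp
        show "integrable lborel (\<lambda>z. indicator band z *\<^sub>R \<bar>U2 z - U1 z\<bar>)"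
          using bi by (simp add: set_integrable_def)
        show "indicator Q' z * (V2 z - V1 z) \<le> indicator band z *\<^sub>R \<bar>U2 z - U1 z\<bar>" for z
          using LG[of z] by (auto simp: V1_def V2_def indicator_def Q'_def band_def)
      qed (use c00 in simp)
      also have "\<dots> = 2 * pi * E" by (simp add: E_def)
      finally have "2 * pi * (\<integral>z. w z \<partial>\<mu>1) \<le> 2 * pi * ((\<integral>z. w z \<partial>\<mu>2) + E)" by (simp add: algebra_simps)
      then show ?thesis by simp
    qed
    show ?thesis
    proof (intro exI[of _ L] exI[of _ w] conjI allI impI)
      show "cutoff_function {z \<in> G. 0 < dH z} {z \<in> G. 3 * \<eta> \<le> dH z} v \<epsilon> L w"
        unfolding cutoff_function_def
      proof (intro conjI allI impI ballI)
      show "L \<subseteq> {z \<in> G. 0 < dH z}"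
      proof
        fix z assume "z \<in> L"
        from LG[OF this] show "z \<in> {z \<in> G. 0 < dH z}" using \<eta> by simp
      qed
      show "w z = 0" if "z \<notin> L" for z
      proof (rule wT)
        show "z \<notin> T" using that TL[of z] s0(1) by (auto simp: \<delta>0_def subset_iff)
      qed
      show "w z \<le> v z" if "z \<in> L" for z using wv[of z] LG[OF that] \<eta> by auto
      show "w z = max 0 (v z - \<epsilon>)" if "z \<in> {z \<in> G. 3 * \<eta> \<le> dH z}" for z
        using that \<kappa>S[of z] \<eta> by (auto simp: w_def)
      qed (use L wm w0 wC in auto)
    qed (fact cmp)
  qed
  show ?thesis using E0 main by blast
qed

section \<open>The sphere\<close>

lemma insert_None_range_Some [simp]: "insert None (range Some) = UNIV"
  by (simp add: UNIV_option_conv)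

text \<open>For a neighbourhood of \<infinity> the complement in the plane has to be compact; it is
  closed as soon as the finite part is open, which leaves boundedness.\<close>

lemma openin_sphere_iff:
  "openin sphere_top W \<longleftrightarrow> open (Some -` W) \<and> (None \<in> W \<longrightarrow> bounded (- Some -` W))"
proof
  assume "openin sphere_top W"
  then have "(\<exists>U. open U \<and> W = Some ` U) \<or> (\<exists>C. compact C \<and> W = insert None (Some ` (- C)))"
    unfolding openin_Alexandroff_compactification Compl_eq_Diff_UNIV by simp blast
  then consider U where "open U" "W = Some ` U" | C where "compact C" "W = insert None (Some ` (- C))"
    by blast
  then show "open (Some -` W) \<and> (None \<in> W \<longrightarrow> bounded (- Some -` W))"
  proof cases
    case 1
    then have "Some -` W = U" by auto
    with 1 show ?thesis by auto
  next
    case 2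
    then have "Some -` W = - C" by auto
    with 2 show ?thesis by (auto simp: compact_imp_closed compact_imp_bounded open_Compl)
  qed
next
  assume a: "open (Some -` W) \<and> (None \<in> W \<longrightarrow> bounded (- Some -` W))"
  show "openin sphere_top W"
  proof (cases "None \<in> W")
    case True
    then have "compact (- Some -` W)" using a by (simp add: compact_eq_bounded_closed closed_Compl)
    moreover have "W = insert None (Some ` (UNIV - (- Some -` W)))"
      using True by (auto simp: image_iff; metis not_None_eq)
    ultimately show ?thesis
      unfolding openin_Alexandroff_compactification
      by (intro disjI2 exI[of _ "- Some -` W"]) (use a in \<open>simp add: closed_Compl\<close>)
  next
    case False
    then have "W = Some ` (Some -` W)" by (auto simp: image_iff; metis not_None_eq)
    then show ?thesis using a unfolding openin_Alexandroff_compactification by auto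
  qed
qed


lemma bounded_Compl_iff: "bounded (- A :: complex set) \<longleftrightarrow> (\<exists>R>0. \<forall>z. R \<le> cmod z \<longrightarrow> z \<in> A)"
proof
  assume "bounded (- A)"
  then obtain R where "R > 0" "\<And>z. z \<in> - A \<Longrightarrow> cmod z \<le> R" by (auto simp: bounded_pos)
  then show "\<exists>R>0. \<forall>z. R \<le> cmod z \<longrightarrow> z \<in> A"
    by (intro exI[of _ "R + 1"]) force
next
  assume "\<exists>R>0. \<forall>z. R \<le> cmod z \<longrightarrow> z \<in> A"
  then obtain R where "\<And>z. R \<le> cmod z \<Longrightarrow> z \<in> A" by auto
  then have "- A \<subseteq> ball 0 R" by (force simp: not_le[symmetric])
  then show "bounded (- A)" using bounded_ball bounded_subset by blast
qed

lemma open_inv_chart_vimage: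
  assumes "openin sphere_top W"
  shows "open (inv_chart -` W)"
  unfolding open_contains_ball
proof
  fix w assume w: "w \<in> inv_chart -` W"
  have o: "open (Some -` W)" using assms by (simp add: openin_sphere_iff)
  show "\<exists>e>0. ball w e \<subseteq> inv_chart -` W"
  proof (cases "w = 0")
    case True
    then have "None \<in> W" using w by (simp add: inv_chart_def)
    then obtain R where R: "R > 0" "\<And>z. R \<le> cmod z \<Longrightarrow> Some z \<in> W"
      using assms by (auto simp: openin_sphere_iff bounded_Compl_iff)
    have "ball w (1 / R) \<subseteq> inv_chart -` W"
    proof
      fix x assume x: "x \<in> ball w (1 / R)"
      show "x \<in> inv_chart -` W"
      proof (cases "x = 0")
        case False
        then have "R \<le> cmod (1 / cnj x)" using x True R(1) by (simp add: norm_divide field_simps)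
        then show ?thesis using R(2) False by (simp add: inv_chart_def)
      qed (use \<open>None \<in> W\<close> in \<open>simp add: inv_chart_def\<close>)
    qed
    then show ?thesis using R(1) by (intro exI[of _ "1 / R"]) auto
  next
    case False
    have "open ((\<lambda>x. 1 / cnj x) -` (Some -` W) \<inter> (- {0}))"
      by (rule continuous_open_preimage[OF _ _ o, of "- {0}", unfolded Int_commute[of "- {0}"]])
         (auto intro!: continuous_intros)
    moreover have "w \<in> (\<lambda>x. 1 / cnj x) -` (Some -` W) \<inter> (- {0})"
      using w False by (simp add: inv_chart_def)
    ultimately obtain e where "e > 0" "ball w e \<subseteq> (\<lambda>x. 1 / cnj x) -` (Some -` W) \<inter> (- {0})"
      by (rule openE)
    then show ?thesis by (intro exI[of _ e]) (auto simp: inv_chart_def subset_iff)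
  qed
qed

text \<open>A disc about 0 in the inverted chart is a neighbourhood of \<infinity>. With this,
  openness of sublevel sets on the sphere can be read off from the two planar conditions in
  \<open>subharmonic\<close>.\<close>

lemma openin_sphere_charts:
  assumes "open (Some -` W)" "open (inv_chart -` W)"
  shows "openin sphere_top W"
  unfolding openin_sphere_iff bounded_Compl_iff
proof (intro conjI impI assms(1))
  assume "None \<in> W"
  then have "0 \<in> inv_chart -` W" by (simp add: inv_chart_def)
  then obtain e where e: "e > 0" "ball 0 e \<subseteq> inv_chart -` W"
    by (rule openE[OF assms(2)])
  show "\<exists>R>0. \<forall>z. R \<le> cmod z \<longrightarrow> z \<in> Some -` W"
  proof (intro exI[of _ "2 / e"] conjI allI impI)
    fix z assume z: "2 / e \<le> cmod z"
    then have z0: "z \<noteq> 0" "cmod z > 0" using e(1) by auto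
    have "1 / cmod z < e" using z e(1) z0(2) by (simp add: field_simps)
    then have "1 / cnj z \<in> ball 0 e" by (simp add: norm_divide)
    then have "inv_chart (1 / cnj z) \<in> W" using e(2) by auto
    then show "z \<in> Some -` W" using z0 by (simp add: inv_chart_def)
  qed (use e in simp)
qed

lemma closedin_sphere_imp_compactin: "closedin sphere_top C \<Longrightarrow> compactin sphere_top C"
  by (simp add: closedin_compact_space)

lemma openin_sphere_Some: "open A \<Longrightarrow> openin sphere_top (Some ` A)"
  by simp

lemma compactin_sphere_Some: "compact K \<Longrightarrow> compactin sphere_top (Some ` K)"
  using image_compactin[OF _ continuous_map_Some, of euclidean K] by simp

text \<open>The set \<open>H\<close> contains the finite points of \<open>D0\<close> and, if \<open>\<infinity>\<close> lies in \<open>D\<close>, also a punctured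
  neighbourhood of \<open>\<infinity>\<close>. Thus only the chart \<open>Some\<close> is needed outside \<open>H\<close>.\<close>

lemma domain_collar:
  assumes D: "openin sphere_top D" "D \<noteq> UNIV" and D0: "openin sphere_top D0" "D0 \<noteq> {}" and rc: "relatively_compact_in D0 D"
  obtains H \<eta> where "closed H" "H \<noteq> {}" "0 < \<eta>" "\<And>z. infdist z H \<le> 5 * \<eta> \<Longrightarrow> Some z \<in> D"
    "\<And>z. Some z \<in> D0 \<Longrightarrow> z \<in> H" "compact {z. \<eta> \<le> infdist z H \<and> infdist z H \<le> 5 * \<eta>}"
    "{z. 3 * \<eta> \<le> infdist z H} \<noteq> {}" "None \<in> D \<Longrightarrow> bounded (- H)"
    "closedin sphere_top (Some ` {z. infdist z H \<le> 3 * \<eta>} \<union> ({None} \<inter> D))"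
proof -
  define C where "C = sphere_top closure_of D0"
  have C: "C \<subseteq> D" "closedin sphere_top C" "D0 \<subseteq> C"
    using rc closure_of_subset[of D0 sphere_top] by (simp_all add: C_def relatively_compact_in_def)
  have oC: "openin sphere_top (- C)" using C(2) by (simp add: closedin_def Compl_eq_Diff_UNIV)
  define G where "G = Some -` D"
  define Hc where "Hc = Some -` C"
  have oG: "open G" using D by (simp add: G_def openin_sphere_iff)
  have "- Hc = Some -` (- C)" by (auto simp: Hc_def)
  then have Hc: "closed Hc" "None \<notin> C \<Longrightarrow> bounded Hc"
    using oC by (auto simp: openin_sphere_iff closed_def vimage_Compl Hc_def)
  have cont: "continuous_on UNIV (\<lambda>z. infdist z H)" for H :: "complex set" by (intro continuous_intros)
  have cl: "closed {z. infdist z H \<le> a}" "closed {z. a \<le> infdist z H}" "open {z. a < infdist z H}" for H :: "complex set" and a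
    using cont by (auto intro: open_Collect_less closed_Collect_le continuous_intros)
  show ?thesis
  proof (cases "None \<in> D")
    case True
    then obtain R where R: "R > 0" "\<And>z. R \<le> cmod z \<Longrightarrow> z \<in> G"
      using D(1) by (auto simp: openin_sphere_iff bounded_Compl_iff G_def)
    define H where "H = Hc \<union> {z. R \<le> cmod z}"
    have H: "closed H" "H \<noteq> {}"
    proof -
      show "closed H" unfolding H_def by (intro closed_Un Hc closed_Collect_le continuous_intros)
      have "of_real R \<in> H" using R(1) by (simp add: H_def)
      then show "H \<noteq> {}" by auto
    qed
    have HG: "H \<subseteq> G" using C(1) R by (auto simp: H_def Hc_def G_def)
    have bH: "bounded (- H)" unfolding bounded_Compl_iff using R(1) by (auto simp: H_def)
    \<comment> \<open>Separation by a positive distance requires one compact set. With \<infinity>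
      in \<open>D\<close> it is the complement of \<open>G\<close>; in the other case it will be
      \<open>Hc\<close>.\<close>
    have "compact (- G)" using oG True D(1) by (simp add: compact_eq_bounded_closed closed_Compl openin_sphere_iff G_def)
    moreover have "- G \<inter> H = {}" using HG by auto
    ultimately have ex: "\<exists>d>0. \<forall>x\<in>- G. \<forall>y\<in>H. d \<le> dist x y"
      by (intro separate_compact_closed H)
    obtain d where d0: "d > 0" and d1: "\<forall>x\<in>- G. \<forall>y\<in>H. d \<le> dist x y"
      using ex by (elim exE conjE)
    have d2: "d \<le> dist x y" if "x \<in> - G" "y \<in> H" for x y using d1 that by (elim ballE) auto
    note d = d0 d2
    \<comment> \<open>Any fraction of \<open>d\<close> below 1/5 keeps all points at distance at
      most 5 \<eta> from \<open>H\<close> inside \<open>G\<close>.\<close>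
    define \<eta> where "\<eta> = d / 6"
    have \<eta>: "\<eta> > 0" "5 * \<eta> < d" using d by (auto simp: \<eta>_def)
    have inG: "z \<in> G" if "infdist z H \<le> 5 * \<eta>" for z
    proof (rule ccontr)
      assume "z \<notin> G"
      moreover obtain p where "p \<in> H" "infdist z H = dist z p" using infdist_attains_inf[OF H] by metis
      ultimately show False using d(2)[of z p] that \<eta> by simp
    qed
    show ?thesis
    proof (rule that[OF H \<eta>(1)])
      show "\<And>z. infdist z H \<le> 5 * \<eta> \<Longrightarrow> Some z \<in> D" using inG by (simp add: G_def)
      show "\<And>z. Some z \<in> D0 \<Longrightarrow> z \<in> H" using C by (auto simp: H_def Hc_def)
      have "{z. \<eta> \<le> infdist z H \<and> infdist z H \<le> 5 * \<eta>} \<subseteq> - H" using \<eta> by auto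
      moreover have "{z. \<eta> \<le> infdist z H \<and> infdist z H \<le> 5 * \<eta>} = {z. \<eta> \<le> infdist z H} \<inter> {z. infdist z H \<le> 5 * \<eta>}" by auto
      ultimately show "compact {z. \<eta> \<le> infdist z H \<and> infdist z H \<le> 5 * \<eta>}"
        unfolding compact_eq_bounded_closed using bounded_subset[OF bH] closed_Int[OF cl(2) cl(1)] by auto
      \<comment> \<open>Here \<open>D \<noteq> UNIV\<close> enters: as \<infinity> is in
        \<open>D\<close>, the missing point is finite, and by \<open>inG\<close> it is farther than
        5 \<eta> from \<open>H\<close>.\<close>
      obtain p where "p \<notin> D" using D(2) by auto
      then obtain z where "z \<notin> G" using True by (cases p) (auto simp: G_def)
      then have "3 * \<eta> \<le> infdist z H" using inG[of z] \<eta> by linarith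
      then show "{z. 3 * \<eta> \<le> infdist z H} \<noteq> {}" by auto
      show "bounded (- H)" by (rule bH)
      have "UNIV - (Some ` {z. infdist z H \<le> 3 * \<eta>} \<union> ({None} \<inter> D)) = Some ` {z. 3 * \<eta> < infdist z H}"
      proof (rule set_eqI)
        fix p
        show "p \<in> UNIV - (Some ` {z. infdist z H \<le> 3 * \<eta>} \<union> ({None} \<inter> D))
            \<longleftrightarrow> p \<in> Some ` {z. 3 * \<eta> < infdist z H}"
          using True by (cases p) (auto simp: image_iff not_le)
      qed
      then show "closedin sphere_top (Some ` {z. infdist z H \<le> 3 * \<eta>} \<union> ({None} \<inter> D))"
        unfolding closedin_def using openin_sphere_Some[OF cl(3)] by simp
    qed
  next
    case False
    then have nC: "None \<notin> C" using C by auto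
    have bH: "bounded Hc" using Hc nC by simp
    obtain p where p: "p \<in> D0" using D0 by auto
    then have ne: "Hc \<noteq> {}" using C(3) nC by (cases p) (auto simp: Hc_def)
    have HG: "Hc \<subseteq> G" using C(1) by (auto simp: Hc_def G_def)
    have "compact Hc" using bH Hc by (simp add: compact_eq_bounded_closed)
    moreover have "Hc \<inter> - G = {}" using HG by auto
    ultimately have ex: "\<exists>d>0. \<forall>x\<in>Hc. \<forall>y\<in>- G. d \<le> dist x y"
      by (intro separate_compact_closed closed_Compl) (use oG in auto)
    obtain d where d0: "d > 0" and d1: "\<forall>x\<in>Hc. \<forall>y\<in>- G. d \<le> dist x y"
      using ex by (elim exE conjE)
    have d2: "d \<le> dist x y" if "x \<in> Hc" "y \<in> - G" for x y using d1 that by (elim ballE) auto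
    note d = d0 d2
    define \<eta> where "\<eta> = d / 6"
    have \<eta>: "\<eta> > 0" "5 * \<eta> < d" using d by (auto simp: \<eta>_def)
    obtain b where b: "\<And>z. z \<in> Hc \<Longrightarrow> cmod z \<le> b" using bH by (auto simp: bounded_iff)
    have nb: "cmod z \<le> b + infdist z Hc" for z
    proof -
      obtain p where "p \<in> Hc" "infdist z Hc = dist z p" using infdist_attains_inf[OF Hc(1) ne] by metis
      then show ?thesis using b[of p] norm_triangle_ineq2[of z p] by (simp add: dist_norm)
    qed
    have bN: "bounded {z. infdist z Hc \<le> a}" for a
    proof -
      have "cmod z \<le> b + a" if "infdist z Hc \<le> a" for z using nb[of z] that by linarith
      then show ?thesis unfolding bounded_iff by (intro exI[of _ "b + a"]) simp
    qed
    show ?thesis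
    proof (rule that[OF Hc(1) ne \<eta>(1)])
      show "Some z \<in> D" if "infdist z Hc \<le> 5 * \<eta>" for z
      proof (rule ccontr)
        assume "Some z \<notin> D"
        moreover obtain p where "p \<in> Hc" "infdist z Hc = dist z p" using infdist_attains_inf[OF Hc(1) ne] by metis
        ultimately show False using d(2)[of p z] that \<eta> by (simp add: G_def dist_commute)
      qed
      show "\<And>z. Some z \<in> D0 \<Longrightarrow> z \<in> Hc" using C by (auto simp: Hc_def)
      have "{z. \<eta> \<le> infdist z Hc \<and> infdist z Hc \<le> 5 * \<eta>} = {z. \<eta> \<le> infdist z Hc} \<inter> {z. infdist z Hc \<le> 5 * \<eta>}" by auto
      then show "compact {z. \<eta> \<le> infdist z Hc \<and> infdist z Hc \<le> 5 * \<eta>}"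
        unfolding compact_eq_bounded_closed
        using bounded_Int[of "{z. \<eta> \<le> infdist z Hc}" "{z. infdist z Hc \<le> 5 * \<eta>}"] bN closed_Int[OF cl(2) cl(1)] by auto
      \<comment> \<open>\<open>Hc\<close> lies in the disc of radius \<open>b\<close>, so a point of
        modulus \<bar>b\<bar> + 3 \<eta> has distance at least 3 \<eta> from it.\<close>
      have "of_real (\<bar>b\<bar> + 3 * \<eta>) \<in> {z. 3 * \<eta> \<le> infdist z Hc}"
        using nb[of "of_real (\<bar>b\<bar> + 3 * \<eta>)"] \<eta> by (simp del: of_real_add)
      then show "{z. 3 * \<eta> \<le> infdist z Hc} \<noteq> {}" by auto
      show "None \<in> D \<Longrightarrow> bounded (- Hc)" using False by simp
      have "compact {z. infdist z Hc \<le> 3 * \<eta>}" unfolding compact_eq_bounded_closed using bN cl by simp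
      then show "closedin sphere_top (Some ` {z. infdist z Hc \<le> 3 * \<eta>} \<union> ({None} \<inter> D))"
        using False by (simp add: compact_imp_closed)
    qed
  qed
qed

text \<open>The part of \<open>riesz_measure\<close> that does not mention the function; it is
  shared with the counting measure of a zero sequence, which need not be a Riesz measure.\<close>

definition radon_on :: "complex option set \<Rightarrow> complex option measure \<Rightarrow> bool" where
  "radon_on D \<nu> \<longleftrightarrow> space \<nu> = D \<and> sets \<nu> = sigma_sets D {U. openin sphere_top U \<and> U \<subseteq> D} \<and>
     (\<forall>K. compactin sphere_top K \<and> K \<subseteq> D \<longrightarrow> emeasure \<nu> K < \<infinity>)"

lemma radon_on_open: "radon_on D \<nu> \<Longrightarrow> openin sphere_top U \<Longrightarrow> U \<subseteq> D \<Longrightarrow> U \<in> sets \<nu>"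
  by (auto simp: radon_on_def intro!: sigma_sets.Basic)

lemma radon_on_closed:
  assumes "radon_on D \<nu>" "openin sphere_top D" "closedin sphere_top C" "C \<subseteq> D"
  shows "C \<in> sets \<nu>"
proof -
  have "openin sphere_top (D - C)" using assms by (simp add: openin_diff)
  then have "D - C \<in> sets \<nu>" by (rule radon_on_open[OF assms(1)]) auto
  then have "space \<nu> - (D - C) \<in> sets \<nu>" by (rule sets.compl_sets)
  moreover have "space \<nu> - (D - C) = C" using assms by (auto simp: radon_on_def)
  ultimately show ?thesis by simp
qed

lemma measurable_the:
  assumes "radon_on D \<nu>" "openin sphere_top D"
  shows "the \<in> borel_measurable \<nu>"
proof (rule borel_measurableI)
  fix S :: "complex set" assume S: "open S"
  have sp: "space \<nu> = D" using assms by (simp add: radon_on_def)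
  have oD: "open (Some -` D)" using assms(2) by (simp add: openin_sphere_iff)
  have 1: "Some ` (S \<inter> Some -` D) \<in> sets \<nu>"
    by (rule radon_on_open[OF assms(1)]) (use S oD in \<open>auto intro!: openin_sphere_Some\<close>)
  have 2: "Some ` (Some -` D) \<in> sets \<nu>"
    by (rule radon_on_open[OF assms(1) openin_sphere_Some[OF oD]]) auto
  then have 3: "D - Some ` (Some -` D) \<in> sets \<nu>" using sp by (metis sets.compl_sets)
  have 4: "D - Some ` (Some -` D) = {None} \<inter> D" by (auto simp: image_iff; metis not_None_eq)
  show "the -` S \<inter> space \<nu> \<in> sets \<nu>"
  \<comment> \<open>\<open>the None\<close> is an unspecified complex number, so whether the point
    \<infinity> belongs to the preimage depends on \<open>S\<close>.\<close>
  proof (cases "the None \<in> S")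
    case True
    have "the -` S \<inter> space \<nu> = Some ` (S \<inter> Some -` D) \<union> (D - Some ` (Some -` D))"
      unfolding 4 sp
    proof (rule set_eqI)
      fix p
      show "p \<in> the -` S \<inter> D \<longleftrightarrow> p \<in> Some ` (S \<inter> Some -` D) \<union> {None} \<inter> D"
        using True by (cases p) auto
    qed
    then show ?thesis using 1 3 by simp
  next
    case False
    have "the -` S \<inter> space \<nu> = Some ` (S \<inter> Some -` D)"
      unfolding sp
    proof (rule set_eqI)
      fix p
      show "p \<in> the -` S \<inter> D \<longleftrightarrow> p \<in> Some ` (S \<inter> Some -` D)"
        using False by (cases p) auto
    qed
    then show ?thesis using 1 by simp
  qed
qed

text \<open>The planar estimate wants finite Borel measures on the plane. Restricting through a
  density rather than to a subspace keeps the domain of \<open>the\<close> unchanged, and the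
  density kills \<infinity>, so the value \<open>the None\<close> never matters.\<close>

definition plane_part :: "complex option measure \<Rightarrow> complex set \<Rightarrow> complex measure" where
  "plane_part \<nu> L = distr (density \<nu> (\<lambda>p. ennreal (indicator (Some ` L) p))) borel the"

lemma plane_part:
  assumes \<nu>: "radon_on D \<nu>" and D: "openin sphere_top D" and L: "compact L" "Some ` L \<subseteq> D"
  shows "finite_measure (plane_part \<nu> L)" "sets (plane_part \<nu> L) = sets borel"
    "\<And>f. f \<in> borel_measurable borel \<Longrightarrow> (\<integral>\<^sup>+z. f z \<partial>plane_part \<nu> L) = (\<integral>\<^sup>+p. indicator (Some ` L) p * f (the p) \<partial>\<nu>)"
    "\<And>\<phi>. \<phi> \<in> borel_measurable borel \<Longrightarrow> (\<And>z. z \<notin> L \<Longrightarrow> \<phi> z = 0) \<Longrightarrow> (\<integral>z. \<phi> z \<partial>plane_part \<nu> L) = (\<integral>p. transport Some \<phi> p \<partial>\<nu>)"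
    "Some ` L \<in> sets \<nu>"
proof -
  note [measurable] = measurable_the[OF \<nu> D]
  have H: "Hausdorff_space (sphere_top :: complex option topology)"
    by (simp add: Hausdorff_space_Alexandroff_compactification locally_compact_space_euclidean)
  have c: "compactin sphere_top (Some ` L)" using L by (intro compactin_sphere_Some)
  then have "closedin sphere_top (Some ` L)" using H by (rule compactin_imp_closedin[rotated])
  then show LM[measurable]: "Some ` L \<in> sets \<nu>" using radon_on_closed[OF \<nu> D] L by blast
  show s: "sets (plane_part \<nu> L) = sets borel" by (simp add: plane_part_def)
  show nn: "(\<integral>\<^sup>+z. f z \<partial>plane_part \<nu> L) = (\<integral>\<^sup>+p. indicator (Some ` L) p * f (the p) \<partial>\<nu>)"
    if [measurable]: "f \<in> borel_measurable borel" for f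
  proof -
    have "(\<integral>\<^sup>+z. f z \<partial>plane_part \<nu> L) = (\<integral>\<^sup>+p. ennreal (indicator (Some ` L) p) * f (the p) \<partial>\<nu>)"
      unfolding plane_part_def by (subst nn_integral_distr, simp, simp, subst nn_integral_density) auto
    then show ?thesis by (simp add: ennreal_indicator)
  qed
  show "finite_measure (plane_part \<nu> L)"
  proof
    have "emeasure (plane_part \<nu> L) (space (plane_part \<nu> L)) = (\<integral>\<^sup>+z. 1 \<partial>plane_part \<nu> L)" by simp
    also have "\<dots> = emeasure \<nu> (Some ` L)" by (subst nn) auto
    also have "\<dots> < \<infinity>" using \<nu> c L(2) by (simp add: radon_on_def)
    finally show "emeasure (plane_part \<nu> L) (space (plane_part \<nu> L)) \<noteq> \<infinity>" by simp
  qed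
  show "(\<integral>z. \<phi> z \<partial>plane_part \<nu> L) = (\<integral>p. transport Some \<phi> p \<partial>\<nu>)"
    if [measurable]: "\<phi> \<in> borel_measurable borel" and z: "\<And>z. z \<notin> L \<Longrightarrow> \<phi> z = 0" for \<phi> :: "complex \<Rightarrow> real"
  proof -
    have "(\<integral>z. \<phi> z \<partial>plane_part \<nu> L) = (\<integral>p. indicator (Some ` L) p *\<^sub>R \<phi> (the p) \<partial>\<nu>)"
      unfolding plane_part_def by (subst integral_distr, simp, simp, subst integral_density) auto
    also have "\<dots> = (\<integral>p. transport Some \<phi> p \<partial>\<nu>)"
    proof (rule Bochner_Integration.integral_cong[OF refl])
      fix p :: "complex option"
      show "indicator (Some ` L) p *\<^sub>R \<phi> (the p) = transport Some \<phi> p"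
        using z by (cases p) (auto simp: transport_def indicator_def)
    qed
    finally show ?thesis .
  qed
qed

section \<open>Transfer of the test integral\<close>

text \<open>This trades the extended-real \<open>circle_mean\<close> for an ordinary integral of a
  bounded Borel majorant: the majorant bounds the positive part, and the negative part is
  discarded.\<close>

lemma subharmonic_plane_mean_le:
  assumes f: "subharmonic_plane W f" and s: "0 < s" "cball z s \<subseteq> W"
    and h[measurable]: "h \<in> borel_measurable borel" and hb: "\<And>x. 0 \<le> h x \<and> h x \<le> B"
    and fh: "\<And>x. cmod x = 1 \<Longrightarrow> f (z + of_real s * x) \<le> ereal (h x)"
  shows "f z \<le> ereal (\<integral>x. h x \<partial>circ)"
proof -
  define X where "X = (\<integral>\<^sup>+t\<in>{0..2*pi}. e2ennreal (f (z + of_real s * cis t)) \<partial>lborel)"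
  define Y where "Y = (\<integral>\<^sup>+t\<in>{0..2*pi}. e2ennreal (- f (z + of_real s * cis t)) \<partial>lborel)"
  have hi: "integrable circ h" using hb by (intro integrable_circ[of _ B]) auto
  have "X \<le> (\<integral>\<^sup>+t\<in>{0..2*pi}. ennreal (h (cis t)) \<partial>lborel)"
    unfolding X_def using fh by (intro nn_integral_mono mult_right_mono) (auto simp: e2ennreal_ereal[symmetric] intro!: e2ennreal_mono simp del: e2ennreal_ereal)
  also have "\<dots> = ennreal (2 * pi) * (ennreal (1 / (2 * pi)) * (\<integral>\<^sup>+t\<in>{0..2*pi}. ennreal (h (cis t)) \<partial>lborel))"
    by (simp add: mult.assoc[symmetric] ennreal_mult[symmetric])
  also have "\<dots> = ennreal (2 * pi) * (\<integral>\<^sup>+x. ennreal (h x) \<partial>circ)"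
    by (subst nn_integral_circ) auto
  also have "\<dots> = ennreal (2 * pi * (\<integral>x. h x \<partial>circ))"
    using hi hb by (simp add: nn_integral_eq_integral ennreal_mult)
  finally have "enn2ereal X \<le> ereal (2 * pi * (\<integral>x. h x \<partial>circ))"
    using hb by (simp add: enn2ereal_ennreal less_eq_ennreal.rep_eq)
  \<comment> \<open>\<open>Y\<close> may be infinite, and then the difference is -\<infinity>; in
    every case subtracting a nonnegative number only decreases.\<close>
  moreover have "enn2ereal X - enn2ereal Y \<le> enn2ereal X"
    by (cases "enn2ereal X"; cases "enn2ereal Y") (use enn2ereal_nonneg[of Y] in auto)
  ultimately have "(enn2ereal X - enn2ereal Y) / ereal (2 * pi) \<le> ereal (2 * pi * (\<integral>x. h x \<partial>circ)) / ereal (2 * pi)"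
    by (intro ereal_divide_right_mono) (auto intro: order_trans)
  moreover have "f z \<le> circle_mean f z s" using f s by (auto simp: subharmonic_plane_def)
  ultimately show ?thesis by (simp add: circle_mean_def X_def Y_def)
qed

section \<open>Semicontinuity on the sphere and smallness near the boundary\<close>

lemma openin_sphere_sublevel:
  assumes "subharmonic U V"
  shows "openin sphere_top {p \<in> U. V p < c}"
proof (rule openin_sphere_charts)
  have "Some -` {p \<in> U. V p < c} = {z \<in> Some -` U. (V \<circ> Some) z < c}" by auto
  then show "open (Some -` {p \<in> U. V p < c})" using assms by (simp add: subharmonic_def subharmonic_plane_def)
  have "inv_chart -` {p \<in> U. V p < c} = {z \<in> inv_chart -` U. (V \<circ> inv_chart) z < c}" by auto
  then show "open (inv_chart -` {p \<in> U. V p < c})" using assms by (simp add: subharmonic_def subharmonic_plane_def)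
qed

lemma subharmonic_less_top:
  assumes "subharmonic U V" "p \<in> U"
  shows "V p < \<infinity>"
proof (cases p)
  case (Some z)
  then show ?thesis using assms by (auto simp: subharmonic_def subharmonic_plane_def)
next
  case None
  then have "inv_chart 0 = p" by (simp add: inv_chart_def)
  moreover have "\<forall>z\<in>inv_chart -` U. V (inv_chart z) < \<infinity>"
    using assms by (auto simp: subharmonic_def subharmonic_plane_def)
  ultimately show ?thesis using assms(2) by (metis vimageI2)
qed

lemma subharmonic_bounded_on_compact:
  assumes V: "subharmonic U V" and K: "compactin sphere_top K" "K \<subseteq> U"
  obtains C where "\<And>p. p \<in> K \<Longrightarrow> V p \<le> ereal C" "0 \<le> C"
proof -
  let ?W = "\<lambda>n. {p \<in> U. V p < ereal (real n)}"
  have cover: "K \<subseteq> \<Union>(range ?W)"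
  proof
    fix p assume "p \<in> K"
    then have "p \<in> U" "V p < \<infinity>" using K subharmonic_less_top[OF V] by auto
    then have "\<exists>n. V p < ereal (real n)" using less_PInf_Ex_of_nat[of "V p"] by auto
    then obtain n where "V p < ereal (real n)" by (elim exE)
    then show "p \<in> \<Union>(range ?W)" using \<open>p \<in> U\<close> by blast
  qed
  have opn: "openin sphere_top W" if "W \<in> range ?W" for W
    using that openin_sphere_sublevel[OF V] by auto
  have "\<exists>F. finite F \<and> F \<subseteq> range ?W \<and> K \<subseteq> \<Union>F"
    by (rule compactinD[OF K(1) opn cover])
  then obtain F where F: "finite F" "F \<subseteq> range ?W" "K \<subseteq> \<Union>F"
    by (elim exE conjE)
  obtain N where N: "finite N" "F = ?W ` N" using finite_subset_image[OF F(1,2)] by blast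
  have "V p \<le> ereal (real (\<Sum>N))" if "p \<in> K" for p
  proof -
    have "p \<in> \<Union>(?W ` N)" using F(3) N(2) that by blast
    then obtain n where n: "n \<in> N" "V p < ereal (real n)" by blast
    then have "n \<le> \<Sum>N" using N(1) member_le_sum[of n N "\<lambda>x. x"] by auto
    then have "ereal (real n) \<le> ereal (real (\<Sum>N))" by (simp del: of_nat_sum)
    then show ?thesis using n(2) by (meson less_imp_le order_trans)
  qed
  then show ?thesis using that[of "real (\<Sum>N)"] by (simp del: of_nat_sum)
qed

text \<open>At a boundary point this is the limit condition; any other point outside
  \<open>D\<close> is exterior and has a neighbourhood that misses \<open>D\<close>
  altogether.\<close>

lemma sbh0_pos_small_near_complement:
  assumes D: "openin sphere_top D" and v: "v \<in> sbh0_pos D D0" and p: "p \<notin> D" and \<epsilon>: "0 < (\<epsilon>::ereal)"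
  shows "\<exists>W. openin sphere_top W \<and> p \<in> W \<and> (\<forall>q\<in>W \<inter> D. v q < \<epsilon>)"
proof (cases "p \<in> sphere_top frontier_of D")
  case True
  then have "(v \<longlongrightarrow> 0) (atin_within sphere_top p D)" using v by (simp add: sbh0_pos_def)
  then have "\<forall>\<^sub>F q in atin_within sphere_top p D. v q < \<epsilon>" using \<epsilon> by (rule order_tendstoD)
  then obtain T where "openin sphere_top T" "p \<in> T" "\<forall>x\<in>T. x \<in> D \<and> x \<noteq> p \<longrightarrow> v x < \<epsilon>"
    by (auto simp: eventually_atin_within)
  then show ?thesis using p by (intro exI[of _ T]) auto
next
  case False
  have "sphere_top interior_of D = D" using D by (simp add: interior_of_openin)
  then have "p \<notin> sphere_top closure_of D" using False p by (simp add: frontier_of_def)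
  moreover have "openin sphere_top (topspace sphere_top - sphere_top closure_of D)"
    by (intro openin_diff openin_topspace closedin_closure_of)
  moreover have "D \<subseteq> sphere_top closure_of D" by (rule closure_of_subset) simp
  ultimately show ?thesis
    by (intro exI[of _ "topspace sphere_top - sphere_top closure_of D"]) auto
qed

lemma SUP_max_minus_inverse:
  fixes a :: real
  assumes "0 \<le> a"
  shows "(SUP n. ennreal (max 0 (a - 1 / real (Suc n)))) = ennreal a"
proof (rule LIMSEQ_unique[OF LIMSEQ_SUP])
  show "incseq (\<lambda>n. ennreal (max 0 (a - 1 / real (Suc n))))"
    by (rule incseq_SucI, intro ennreal_leI max.mono order_refl diff_left_mono) (simp add: frac_le)
  have "(\<lambda>n. max 0 (a - 1 / real (Suc n))) \<longlonglongrightarrow> max 0 (a - 0)"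
    by (intro tendsto_intros LIMSEQ_Suc lim_const_over_n)
  then show "(\<lambda>n. ennreal (max 0 (a - 1 / real (Suc n)))) \<longlonglongrightarrow> ennreal a"
    using assms by (intro tendsto_ennrealI) simp
qed

text \<open>The common core of both implications. Real functions and one-sided test inequalities are
  used so that the smaller side may be a subharmonic function with its Riesz measure or log
  \<bar>f\<bar> with a counting measure of zeros.\<close>

lemma test_integral_transfer:
  fixes U1 U2 :: "complex \<Rightarrow> real"
  assumes D: "openin sphere_top D" "D \<noteq> UNIV" and D0: "openin sphere_top D0" "D0 \<noteq> {}" and rc: "relatively_compact_in D0 D"
    and v: "v \<in> sbh0_pos D D0"
    and \<nu>1: "radon_on D \<nu>1" and \<nu>2: "radon_on D \<nu>2"
    and U: "\<And>K. compact K \<Longrightarrow> K \<subseteq> Some -` D \<Longrightarrow> set_integrable lborel K U1" "\<And>K. compact K \<Longrightarrow> K \<subseteq> Some -` D \<Longrightarrow> set_integrable lborel K U2"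
    and Ule: "AE z in lborel. Some z \<in> D - D0 \<longrightarrow> U1 z \<le> U2 z"
    and R1: "\<And>\<phi>. smooth_compact_support (Some -` D) \<phi> \<Longrightarrow> (\<And>z. 0 \<le> \<phi> z) \<Longrightarrow>
        2 * pi * (\<integral>p. transport Some \<phi> p \<partial>\<nu>1) \<le> (\<integral>z. U1 z * laplacian \<phi> z \<partial>lborel)"
    and R2: "\<And>\<phi>. smooth_compact_support (Some -` D) \<phi> \<Longrightarrow> (\<And>z. 0 \<le> \<phi> z) \<Longrightarrow>
        (\<integral>z. U2 z * laplacian \<phi> z \<partial>lborel) \<le> 2 * pi * (\<integral>p. transport Some \<phi> p \<partial>\<nu>2)"
    and fin: "(\<integral>\<^sup>+p\<in>D - D0. e2ennreal (v p) \<partial>\<nu>2) < \<infinity>"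
  shows "(\<integral>\<^sup>+p\<in>D - D0. e2ennreal (v p) \<partial>\<nu>1) < \<infinity>"
proof -
  obtain H \<eta> where H: "closed H" "H \<noteq> {}" "0 < \<eta>" "\<And>z. infdist z H \<le> 5 * \<eta> \<Longrightarrow> Some z \<in> D"
    "\<And>z. Some z \<in> D0 \<Longrightarrow> z \<in> H" "compact {z. \<eta> \<le> infdist z H \<and> infdist z H \<le> 5 * \<eta>}"
    "{z. 3 * \<eta> \<le> infdist z H} \<noteq> {}" "None \<in> D \<Longrightarrow> bounded (- H)"
    "closedin sphere_top (Some ` {z. infdist z H \<le> 3 * \<eta>} \<union> ({None} \<inter> D))"
    by (rule domain_collar[OF D D0 rc]) (rule that; assumption)
  define KK where "KK = Some ` {z. infdist z H \<le> 3 * \<eta>} \<union> ({None} \<inter> D)"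
  define G where "G = Some -` D"
  have oG: "open G" using D by (simp add: G_def openin_sphere_iff)
  obtain UU V where V: "D - D0 \<subseteq> UU" "subharmonic UU V" "\<And>p. p \<in> D - D0 \<Longrightarrow> v p = V p"
    and v0: "\<And>p. p \<in> D - D0 \<Longrightarrow> 0 \<le> v p"
    using v by (auto simp: sbh0_pos_def sbh_pos_def sbh_def)
  define vr where "vr z = real_of_ereal (v (Some z))" for z
  have vfin: "v p = ereal (real_of_ereal (v p))" if "p \<in> D - D0" for p
    using v0[OF that] subharmonic_less_top[OF V(2), of p] V(1,3) that
    by (cases "v p") auto
  define F where "F = {z \<in> G. 0 < infdist z H}"
  have oF: "open F"
  proof -
    have "open {z. 0 < infdist z H}" by (intro open_Collect_less continuous_intros)
    then show ?thesis using oG by (simp add: F_def Collect_conj_eq open_Int)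
  qed
  have FD: "Some z \<in> D - D0" if "z \<in> F" for z
    using that H(5)[of z] by (auto simp: F_def G_def)
  have vvr: "v (Some z) = ereal (vr z)" "0 \<le> vr z" "V (Some z) = ereal (vr z)" if "z \<in> F" for z
    using vfin[OF FD[OF that]] v0[OF FD[OF that]] V(3)[OF FD[OF that]] by (simp_all add: vr_def real_of_ereal_pos)
  have VP: "subharmonic_plane (Some -` UU) (V \<circ> Some)" using V(2) by (simp add: subharmonic_def)
  have usc: "\<exists>r>0. \<forall>y\<in>ball z r. vr y < a" if z: "z \<in> G" "0 < infdist z H" and a: "vr z < a" for z a
  proof -
    have zF: "z \<in> F" using z by (simp add: F_def)
    have "open {y \<in> Some -` UU. (V \<circ> Some) y < ereal a}" using VP by (simp add: subharmonic_plane_def)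
    then have "open ({y \<in> Some -` UU. (V \<circ> Some) y < ereal a} \<inter> F)" using oF by (rule open_Int)
    moreover have "z \<in> {y \<in> Some -` UU. (V \<circ> Some) y < ereal a} \<inter> F"
      using zF vvr[OF zF] a FD[OF zF] V(1) by auto
    ultimately obtain r where "r > 0" "ball z r \<subseteq> {y \<in> Some -` UU. (V \<circ> Some) y < ereal a} \<inter> F" by (rule openE)
    then show ?thesis using vvr(3) by (intro exI[of _ r]) (auto simp: subset_iff)
  qed
  have sub: "vr z \<le> (\<integral>x. h x \<partial>circ)"
    if s: "0 < s" "cball z s \<subseteq> {z \<in> G. 0 < infdist z H}" and h: "h \<in> borel_measurable borel"
      "\<And>x. 0 \<le> h x \<and> h x \<le> B" "\<And>x. cmod x = 1 \<Longrightarrow> vr (z + of_real s * x) \<le> h x" for z s h B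
  proof -
    have sF: "cball z s \<subseteq> F" using s by (simp add: F_def)
    have "(V \<circ> Some) z \<le> ereal (\<integral>x. h x \<partial>circ)"
    proof (rule subharmonic_plane_mean_le[OF VP s(1) _ h(1,2)])
      show "cball z s \<subseteq> Some -` UU" using sF FD V(1) by blast
      fix x :: complex assume x: "cmod x = 1"
      then have "z + of_real s * x \<in> F" using sF s(1) by (auto simp: subset_iff dist_norm norm_mult)
      then show "(V \<circ> Some) (z + of_real s * x) \<le> ereal (h x)" using vvr(3) h(3)[OF x] by simp
    qed
    moreover have "z \<in> F" using sF s(1) by auto
    ultimately show ?thesis using vvr(3)[of z] by simp
  qed
  have vanish: "\<exists>T. compact T \<and> T \<subseteq> G \<and> (\<forall>z\<in>G. 2 * \<eta> \<le> infdist z H \<longrightarrow> \<epsilon> \<le> vr z \<longrightarrow> z \<in> T)" if \<epsilon>: "0 < \<epsilon>" for \<epsilon>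
  proof -
    \<comment> \<open>\<open>Op\<close> is open, contains everything outside \<open>D\<close>, and
      \<open>v\<close> is small on its part in \<open>D\<close>. What remains of \<open>D\<close>
      away from \<open>H\<close> is therefore compact and contains every point there where
      \<open>v\<close> is at least \<epsilon>.\<close>
    define Op where "Op = \<Union>{W. openin sphere_top W \<and> (\<forall>q\<in>W \<inter> D. v q < ereal \<epsilon>)}"
    have oO: "openin sphere_top Op" unfolding Op_def by (rule openin_Union) auto
    have DO: "p \<in> Op" if "p \<notin> D" for p
      using sbh0_pos_small_near_complement[OF D(1) v that, of "ereal \<epsilon>"] \<epsilon> unfolding Op_def by auto
    have small: "v p < ereal \<epsilon>" if "p \<in> Op" "p \<in> D" for p
      using that unfolding Op_def by auto
    define T where "T = - (Some -` Op) \<inter> {z. 2 * \<eta> \<le> infdist z H}"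
    have "closed {z. 2 * \<eta> \<le> infdist z H}" by (intro closed_Collect_le continuous_intros)
    then have cT: "closed T" using oO unfolding T_def by (intro closed_Int closed_Compl) (auto simp: openin_sphere_iff)
    \<comment> \<open>If \<infinity> lies in \<open>D\<close>, then \<open>T\<close> avoids
      \<open>H\<close>, whose complement is bounded; otherwise \<infinity> itself belongs to the
      open set \<open>Op\<close>.\<close>
    have "bounded T"
    proof (cases "None \<in> D")
      case True
      have "z \<notin> H" if "z \<in> T" for z using that H(3) by (auto simp: T_def)
      then have "T \<subseteq> - H" by auto
      then show ?thesis using H(8)[OF True] bounded_subset by blast
    next
      case False
      then have "None \<in> Op" by (rule DO)
      then have "bounded (- (Some -` Op))" using oO by (simp add: openin_sphere_iff)
      then show ?thesis unfolding T_def by (rule bounded_subset) auto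
    qed
    then have "compact T" using cT by (simp add: compact_eq_bounded_closed)
    moreover have "T \<subseteq> G" using DO by (auto simp: T_def G_def)
    moreover have "z \<in> T" if "z \<in> G" "2 * \<eta> \<le> infdist z H" "\<epsilon> \<le> vr z" for z
    proof -
      have zF: "z \<in> F" using that H(3) by (auto simp: F_def)
      then have "Some z \<notin> Op" using small[of "Some z"] vvr(1)[OF zF] that FD[OF zF] by force
      then show ?thesis using that by (simp add: T_def)
    qed
    ultimately show ?thesis by blast
  qed
  have Ule': "AE z in lborel. z \<in> G \<longrightarrow> 0 < infdist z H \<longrightarrow> U1 z \<le> U2 z"
    using Ule
  proof eventually_elim
    case (elim z)
    then show ?case using FD[of z] by (auto simp: F_def)
  qed
  have HG: "z \<in> G" if "infdist z H \<le> 5 * \<eta>" for z using H(4)[OF that] by (simp add: G_def)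
  have vr0: "0 \<le> vr z" if "z \<in> G" "0 < infdist z H" for z using vvr(2)[of z] that by (simp add: F_def)
  have UG: "set_integrable lborel K U1" "set_integrable lborel K U2" if "compact K" "K \<subseteq> G" for K
    using U that by (simp_all add: G_def)
  have est: "\<exists>E\<ge>0. \<forall>\<epsilon>>0. \<exists>L w. cutoff_function F {z \<in> G. 3 * \<eta> \<le> infdist z H} vr \<epsilon> L w \<and>
     (\<forall>\<mu>1 \<mu>2. riesz_le L \<mu>1 U1 \<longrightarrow> riesz_ge L \<mu>2 U2 \<longrightarrow> (\<integral>z. w z \<partial>\<mu>1) \<le> (\<integral>z. w z \<partial>\<mu>2) + E)"
    (is "\<exists>E\<ge>0. \<forall>\<epsilon>>0. \<exists>L w. ?P E \<epsilon> L w")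
    unfolding F_def
  proof (rule planar_estimate[of G H \<eta> vr U1 U2])
    show "open G" "closed H" "H \<noteq> {}" "0 < \<eta>" "compact {z. \<eta> \<le> infdist z H \<and> infdist z H \<le> 5 * \<eta>}"
      "{z. 3 * \<eta> \<le> infdist z H} \<noteq> {}" by (fact oG H)+
    show "AE z in lborel. z \<in> G \<longrightarrow> 0 < infdist z H \<longrightarrow> U1 z \<le> U2 z" by (fact Ule')
  qed (fact HG vr0 usc sub vanish UG)+
  then obtain E where EP: "0 \<le> E \<and> (\<forall>\<epsilon>>0. \<exists>L w. ?P E \<epsilon> L w)" by (elim exE)
  note E = EP[THEN conjunct1] and est' = EP[THEN conjunct2]
  define A where "A = (\<integral>\<^sup>+p\<in>D - D0. e2ennreal (v p) \<partial>\<nu>2)"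
  define N where "N = {z \<in> G. 3 * \<eta> \<le> infdist z H}"
  have NF: "N \<subseteq> F" using H(3) by (auto simp: N_def F_def)
  note [measurable] = measurable_the[OF \<nu>1 D(1)] measurable_the[OF \<nu>2 D(1)]
  have KKD: "KK \<subseteq> D" using H(3,4) by (auto simp: KK_def)
  have KKc: "compactin sphere_top KK" unfolding KK_def by (rule closedin_sphere_imp_compactin[OF H(9)])
  have KKm[measurable]: "KK \<in> sets \<nu>1" unfolding KK_def by (rule radon_on_closed[OF \<nu>1 D(1) H(9)]) (use KKD in \<open>simp add: KK_def\<close>)
  have Nm[measurable]: "Some ` N \<in> sets \<nu>1"
  proof -
    have "Some -` (D - Some ` N) = G \<inter> {z. infdist z H < 3 * \<eta>}" by (auto simp: N_def G_def image_iff)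
    moreover have "open {z. infdist z H < 3 * \<eta>}" by (intro open_Collect_less continuous_intros)
    ultimately have *: "open (Some -` (D - Some ` N))" using oG by auto
    have 1: "Some ` (Some -` (D - Some ` N)) \<in> sets \<nu>1"
      by (rule radon_on_open[OF \<nu>1 openin_sphere_Some[OF *]]) auto
    have 2: "Some ` G \<in> sets \<nu>1"
      by (rule radon_on_open[OF \<nu>1 openin_sphere_Some[OF oG]]) (auto simp: G_def)
    have "Some ` N = Some ` G - Some ` (Some -` (D - Some ` N))" by (auto simp: N_def G_def image_iff)
    then show ?thesis using 1 2 by (metis sets.Diff)
  qed
  \<comment> \<open>The cutoff functions for different \<epsilon> are not compared on the collar. On
    \<open>N\<close>, however, they equal max 0 (v - \<epsilon>), which increases as \<epsilon> =
    1/(n + 1) decreases, so monotone convergence applies to \<open>g\<close>.\<close>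
  define g where "g n p = indicator (Some ` N) p * ennreal (max 0 (vr (the p) - 1 / real (Suc n)))" for n p
  have g: "g n \<in> borel_measurable \<nu>1" "(\<integral>\<^sup>+p. g n p \<partial>\<nu>1) \<le> A + ennreal E" for n
  proof -
    have "\<exists>L w. ?P E (1 / real (Suc n)) L w" by (rule est'[rule_format]) simp
    then obtain L w where P: "?P E (1 / real (Suc n)) L w" by (elim exE)
    then have "cutoff_function F {z \<in> G. 3 * \<eta> \<le> infdist z H} vr (1 / real (Suc n)) L w"
      and cmp: "\<And>\<mu>1 \<mu>2. riesz_le L \<mu>1 U1 \<Longrightarrow> riesz_ge L \<mu>2 U2 \<Longrightarrow> (\<integral>z. w z \<partial>\<mu>1) \<le> (\<integral>z. w z \<partial>\<mu>2) + E"
      by blast+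
    then obtain C where L: "compact L" "L \<subseteq> F" and w[measurable]: "w \<in> borel_measurable borel"
      and w0: "\<And>z. 0 \<le> w z" and C: "\<And>z. w z \<le> C" and wL: "\<And>z. z \<notin> L \<Longrightarrow> w z = 0"
      and wv: "\<And>z. z \<in> L \<Longrightarrow> w z \<le> vr z"
      and wN: "\<And>z. z \<in> G \<Longrightarrow> 3 * \<eta> \<le> infdist z H \<Longrightarrow> w z = max 0 (vr z - 1 / real (Suc n))"
      unfolding cutoff_function_def by blast
    have LD: "Some ` L \<subseteq> D" using L(2) by (auto simp: F_def G_def)
    note p1 = plane_part[OF \<nu>1 D(1) L(1) LD] and p2 = plane_part[OF \<nu>2 D(1) L(1) LD]
    note [measurable] = p1(5) p2(5)
    have sm: "smooth_compact_support (Some -` D) \<phi>" "\<phi> \<in> borel_measurable borel" "z \<notin> L \<Longrightarrow> \<phi> z = 0"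
      if s: "smooth_compact_support L \<phi>" for \<phi> z
    proof -
      have "L \<subseteq> Some -` D" using LD by auto
      then show "smooth_compact_support (Some -` D) \<phi>" using s unfolding smooth_compact_support_def by blast
      show "\<phi> \<in> borel_measurable borel" using smooth_compact_support_facts[OF s] by metis
      show "z \<notin> L \<Longrightarrow> \<phi> z = 0" using s unfolding smooth_compact_support_def by blast
    qed
    have "riesz_le L (plane_part \<nu>1 L) U1"
      unfolding riesz_le_def
    proof (intro conjI p1(1,2) allI impI)
      fix \<phi> :: "complex \<Rightarrow> real"
      assume s: "smooth_compact_support L \<phi>" "\<forall>z. 0 \<le> \<phi> z"
      show "2 * pi * (\<integral>z. \<phi> z \<partial>plane_part \<nu>1 L) \<le> (\<integral>z. U1 z * laplacian \<phi> z \<partial>lborel)"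
        using R1[OF sm(1)[OF s(1)]] s(2) p1(4)[OF sm(2)[OF s(1)] sm(3)[OF s(1)]] by simp
    qed
    moreover have "riesz_ge L (plane_part \<nu>2 L) U2"
      unfolding riesz_ge_def
    proof (intro conjI p2(1,2) allI impI)
      fix \<phi> :: "complex \<Rightarrow> real"
      assume s: "smooth_compact_support L \<phi>" "\<forall>z. 0 \<le> \<phi> z"
      show "(\<integral>z. U2 z * laplacian \<phi> z \<partial>lborel) \<le> 2 * pi * (\<integral>z. \<phi> z \<partial>plane_part \<nu>2 L)"
        using R2[OF sm(1)[OF s(1)]] s(2) p2(4)[OF sm(2)[OF s(1)] sm(3)[OF s(1)]] by simp
    qed
    ultimately have ineq: "(\<integral>z. w z \<partial>plane_part \<nu>1 L) \<le> (\<integral>z. w z \<partial>plane_part \<nu>2 L) + E"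
      by (rule cmp)
    have wi: "integrable (plane_part \<nu>1 L) w" "integrable (plane_part \<nu>2 L) w"
      using w0 C p1(2) p2(2)
      by (auto intro!: finite_measure.integrable_const_bound[OF p1(1), of _ C] finite_measure.integrable_const_bound[OF p2(1), of _ C] cong: measurable_cong_sets)
    have g_eq: "g n = (\<lambda>p. indicator (Some ` N) p * ennreal (w (the p)))"
      using wN by (auto simp: g_def fun_eq_iff indicator_def N_def)
    show "g n \<in> borel_measurable \<nu>1" unfolding g_eq by measurable
    have "(\<integral>\<^sup>+p. g n p \<partial>\<nu>1) \<le> (\<integral>\<^sup>+p. indicator (Some ` L) p * ennreal (w (the p)) \<partial>\<nu>1)"
      unfolding g_eq using wL by (intro nn_integral_mono) (auto simp: indicator_def image_iff)
    also have "\<dots> = (\<integral>\<^sup>+z. ennreal (w z) \<partial>plane_part \<nu>1 L)"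
      by (subst p1(3)) auto
    also have "\<dots> = ennreal (\<integral>z. w z \<partial>plane_part \<nu>1 L)"
      using wi w0 by (intro nn_integral_eq_integral) auto
    also have "\<dots> \<le> ennreal ((\<integral>z. w z \<partial>plane_part \<nu>2 L) + E)" using ineq by (rule ennreal_leI)
    also have "\<dots> = ennreal (\<integral>z. w z \<partial>plane_part \<nu>2 L) + ennreal E" using w0 E by (simp add: ennreal_plus)
    also have "ennreal (\<integral>z. w z \<partial>plane_part \<nu>2 L) = (\<integral>\<^sup>+z. ennreal (w z) \<partial>plane_part \<nu>2 L)"
      using wi w0 by (intro nn_integral_eq_integral[symmetric]) auto
    also have "\<dots> = (\<integral>\<^sup>+p. indicator (Some ` L) p * ennreal (w (the p)) \<partial>\<nu>2)"
      by (subst p2(3)) auto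
    also have "\<dots> \<le> A"
      unfolding A_def
    proof (rule nn_integral_mono)
      fix p assume "p \<in> space \<nu>2"
      show "indicator (Some ` L) p * ennreal (w (the p)) \<le> e2ennreal (v p) * indicator (D - D0) p"
      proof (cases "p \<in> Some ` L")
        case True
        then obtain z where z: "p = Some z" "z \<in> L" by auto
        then have zF: "z \<in> F" using L by auto
        show ?thesis using z wv[OF z(2)] vvr(1)[OF zF] FD[OF zF] by (simp add: ennreal_leI)
      qed simp
    qed
    finally show "(\<integral>\<^sup>+p. g n p \<partial>\<nu>1) \<le> A + ennreal E" by (simp add: add_right_mono)
  qed
  define gs where "gs p = indicator (Some ` N) p * ennreal (vr (the p))" for p
  have gs_eq: "gs p = (SUP n. g n p)" for p
  proof (cases "p \<in> Some ` N")
    case True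
    then obtain z where z: "p = Some z" "z \<in> N" by auto
    then show ?thesis using SUP_max_minus_inverse[of "vr z"] vvr(2)[of z] NF by (auto simp: gs_def g_def)
  qed (simp add: gs_def g_def)
  have "incseq g"
    by (rule incseq_SucI, rule le_funI, unfold g_def,
        intro mult_left_mono ennreal_leI max.mono order_refl diff_left_mono) (simp_all add: frac_le)
  then have "(\<integral>\<^sup>+p. gs p \<partial>\<nu>1) = (SUP n. (\<integral>\<^sup>+p. g n p \<partial>\<nu>1))"
    unfolding gs_eq by (rule nn_integral_monotone_convergence_SUP) (rule g)
  also have "\<dots> \<le> A + ennreal E" by (intro SUP_least g)
  also have "\<dots> < \<infinity>" using fin by (simp add: A_def)
  finally have gsfin: "(\<integral>\<^sup>+p. gs p \<partial>\<nu>1) < \<infinity>" .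
  have gsm: "gs \<in> borel_measurable \<nu>1"
    unfolding gs_eq[abs_def] using g(1) by measurable
  \<comment> \<open>The remaining part of \<open>D - D0\<close>, including \<infinity> if it lies in
    \<open>D\<close>, is compact inside the open set where the subharmonic extension of
    \<open>v\<close> lives. There \<open>v\<close> is bounded, and the measure of \<open>KK\<close>
    is finite.\<close>
  have "closedin sphere_top (KK - D0)" unfolding KK_def using H(9) D0(1) by (rule closedin_diff)
  then have "compactin sphere_top (KK - D0)" by (rule closedin_sphere_imp_compactin)
  moreover have "KK - D0 \<subseteq> UU" using KKD V(1) by auto
  ultimately obtain C where C: "\<And>p. p \<in> KK - D0 \<Longrightarrow> V p \<le> ereal C" "0 \<le> C"
    using subharmonic_bounded_on_compact[OF V(2)] by metis
  have "(\<integral>\<^sup>+p\<in>D - D0. e2ennreal (v p) \<partial>\<nu>1) \<le> (\<integral>\<^sup>+p. gs p + ennreal C * indicator KK p \<partial>\<nu>1)"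
  proof (rule nn_integral_mono)
    fix p assume "p \<in> space \<nu>1"
    show "e2ennreal (v p) * indicator (D - D0) p \<le> gs p + ennreal C * indicator KK p"
    proof (cases "p \<in> D - D0")
      case pD: True
      show ?thesis
      proof (cases "p \<in> KK")
        case True
        then have "v p \<le> ereal C" using C(1)[of p] V(3)[OF pD] pD by simp
        then have "e2ennreal (v p) \<le> ennreal C" by (metis e2ennreal_ereal e2ennreal_mono)
        then show ?thesis using True pD by (simp add: add_increasing)
      next
        case False
        obtain z where z: "p = Some z" using False pD by (cases p) (auto simp: KK_def)
        then have zN: "z \<in> N" using False pD by (auto simp: KK_def N_def G_def not_le)
        then have "v p = ereal (vr z)" using vvr(1)[of z] NF z by auto
        then show ?thesis using zN z pD by (simp add: gs_def)
      qed
    qed simp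
  qed
  also have "\<dots> = (\<integral>\<^sup>+p. gs p \<partial>\<nu>1) + ennreal C * emeasure \<nu>1 KK"
    using gsm by (subst nn_integral_add) (auto simp: nn_integral_cmult_indicator)
  also have "\<dots> < \<infinity>"
  proof -
    have "emeasure \<nu>1 KK < \<infinity>" using \<nu>1 KKc KKD by (simp add: radon_on_def)
    then show ?thesis using gsfin by (simp add: ennreal_mult_less_top)
  qed
  finally show ?thesis .
qed

section \<open>Null sets and local integrability\<close>

lemma subharmonic_plane_bounded_on_compact:
  assumes u: "subharmonic_plane W u" and K: "compact K" "K \<subseteq> W"
  obtains C where "\<And>z. z \<in> K \<Longrightarrow> u z \<le> ereal C" "0 \<le> C"
proof -
  let ?W = "\<lambda>n. {p \<in> W. u p < ereal (real n)}"
  have "K \<subseteq> (\<Union>n\<in>UNIV. ?W n)"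
  proof
    fix p assume "p \<in> K"
    then have p: "p \<in> W" "u p < \<infinity>" using K u by (auto simp: subharmonic_plane_def)
    then have "\<exists>n. u p < ereal (real n)" using less_PInf_Ex_of_nat[of "u p"] by auto
    with p show "p \<in> (\<Union>n\<in>UNIV. ?W n)" by auto
  qed
  moreover have "open (?W n)" for n using u by (simp add: subharmonic_plane_def)
  ultimately obtain N where N: "finite N" "K \<subseteq> (\<Union>n\<in>N. ?W n)"
    using compactE_image[OF K(1), of UNIV ?W] by auto
  have "u p \<le> ereal (real (\<Sum>N))" if "p \<in> K" for p
  proof -
    have "p \<in> (\<Union>n\<in>N. ?W n)" using N(2) that by blast
    then obtain n where n: "n \<in> N" "u p < ereal (real n)" by blast
    then have "n \<le> \<Sum>N" using N(1) member_le_sum[of n N "\<lambda>x. x"] by auto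
    then have "ereal (real n) \<le> ereal (real (\<Sum>N))" by (simp del: of_nat_sum)
    then show ?thesis using n(2) by (meson less_imp_le order_trans)
  qed
  then show ?thesis using that[of "real (\<Sum>N)"] by (simp del: of_nat_sum)
qed

text \<open>Polar coordinates in disguise: the area of \<open>E\<close> does not change under
  rotation about \<open>a\<close>, so it equals its average over all rotations. By Fubini this
  average integrates the circle measures, all of which are 0.\<close>

lemma null_set_by_circles:
  assumes E[measurable]: "E \<in> sets borel" and a: "a \<notin> E"
    and c: "\<And>s. 0 < s \<Longrightarrow> AE x in circ. a + of_real s * x \<notin> E"
  shows "emeasure lborel E = 0"
proof -
  have c': "AE x in circ. a + x * y \<notin> E" for y
  proof (cases "y = 0")
    case False
    define e where "e = y / of_real (cmod y)"
    have e: "cmod e = 1" using False by (simp add: e_def norm_divide)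
    have "AE x in distr circ borel ((*) e). a + of_real (cmod y) * x \<notin> E"
      unfolding circ_distr_rotate[OF e] using c[of "cmod y"] False by simp
    moreover have "{x \<in> space borel. a + of_real (cmod y) * x \<notin> E} \<in> sets borel" by measurable
    ultimately have "AE x in circ. a + of_real (cmod y) * (e * x) \<notin> E"
      by (subst (asm) AE_distr_iff) auto
    moreover have "of_real (cmod y) * (e * x) = x * y" for x using False by (simp add: e_def)
    ultimately show ?thesis by simp
  qed (use a in simp)
  have rot: "(\<integral>\<^sup>+y. indicator E (a + x * y) \<partial>lborel) = emeasure lborel E" if "cmod x = 1" for x
  proof -
    have "emeasure lborel E = (\<integral>\<^sup>+y. indicator E y \<partial>distr lborel borel ((+) a))"
      by (simp add: lborel_distr_plus)
    also have "\<dots> = (\<integral>\<^sup>+y. indicator E (a + y) \<partial>lborel)" by (subst nn_integral_distr) auto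
    also have "\<dots> = (\<integral>\<^sup>+y. indicator E (a + y) \<partial>distr lborel borel ((*) x))"
      by (simp add: lborel_distr_rotate[OF that])
    also have "\<dots> = (\<integral>\<^sup>+y. indicator E (a + x * y) \<partial>lborel)" by (subst nn_integral_distr) auto
    finally show ?thesis by simp
  qed
  have "emeasure lborel E = (\<integral>\<^sup>+x. emeasure lborel E \<partial>circ)" by simp
  also have "\<dots> = (\<integral>\<^sup>+x. (\<integral>\<^sup>+y. indicator E (a + x * y) \<partial>lborel) \<partial>circ)"
    using AE_circ by (intro nn_integral_cong_AE, eventually_elim) (simp add: rot)
  also have "\<dots> = (\<integral>\<^sup>+y. (\<integral>\<^sup>+x. indicator E (a + x * y) \<partial>circ) \<partial>lborel)"
    by (rule circ_lborel.Fubini'[symmetric]) measurable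
  also have "\<dots> = (\<integral>\<^sup>+y. 0 \<partial>(lborel :: complex measure))"
  proof (rule nn_integral_cong)
    fix y
    show "(\<integral>\<^sup>+x. indicator E (a + x * y) \<partial>circ) = 0"
      using c'[of y] by (subst nn_integral_0_iff_AE) (auto elim: eventually_mono)
  qed
  finally show ?thesis by simp
qed

text \<open>A finite value at the centre bounds every circle mean from below, so the negative part
  is integrable on each circle and -\<infinity> is taken only on a null set of it.\<close>

lemma subharmonic_plane_null_minus_infinity:
  assumes u: "subharmonic_plane W u" and B: "ball a r \<subseteq> W" "u a \<noteq> -\<infinity>"
  shows "negligible {z \<in> ball a r. u z = -\<infinity>}"
proof -
  \<comment> \<open>\<open>u\<close> is arbitrary outside \<open>W\<close>; the extension by 0 is
    Borel on the whole plane and agrees with \<open>u\<close> where it matters.\<close>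
  define f where "f y = (if y \<in> W then u y else 0)" for y
  have W: "open W" using u by (simp add: subharmonic_plane_def)
  have fm[measurable]: "f \<in> borel_measurable borel"
  proof (rule borel_measurableI_less)
    fix c
    have "{x \<in> space borel. f x < c} = {z \<in> W. u z < c} \<union> (if 0 < c then - W else {})"
      by (auto simp: f_def)
    moreover have "{z \<in> W. u z < c} \<in> sets borel" using u by (auto simp: subharmonic_plane_def)
    moreover have "- W \<in> sets borel" using W by auto
    ultimately show "{x \<in> space borel. f x < c} \<in> sets borel" by simp
  qed
  define E where "E = {z \<in> ball a r. f z = -\<infinity>}"
  have Em: "E \<in> sets borel" unfolding E_def by measurable
  have "emeasure lborel E = 0"
  proof (rule null_set_by_circles[OF Em, of a])
    show "a \<notin> E" using B by (auto simp: E_def f_def subset_iff)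
    fix s :: real assume s: "0 < s"
    show "AE x in circ. a + of_real s * x \<notin> E"
    proof (cases "s < r")
      case False
      show ?thesis using AE_circ
        by eventually_elim (use False s in \<open>auto simp: E_def dist_norm norm_mult\<close>)
    next
      case True
      then have sW: "cball a s \<subseteq> W" using B(1) by (auto simp: subset_iff)
      obtain C where C: "\<And>z. z \<in> cball a s \<Longrightarrow> u z \<le> ereal C" "0 \<le> C"
        using subharmonic_plane_bounded_on_compact[OF u compact_cball sW] by metis
      have inc: "a + of_real s * cis t \<in> cball a s" for t using s by (simp add: dist_norm norm_mult)
      then have fu: "f (a + of_real s * cis t) = u (a + of_real s * cis t)" for t
        using sW by (auto simp: f_def subset_iff)
      define X where "X = (\<integral>\<^sup>+t\<in>{0..2*pi}. e2ennreal (u (a + of_real s * cis t)) \<partial>lborel)"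
      define Y where "Y = (\<integral>\<^sup>+t\<in>{0..2*pi}. e2ennreal (- u (a + of_real s * cis t)) \<partial>lborel)"
      have "X \<le> (\<integral>\<^sup>+t\<in>{0..2*pi}. ennreal C \<partial>lborel)"
        unfolding X_def using C(1)[OF inc]
        by (intro nn_integral_mono mult_right_mono) (auto simp flip: e2ennreal_ereal intro!: e2ennreal_mono)
      also have "\<dots> < \<infinity>" by (simp add: nn_integral_cmult_indicator ennreal_mult_less_top)
      finally have X: "X < \<infinity>" .
      have "circle_mean u a s \<noteq> -\<infinity>"
        using u s sW B(2) unfolding subharmonic_plane_def by (metis ereal_infty_less_eq(2))
      then have "Y \<noteq> \<infinity>"
        using X unfolding circle_mean_def X_def[symmetric] Y_def[symmetric]
        by (cases X) (auto simp: enn2ereal_ennreal)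
      moreover have "Y = ennreal (2 * pi) * (\<integral>\<^sup>+x. e2ennreal (- f (a + of_real s * x)) \<partial>circ)"
        unfolding Y_def fu[symmetric]
        by (subst nn_integral_circ) (auto simp: mult.assoc[symmetric] ennreal_mult[symmetric])
      ultimately have "(\<integral>\<^sup>+x. e2ennreal (- f (a + of_real s * x)) \<partial>circ) \<noteq> \<infinity>"
        by (auto simp: ennreal_mult_eq_top_iff)
      then have "AE x in circ. e2ennreal (- f (a + of_real s * x)) \<noteq> \<infinity>"
        by (rule nn_integral_noteq_infinite[rotated]) measurable
      then show ?thesis by eventually_elim (auto simp: E_def)
    qed
  qed
  then have "E \<in> null_sets lborel" using Em by auto
  then have "negligible E"
    by (simp add: negligible_iff_null_sets null_sets_completionI)
  moreover have "{z \<in> ball a r. u z = -\<infinity>} = E" using B(1) by (auto simp: E_def f_def)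
  ultimately show ?thesis by simp
qed

section \<open>Null sets on a connected domain of the sphere\<close>

lemma inversion_differentiable:
  assumes "x \<noteq> 0"
  shows "(\<lambda>w. 1 / cnj w) differentiable (at x)"
proof -
  have "((\<lambda>w::complex. 1 / w) has_derivative (\<lambda>h. - h / x\<^sup>2)) (at x)"
    using assms by (auto intro!: derivative_eq_intros simp: power2_eq_square field_simps)
  then have "((\<lambda>w. cnj (1 / w)) has_derivative (\<lambda>h. cnj (- h / x\<^sup>2))) (at x)"
    by (rule bounded_linear.has_derivative[OF bounded_linear_cnj])
  then show ?thesis by (auto simp: differentiable_def)
qed

lemma inv_chart_image_ball:
  assumes "r > 0"
  shows "openin sphere_top (inv_chart ` ball 0 r)" "Some -` (inv_chart ` ball 0 r) = (\<lambda>w. 1 / cnj w) ` (ball 0 r - {0})"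
    "None \<in> inv_chart ` ball 0 r"
proof -
  have "inj inv_chart" by (rule injI) (auto simp: inv_chart_def split: if_splits)
  then have inv: "inv_chart -` (inv_chart ` ball 0 r) = ball 0 r" by (rule inj_vimage_image_eq)
  show S: "Some -` (inv_chart ` ball 0 r) = (\<lambda>w. 1 / cnj w) ` (ball 0 r - {0})"
    by (auto simp: inv_chart_def image_iff split: if_splits)
  also have "\<dots> = {z. 1 / r < cmod z}"
  proof (intro equalityI subsetI)
    fix z assume "z \<in> (\<lambda>w. 1 / cnj w) ` (ball 0 r - {0})"
    then obtain w where w': "w \<in> ball 0 r - {0}" "z = 1 / cnj w" by blast
    then have "0 < cmod w" "cmod w < r" by auto
    note w = w'(2) this
    have "1 / r < 1 / cmod w" using w(2,3) by (simp add: frac_less2)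
    then show "z \<in> {z. 1 / r < cmod z}" using w(1) by (simp add: norm_divide)
  next
    fix z assume z: "z \<in> {z. 1 / r < cmod z}"
    then have z0: "0 < cmod z" using assms by (auto intro: less_trans[of _ "1 / r"])
    have "1 / cmod z < r" using z z0 assms by (simp add: field_simps)
    then show "z \<in> (\<lambda>w. 1 / cnj w) ` (ball 0 r - {0})"
      using z0 by (intro image_eqI[of _ _ "1 / cnj z"]) (auto simp: norm_divide)
  qed
  finally have "open (Some -` (inv_chart ` ball 0 r))" by (auto intro!: open_Collect_less continuous_intros)
  then show "openin sphere_top (inv_chart ` ball 0 r)" by (intro openin_sphere_charts) (auto simp: inv)
  show "None \<in> inv_chart ` ball 0 r" using assms by (intro image_eqI[of _ _ 0]) (auto simp: inv_chart_def)
qed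

text \<open>\<open>Q\<close> is the degenerate behaviour (identically \<open>-\<infinity>\<close>, identically 0) and \<open>P\<close> the generic
  one; every point has a neighbourhood of one kind, and the two kinds do not meet.\<close>

lemma connected_domain_dichotomy:
  assumes D: "sphere_domain D" and p0: "p0 \<in> D" "\<not> Q p0"
    and loc: "\<And>p. p \<in> D \<Longrightarrow> \<exists>W. openin sphere_top W \<and> p \<in> W \<and> W \<subseteq> D \<and> (P W \<or> (\<forall>q\<in>W. Q q))"
    and excl: "\<And>W W'. openin sphere_top W \<Longrightarrow> openin sphere_top W' \<Longrightarrow> P W \<Longrightarrow> (\<forall>q\<in>W'. Q q) \<Longrightarrow> Some -` (W \<inter> W') \<noteq> {} \<Longrightarrow> False"
    and p: "p \<in> D"
  shows "\<exists>W. openin sphere_top W \<and> p \<in> W \<and> W \<subseteq> D \<and> P W"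
proof -
  define A where "A = \<Union>{W. openin sphere_top W \<and> W \<subseteq> D \<and> P W}"
  define B where "B = \<Union>{W. openin sphere_top W \<and> W \<subseteq> D \<and> (\<forall>q\<in>W. Q q)}"
  have oA: "openin sphere_top A" unfolding A_def by (rule openin_Union) auto
  have oB: "openin sphere_top B" unfolding B_def by (rule openin_Union) auto
  have DAB: "D \<subseteq> A \<union> B"
  proof
    fix q assume "q \<in> D"
    from loc[OF this] obtain W where W: "openin sphere_top W" "q \<in> W" "W \<subseteq> D" "P W \<or> (\<forall>q\<in>W. Q q)" by blast
    then show "q \<in> A \<union> B" unfolding A_def B_def by blast
  qed
  have AB: "A \<inter> B = {}"
  proof (rule ccontr)
    assume "A \<inter> B \<noteq> {}"
    then obtain q W W' where W: "openin sphere_top W" "P W" "q \<in> W" and W': "openin sphere_top W'" "\<forall>q\<in>W'. Q q" "q \<in> W'"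
      unfolding A_def B_def by blast
    have o: "openin sphere_top (W \<inter> W')" using W W' by (intro openin_Int)
    \<comment> \<open>\<open>excl\<close> wants a common finite point; if the common point found is
      \<infinity>, every neighbourhood of it contains finite points.\<close>
    have "Some -` (W \<inter> W') \<noteq> {}"
    proof (cases q)
      case None
      then have b: "bounded (- Some -` (W \<inter> W'))" using o W(3) W'(3) unfolding openin_sphere_iff by blast
      show ?thesis
      proof
        assume e: "Some -` (W \<inter> W') = {}"
        have "bounded (UNIV :: complex set)" using b unfolding e by simp
        then show False by simp
      qed
    next
      case (Some z)
      then have "z \<in> Some -` (W \<inter> W')" using W W' by simp
      then show ?thesis by blast
    qed
    then show False using excl[OF W(1) W'(1) W(2) W'(2)] by blast
  qed
  have "p0 \<in> A" using DAB p0 unfolding B_def by blast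
  have "\<not> (A \<inter> D \<noteq> {} \<and> B \<inter> D \<noteq> {})"
  proof
    assume ne: "A \<inter> D \<noteq> {} \<and> B \<inter> D \<noteq> {}"
    have "connectedin sphere_top D" using D by (simp add: sphere_domain_def)
    then have "\<not> (\<exists>E1 E2. openin sphere_top E1 \<and> openin sphere_top E2 \<and> D \<subseteq> E1 \<union> E2 \<and> E1 \<inter> E2 \<inter> D = {} \<and> E1 \<inter> D \<noteq> {} \<and> E2 \<inter> D \<noteq> {})"
      by (simp add: connectedin)
    moreover have "A \<inter> B \<inter> D = {}" using AB by blast
    ultimately show False using oA oB DAB ne by blast
  qed
  moreover have "A \<inter> D \<noteq> {}" using \<open>p0 \<in> A\<close> p0 by blast
  ultimately have "B \<inter> D = {}" by blast
  then have "p \<in> A" using DAB p by blast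
  then show ?thesis unfolding A_def by blast
qed

text \<open>\<open>connected_domain_dichotomy\<close> spreads one value different from -\<infinity>
  over the whole domain: near each point either \<open>u\<close> is -\<infinity> identically or only
  on a null set, and a nonempty open set is not null. Local nullity then gives nullity.\<close>

lemma subharmonic_null_minus_infinity:
  assumes D: "sphere_domain D" and u: "subharmonic D u" and p0: "p0 \<in> D" "u p0 \<noteq> -\<infinity>"
  shows "negligible {z. Some z \<in> D \<and> u (Some z) = -\<infinity>}"
proof -
  define P where "P W = negligible {z. Some z \<in> W \<and> u (Some z) = -\<infinity>}" for W
  have oD: "openin sphere_top D" using D by (simp add: sphere_domain_def)
  have u1: "subharmonic_plane (Some -` D) (u \<circ> Some)" and u2: "subharmonic_plane (inv_chart -` D) (u \<circ> inv_chart)"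
    using u by (auto simp: subharmonic_def)
  \<comment> \<open>The point \<open>a\<close> with a value other than -\<infinity> need not be the
    centre \<open>b\<close>. These radii allow recentring at \<open>a\<close> with a disc that still
    covers a fixed disc about \<open>b\<close> and stays in the chart.\<close>
  have third: "ball b (r / 3) \<subseteq> ball a (2 * r / 3) \<and> ball a (2 * r / 3) \<subseteq> ball b r" if "a \<in> ball b (r / 3)" for a b :: complex and r
  proof (intro conjI subsetI)
    fix y assume "y \<in> ball b (r / 3)"
    then show "y \<in> ball a (2 * r / 3)" using that dist_triangle[of a y b] by (simp add: dist_commute)
  next
    fix y assume "y \<in> ball a (2 * r / 3)"
    then show "y \<in> ball b r" using that dist_triangle[of b y a] by (simp add: dist_commute)
  qed
  have ballnull: "negligible {y \<in> ball b (r / 3). f y = -\<infinity>}"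
    if f: "subharmonic_plane W f" "ball b r \<subseteq> W" and a: "a \<in> ball b (r / 3)" "f a \<noteq> -\<infinity>" for W f b r a
  proof -
    have "negligible {y \<in> ball a (2 * r / 3). f y = -\<infinity>}"
      by (rule subharmonic_plane_null_minus_infinity[OF f(1) _ a(2)]) (use third[OF a(1)] f(2) in blast)
    then show ?thesis by (rule negligible_subset) (use third[OF a(1)] in blast)
  qed
  have loc: "\<exists>W. openin sphere_top W \<and> p \<in> W \<and> W \<subseteq> D \<and> (P W \<or> (\<forall>q\<in>W. u q = -\<infinity>))" if p: "p \<in> D" for p
  proof (cases p)
    case (Some z)
    have "open (Some -` D)" using oD by (simp add: openin_sphere_iff)
    moreover have "z \<in> Some -` D" using p Some by simp
    ultimately obtain r where r: "r > 0" "ball z r \<subseteq> Some -` D" by (rule openE)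
    let ?W = "Some ` ball z (r / 3)"
    have W: "openin sphere_top ?W" "p \<in> ?W" "?W \<subseteq> D"
      using r Some by (auto intro!: openin_sphere_Some simp: subset_iff)
    show ?thesis
    proof (cases "\<exists>a\<in>ball z (r / 3). u (Some a) \<noteq> -\<infinity>")
      case True
      then obtain a where "a \<in> ball z (r / 3)" "(u \<circ> Some) a \<noteq> -\<infinity>" by auto
      from ballnull[OF u1 r(2) this] have "P ?W"
        unfolding P_def by (rule negligible_subset) auto
      then show ?thesis using W by blast
    next
      case False
      then have "\<forall>q\<in>?W. u q = -\<infinity>" by auto
      then show ?thesis using W by blast
    qed
  next
    case None
    have "0 \<in> inv_chart -` D" using p None by (simp add: inv_chart_def)
    then obtain r where r: "r > 0" "ball 0 r \<subseteq> inv_chart -` D" by (rule openE[OF open_inv_chart_vimage[OF oD]])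
    let ?W = "inv_chart ` ball 0 (r / 3)"
    have r3: "r / 3 > 0" using r by simp
    have W: "openin sphere_top ?W" "p \<in> ?W" "?W \<subseteq> D"
      using r None inv_chart_image_ball[OF r3] by (auto simp: subset_iff)
    show ?thesis
    proof (cases "\<exists>a\<in>ball 0 (r / 3). u (inv_chart a) \<noteq> -\<infinity>")
      case True
      then obtain a where "a \<in> ball 0 (r / 3)" "(u \<circ> inv_chart) a \<noteq> -\<infinity>" by auto
      from ballnull[OF u2 r(2) this] have N: "negligible ({y \<in> ball 0 (r / 3). (u \<circ> inv_chart) y = -\<infinity>} - {0})"
        by (rule negligible_subset) auto
      \<comment> \<open>Nullity is known in the inverted chart and wanted in the plane; the
        inversion is differentiable off 0, and the excluded 0 stands for \<infinity>, which has no
        place in the plane.\<close>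
      have "negligible ((\<lambda>w. 1 / cnj w) ` ({y \<in> ball 0 (r / 3). (u \<circ> inv_chart) y = -\<infinity>} - {0}))"
        by (rule negligible_differentiable_image_negligible[OF _ N])
          (auto simp: differentiable_on_def intro!: differentiable_at_withinI inversion_differentiable)
      then have "P ?W"
        unfolding P_def
      proof (rule negligible_subset)
        show "{z. Some z \<in> ?W \<and> u (Some z) = -\<infinity>} \<subseteq> (\<lambda>w. 1 / cnj w) ` ({y \<in> ball 0 (r / 3). (u \<circ> inv_chart) y = -\<infinity>} - {0})"
          by (auto simp: inv_chart_def image_iff split: if_splits)
      qed
      then show ?thesis using W by blast
    next
      case False
      then have "\<forall>q\<in>?W. u q = -\<infinity>" by auto
      then show ?thesis using W by blast
    qed
  qed
  have excl: False if "openin sphere_top W" "openin sphere_top W'" "P W" "\<forall>q\<in>W'. u q = -\<infinity>" "Some -` (W \<inter> W') \<noteq> {}" for W W'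
  proof -
    have "open (Some -` (W \<inter> W'))" using openin_Int[OF that(1,2)] by (simp add: openin_sphere_iff)
    moreover have "negligible (Some -` (W \<inter> W'))"
      using that(3) unfolding P_def by (rule negligible_subset) (use that(4) in auto)
    ultimately show False using that(5) open_not_negligible by blast
  qed
  show ?thesis
  proof (rule iffD2[OF locally_negligible_alt], rule ballI)
    fix z assume z: "z \<in> {z. Some z \<in> D \<and> u (Some z) = -\<infinity>}"
    then have "Some z \<in> D" by simp
    have "\<exists>W. openin sphere_top W \<and> Some z \<in> W \<and> W \<subseteq> D \<and> P W"
    proof (rule connected_domain_dichotomy[of D p0 "\<lambda>q. u q = -\<infinity>" P "Some z"])
      show "sphere_domain D" "p0 \<in> D" "u p0 \<noteq> -\<infinity>" "Some z \<in> D" by fact+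
    qed (fact loc, fact excl)
    then obtain W where W: "openin sphere_top W" "Some z \<in> W" "P W" by (elim exE conjE)
    let ?Z = "{z. Some z \<in> D \<and> u (Some z) = -\<infinity>}"
    have "openin (top_of_set ?Z) (?Z \<inter> Some -` W)"
      using W(1) by (intro openin_open_Int) (simp add: openin_sphere_iff)
    moreover have "negligible (?Z \<inter> Some -` W)"
      using W(3) unfolding P_def by (rule negligible_subset) auto
    ultimately show "\<exists>U. openin (top_of_set ?Z) U \<and> z \<in> U \<and> negligible U" using z W(2) by blast
  qed
qed

text \<open>At the centre of the bump the gradient of the inner polynomial \<tau> vanishes, so only
  its second derivatives contribute and the Laplacian is -4 times \<open>flat_exp 2\<close> at
  \<delta>^2.\<close>

lemma ex_test_function_laplacian_nonzero:
  assumes "0 < r"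
  obtains \<phi> where "smooth_compact_support (ball a r) \<phi>" "laplacian \<phi> a \<noteq> 0"
proof -
  define \<delta> where "\<delta> = r / 2"
  define \<tau> where "\<tau> z = \<delta>\<^sup>2 + (-1) * (Re z * Re z + Im z * Im z)" for z
  define f where "f z = flat_exp 0 (\<tau> z)" for z
  have C: "C_k n f" for n
    unfolding f_def \<tau>_def by (intro C_k_flat_exp C_k_add C_k_mult C_k_const C_k_Re C_k_Im)
  have Re': "(Re has_derivative Re) F" and Im': "(Im has_derivative Im) F" for F
    using bounded_linear_Re bounded_linear_Im bounded_linear_imp_has_derivative by blast+
  have T: "(\<tau> has_derivative (\<lambda>h. - (2 * (Re z * Re h + Im z * Im h)))) (at z)" for z
    unfolding \<tau>_def[abs_def] by (auto intro!: derivative_eq_intros Re' Im')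
  have p1: "pderiv_dir d f = (\<lambda>z. - (2 * (Re z * Re d + Im z * Im d)) * flat_exp 2 (\<tau> z))" for d
  proof
    fix z
    have "(f has_derivative (\<lambda>h. - (2 * (Re z * Re h + Im z * Im h)) * (flat_exp (0 + 2) (\<tau> z) - real 0 * flat_exp (Suc 0) (\<tau> z)))) (at z)"
      unfolding f_def[abs_def] by (rule DERIV_compose_FDERIV[OF flat_exp_has_derivative T])
    then show "pderiv_dir d f z = - (2 * (Re z * Re d + Im z * Im d)) * flat_exp 2 (\<tau> z)"
      by (subst pderiv_dir_eqI) (assumption, simp add: numeral_2_eq_2)
  qed
  have p2: "pderiv_dir d (pderiv_dir d f) 0 = - (2 * (Re d * Re d + Im d * Im d)) * flat_exp 2 (\<delta>\<^sup>2)" for d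
  proof -
    have G: "((\<lambda>z. flat_exp 2 (\<tau> z)) has_derivative (\<lambda>h. 0)) (at 0)"
      using DERIV_compose_FDERIV[OF flat_exp_has_derivative[of 2] T[of 0]] by simp
    have L: "((\<lambda>z. - (2 * (Re z * Re d + Im z * Im d))) has_derivative (\<lambda>h. - (2 * (Re h * Re d + Im h * Im d)))) (at 0)"
      by (auto intro!: derivative_eq_intros Re' Im')
    have "((\<lambda>z. - (2 * (Re z * Re d + Im z * Im d)) * flat_exp 2 (\<tau> z)) has_derivative
        (\<lambda>h. - (2 * (Re h * Re d + Im h * Im d)) * flat_exp 2 (\<delta>\<^sup>2))) (at 0)"
      using has_derivative_mult[OF L G] by (simp add: \<tau>_def)
    then show ?thesis unfolding p1 by (rule pderiv_dir_eqI)
  qed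
  have l0: "laplacian f 0 \<noteq> 0"
    using assms by (simp add: laplacian_def p2 flat_exp_def \<delta>_def)
  define \<phi> where "\<phi> z = f (- a + of_real 1 * z)" for z
  have "laplacian \<phi> a \<noteq> 0" unfolding \<phi>_def[abs_def] by (subst laplacian_affine[OF C]) (use l0 in simp)
  moreover have "smooth_compact_support (ball a r) \<phi>"
    unfolding smooth_compact_support_def
  proof (intro conjI allI exI[of _ "cball a \<delta>"] impI)
    show "C_k n \<phi>" for n unfolding \<phi>_def by (intro C_k_affine C)
    show "cball a \<delta> \<subseteq> ball a r" using assms by (auto simp: \<delta>_def)
    show "\<phi> z = 0" if "z \<notin> cball a \<delta>" for z
    proof -
      have "\<delta> < cmod (z - a)" using that by (simp add: dist_norm norm_minus_commute)
      then have "\<delta>\<^sup>2 \<le> (cmod (z - a))\<^sup>2" using assms by (intro power_mono) (auto simp: \<delta>_def)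
      then show ?thesis by (simp add: \<phi>_def f_def \<tau>_def flat_exp_def cmod_power2) (simp add: power2_eq_square)
    qed
  qed auto
  ultimately show ?thesis using that by blast
qed

lemma set_integrable_compact_if_locally:
  fixes f :: "complex \<Rightarrow> real"
  assumes "compact K" and loc: "\<And>a. a \<in> K \<Longrightarrow> \<exists>r>0. set_integrable lborel (ball a r) f"
  shows "set_integrable lborel K f"
proof -
  obtain r where r: "\<And>a. a \<in> K \<Longrightarrow> 0 < r a \<and> set_integrable lborel (ball a (r a)) f"
    using loc by metis
  have "K \<subseteq> (\<Union>a\<in>K. ball a (r a))" using r by force
  then obtain A where A: "A \<subseteq> K" "finite A" "K \<subseteq> (\<Union>a\<in>A. ball a (r a))"
    using compactE_image[OF assms(1), of K "\<lambda>a. ball a (r a)"] by auto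
  have "set_integrable lborel (\<Union>a\<in>A. ball a (r a)) f"
    by (rule set_integrable_UN) (use A r in auto)
  then show ?thesis by (rule set_integrable_subset) (use A assms(1) in \<open>auto intro: borel_compact\<close>)
qed

text \<open>\<open>has_bochner_integral\<close> in the Riesz equation says that u * \<Delta>\<phi>
  is integrable for every test function. Near each point some \<Delta>\<phi> is bounded away from 0,
  and dividing by it gives local integrability of \<open>u\<close>.\<close>

lemma riesz_set_integrable:
  assumes R: "riesz_in_chart Some D u \<nu>" and K: "compact K" "K \<subseteq> Some -` D" and D: "open (Some -` D)"
  shows "set_integrable lborel K (\<lambda>z. real_of_ereal (u (Some z)))"
proof (rule set_integrable_compact_if_locally[OF K(1)])
  fix a assume "a \<in> K"
  then obtain r where r: "r > 0" "ball a r \<subseteq> Some -` D" using K(2) D by (meson openE subsetD)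
  obtain \<phi> where \<phi>: "smooth_compact_support (ball a r) \<phi>" "laplacian \<phi> a \<noteq> 0"
    using ex_test_function_laplacian_nonzero[OF r(1)] by blast
  then have \<phi>D: "smooth_compact_support (Some -` D) \<phi>"
    using r(2) unfolding smooth_compact_support_def by blast
  have i: "integrable lborel (\<lambda>z. real_of_ereal (u (Some z)) * laplacian \<phi> z)"
    using R \<phi>D by (auto simp: riesz_in_chart_def has_bochner_integral_iff)
  have "C_k 2 \<phi>" using \<phi>(1) by (simp add: smooth_compact_support_def)
  then have "C_k 0 (pderiv_dir 1 (pderiv_dir 1 \<phi>))" "C_k 0 (pderiv_dir \<i> (pderiv_dir \<i> \<phi>))"
    by (simp_all add: numeral_2_eq_2)
  then have "C_k 0 (laplacian \<phi>)" unfolding laplacian_def[abs_def] by (rule C_k_add)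
  then have lc: "continuous_on UNIV (laplacian \<phi>)" by simp
  then have lm[measurable]: "laplacian \<phi> \<in> borel_measurable borel" by (rule borel_measurable_continuous_onI)
  define m where "m = \<bar>laplacian \<phi> a\<bar> / 2"
  have m: "m > 0" using \<phi>(2) by (simp add: m_def)
  have "isCont (laplacian \<phi>) a" using lc by (simp add: continuous_on_eq_continuous_at)
  then obtain s where s: "s > 0" "\<And>z. dist z a < s \<Longrightarrow> dist (laplacian \<phi> z) (laplacian \<phi> a) < m"
    unfolding continuous_at_eps_delta using m by blast
  have big: "m \<le> \<bar>laplacian \<phi> z\<bar>" if "z \<in> ball a s" for z
  proof -
    have "\<bar>laplacian \<phi> z - laplacian \<phi> a\<bar> < \<bar>laplacian \<phi> a\<bar> / 2"
      using s(2)[of z] that by (simp add: dist_commute[of a] dist_real_def m_def)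
    then show ?thesis unfolding m_def by linarith
  qed
  \<comment> \<open>A bounded Borel multiplier that divides by the Laplacian near \<open>a\<close>
    and truncates to the small disc in one go.\<close>
  define k where "k z = (if z \<in> ball a s then 1 / laplacian \<phi> z else 0)" for z
  have km: "k \<in> borel_measurable lborel" unfolding k_def[abs_def] by (rule measurable_If_set) auto
  have kb: "\<bar>k z\<bar> \<le> 1 / m" for z
    using big[of z] m by (auto simp: k_def intro!: divide_left_mono mult_pos_pos)
  have "integrable lborel (\<lambda>z. real_of_ereal (u (Some z)) * laplacian \<phi> z * k z)"
    by (rule integrable_mult_bounded[OF i km kb])
  moreover have "real_of_ereal (u (Some z)) * laplacian \<phi> z * k z = indicator (ball a s) z *\<^sub>R real_of_ereal (u (Some z))" for z
    using big[of z] m by (auto simp: k_def indicator_def)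
  ultimately have "set_integrable lborel (ball a s) (\<lambda>z. real_of_ereal (u (Some z)))"
    by (simp add: set_integrable_def)
  then show "\<exists>r>0. set_integrable lborel (ball a r) (\<lambda>z. real_of_ereal (u (Some z)))" using s(1) by blast
qed

section \<open>The logarithm of a holomorphic function\<close>

text \<open>A zero-free function on a disc has a holomorphic logarithm \<open>h\<close>, and
  Cauchy's formula at the centre is its mean value property. \<open>W\<close> stands for log
  \<bar>g\<bar> on the circle because \<open>g\<close> is uncontrolled off the disc and need not be
  Borel there.\<close>

lemma circ_mean_ln_holomorphic:
  assumes g: "g holomorphic_on ball c R" "\<And>z. z \<in> ball c R \<Longrightarrow> g z \<noteq> 0" and s: "0 < s" "s < R"
    and W: "W \<in> borel_measurable borel" "\<And>x. cmod x = 1 \<Longrightarrow> W x = ln (cmod (g (c + of_real s * x)))"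
  shows "(\<integral>x. W x \<partial>circ) = ln (cmod (g c))"
proof -
  have "contractible (ball c R)" by (simp add: convex_imp_contractible)
  then obtain h where h: "h holomorphic_on ball c R" "\<And>z. z \<in> ball c R \<Longrightarrow> g z = exp (h z)"
    using contractible_imp_holomorphic_log[OF g(1) _ g(2)] by blast
  have ln_g: "ln (cmod (g z)) = Re (h z)" if "z \<in> ball c R" for z using h(2)[OF that] by simp
  have sub: "cball c s \<subseteq> ball c R" using s by auto
  have hc: "h holomorphic_on cball c s" using h(1) sub by (rule holomorphic_on_subset)
  have "((\<lambda>u. h u / (u - c)) has_contour_integral (2 * pi * \<i> * h c)) (circlepath c s)"
    using Cauchy_integral_circlepath_simple[OF hc, of c] s by simp
  then have "((\<lambda>t. h (c + s * cis t) / (c + s * cis t - c) * s * \<i> * cis t) has_integral (2 * pi * \<i> * h c)) {0..2 * pi}"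
    unfolding circlepath_def by (subst (asm) has_contour_integral_part_circlepath_iff) auto
  then have "((\<lambda>t. \<i> * h (c + s * cis t)) has_integral (2 * pi * \<i> * h c)) {0..2 * pi}"
    by (rule has_integral_eq[rotated]) (use s in auto)
  from has_integral_linear[OF this bounded_linear_Im]
  have I: "((\<lambda>t. Re (h (c + s * cis t))) has_integral (2 * pi * Re (h c))) {0..2 * pi}"
    by (simp add: o_def)
  have inb: "c + s * cis t \<in> ball c R" for t using s by (simp add: dist_norm norm_mult)
  have cont: "continuous_on {0..2 * pi} (\<lambda>t. Re (h (c + s * cis t)))"
    by (intro continuous_intros continuous_on_compose2[OF holomorphic_on_imp_continuous_on[OF h(1)]]) (use inb in auto)
  have si: "set_integrable lborel {0..2 * pi} (\<lambda>t. Re (h (c + s * cis t)))"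
    unfolding set_integrable_def by (rule borel_integrable_compact[OF _ cont]) simp
  have "(LINT t:{0..2 * pi}|lborel. Re (h (c + s * cis t))) = 2 * pi * Re (h c)"
    using set_borel_integral_eq_integral(2)[OF si] I by (simp add: integral_unique)
  moreover have "W (cis t) = Re (h (c + s * cis t))" for t
    using W(2)[of "cis t"] ln_g[OF inb] by simp
  ultimately have "(\<integral>x. W x \<partial>circ) = Re (h c)"
    by (subst integral_circ[OF W(1)]) (simp add: set_lebesgue_integral_def)
  then show ?thesis using ln_g[of c] s by simp
qed

text \<open>Jensen's formula for a single zero. If the zero lies outside the circle this is the mean
  value property; an inside zero is exchanged for an outside one. The excluded radius will only
  matter for a null set of centres.\<close>

lemma circ_mean_ln:
  assumes "0 < s" "cmod d \<noteq> s"
  shows "(\<integral>x. ln (cmod (d + of_real s * x)) \<partial>circ) = ln (max (cmod d) s)"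
proof -
  have far: "(\<integral>x. ln (cmod (d + of_real s * x)) \<partial>circ) = ln (cmod d)" if "0 < s" "s < cmod d" for d s
  proof -
    have "(\<integral>x. ln (cmod (d + of_real s * x)) \<partial>circ) = ln (cmod ((\<lambda>z. z) d))"
      by (rule circ_mean_ln_holomorphic[of "\<lambda>z. z" d "cmod d" s])
        (use that in \<open>auto simp: dist_norm intro!: holomorphic_intros\<close>)
    then show ?thesis by simp
  qed
  show ?thesis
  proof (cases "s < cmod d")
    case True
    then show ?thesis using far[OF assms(1) True] by simp
  next
    case False
    then have ds: "cmod d < s" using assms(2) by simp
    \<comment> \<open>On the unit circle the roles of \<open>d\<close> and \<open>s\<close> can be exchanged.\<close>
    have "(\<integral>x. ln (cmod (d + of_real s * x)) \<partial>circ) = (\<integral>x. ln (cmod (of_real s + cnj d * x)) \<partial>circ)"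
    proof (rule integral_cong_AE)
      show "AE x in circ. ln (cmod (d + of_real s * x)) = ln (cmod (of_real s + cnj d * x))"
        using AE_circ
      proof eventually_elim
        case (elim x)
        then have xx: "cnj x * x = 1" using complex_norm_square[of x] by (simp add: mult.commute)
        have "cmod (d + of_real s * x) = cmod (cnj x * (d + of_real s * x))" using elim by (simp add: norm_mult)
        also have "cnj x * (d + of_real s * x) = cnj (of_real s + cnj d * x)"
          using xx by (simp add: algebra_simps)
        finally show ?case by (simp only: complex_mod_cnj)
      qed
    qed auto
    also have "\<dots> = (\<integral>x. ln (cmod (of_real s + of_real (cmod d) * x)) \<partial>circ)"
      using circ_mean_rotate[of "\<lambda>z. ln (cmod z)" "of_real s" "cnj d"] by simp
    also have "\<dots> = ln s"
    proof (cases "d = 0")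
      case False
      then show ?thesis using far[of "cmod d" "of_real s"] ds assms(1) by simp
    qed (use assms in simp)
    finally show ?thesis using ds by simp
  qed
qed

text \<open>Layer cake: the set where the function exceeds t is, up to the centre, a disc of radius
  s * exp (-t), and its area pi * s^2 * exp (-2 t) integrates over t > 0 to pi * s^2 / 2.\<close>

lemma ln_plus_integral:
  assumes "0 < s"
  shows "integrable lborel (\<lambda>y. max 0 (ln (s / cmod (y - a))))" "(\<integral>y. max 0 (ln (s / cmod (y - a))) \<partial>lborel) = pi * s\<^sup>2 / 2"
proof -
  define P where "P y = max 0 (ln (s / cmod y))" for y
  have Pm[measurable]: "P \<in> borel_measurable borel" unfolding P_def[abs_def] by measurable
  have P0: "0 \<le> P y" for y by (simp add: P_def)
  have "(\<integral>\<^sup>+y. ennreal (P y) \<partial>lborel) = (\<integral>\<^sup>+y. (\<integral>\<^sup>+t. indicator {0..} t * indicator {..<P y} t \<partial>(lborel :: real measure)) \<partial>lborel)"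
  proof (rule nn_integral_cong)
    fix y
    have "ennreal (P y) = emeasure lborel {0..<P y}" using P0[of y] by simp
    also have "\<dots> = (\<integral>\<^sup>+t. indicator {0..<P y} t \<partial>lborel)" by simp
    also have "\<dots> = (\<integral>\<^sup>+t. indicator {0..} t * indicator {..<P y} t \<partial>lborel)"
      by (intro nn_integral_cong) (auto simp: indicator_def)
    finally show "ennreal (P y) = \<dots>" .
  qed
  also have "\<dots> = (\<integral>\<^sup>+t. (\<integral>\<^sup>+y. indicator {0..} t * (if t < P y then 1 else 0) \<partial>lborel) \<partial>(lborel :: real measure))"
  proof -
    have "(\<integral>\<^sup>+y. (\<integral>\<^sup>+t. indicator {0..} t * (if t < P y then 1 else 0 :: ennreal) \<partial>(lborel :: real measure)) \<partial>lborel)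
        = (\<integral>\<^sup>+t. (\<integral>\<^sup>+y. indicator {0..} t * (if t < P y then 1 else 0) \<partial>lborel) \<partial>(lborel :: real measure))"
      by (rule lborel_pair.Fubini'[symmetric]) measurable
    moreover have "indicator {..<P y} t = (if t < P y then 1 else 0 :: ennreal)" for y t by (simp add: indicator_def)
    ultimately show ?thesis by simp
  qed
  also have "\<dots> = (\<integral>\<^sup>+t. ennreal (pi * s\<^sup>2 * exp (- 2 * t)) * indicator {0..} t \<partial>(lborel :: real measure))"
  proof (rule nn_integral_cong)
    fix t :: real
    show "(\<integral>\<^sup>+y. indicator {0..} t * (if t < P y then 1 else 0) \<partial>lborel) = ennreal (pi * s\<^sup>2 * exp (- 2 * t)) * indicator {0..} t"
    proof (cases "0 \<le> t")
      case True
      have "(\<integral>\<^sup>+y. indicator {0..} t * (if t < P y then 1 else 0) \<partial>lborel)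
          = (\<integral>\<^sup>+y. indicator (ball 0 (s * exp (- t))) y \<partial>(lborel :: complex measure))"
      proof (rule nn_integral_cong_AE)
        \<comment> \<open>At y = 0 the quotient s / 0 is 0 by convention, so the logarithmic pole is
          absent there and the two sides may differ.\<close>
        show "AE y in lborel. indicator {0..} t * (if t < P y then 1 else 0) = (indicator (ball 0 (s * exp (- t))) y :: ennreal)"
          using AE_lborel_singleton[of "0::complex"]
        proof eventually_elim
          case (elim y)
          have y: "0 < cmod y" using elim by simp
          have "t < P y \<longleftrightarrow> t < ln (s / cmod y)" using True by (auto simp: P_def)
          also have "\<dots> \<longleftrightarrow> exp t < s / cmod y"
          proof -
            have "0 < s / cmod y" using y assms by simp
            then show ?thesis by (metis exp_less_cancel_iff exp_ln)
          qed
          also have "\<dots> \<longleftrightarrow> cmod y < s * exp (- t)"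
            using y by (simp add: exp_minus field_simps)
          finally show ?case using True by (simp add: indicator_def)
        qed
      qed
      also have "\<dots> = ennreal (pi * (s * exp (- t))\<^sup>2)"
        using assms by (simp add: emeasure_ball unit_ball_vol_2)
      also have "(s * exp (- t))\<^sup>2 = s\<^sup>2 * exp (- 2 * t)"
        by (simp add: power_mult_distrib flip: exp_of_nat_mult)
      finally show ?thesis using True by (simp add: mult.assoc)
    qed simp
  qed
  also have "\<dots> = ennreal (0 - (- (pi * s\<^sup>2 / 2) * exp (- 2 * 0)))"
  proof (rule nn_integral_FTC_atLeast)
    show "((\<lambda>t. - (pi * s\<^sup>2 / 2) * exp (- 2 * t)) has_real_derivative pi * s\<^sup>2 * exp (- 2 * x)) (at x)" for x
      by (auto intro!: derivative_eq_intros)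
    have "((\<lambda>t::real. exp (- 2 * t)) \<longlongrightarrow> 0) at_top"
      by (intro filterlim_compose[OF exp_at_bot] filterlim_tendsto_neg_mult_at_bot[OF tendsto_const]) (auto simp: filterlim_ident)
    then show "((\<lambda>t. - (pi * s\<^sup>2 / 2) * exp (- 2 * t)) \<longlongrightarrow> 0) at_top"
      by (rule tendsto_mult_right_zero)
  qed auto
  finally have nn: "(\<integral>\<^sup>+y. ennreal (P y) \<partial>lborel) = ennreal (pi * s\<^sup>2 / 2)" by simp
  have Pi: "integrable lborel P"
    using nn P0 by (intro integrableI_nonneg) auto
  have PI: "(\<integral>y. P y \<partial>lborel) = pi * s\<^sup>2 / 2"
    using nn P0 by (subst integral_eq_nn_integral) auto
  show "integrable lborel (\<lambda>y. max 0 (ln (s / cmod (y - a))))"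
    using integrable_lborel_translate[OF Pi, of "- a"] by (simp add: P_def)
  show "(\<integral>y. max 0 (ln (s / cmod (y - a))) \<partial>lborel) = pi * s\<^sup>2 / 2"
    using integral_lborel_translate[OF Pm, of "- a"] PI by (simp add: P_def)
qed

text \<open>The negative part is dominated by the truncated pole of \<open>ln_plus_integral\<close>,
  the positive part by a constant on \<open>K\<close>.\<close>

lemma ln_set_integrable:
  assumes K: "compact K"
  shows "set_integrable lborel K (\<lambda>z. ln (cmod (z - a)))"
proof -
  obtain b where b: "\<And>z. z \<in> K \<Longrightarrow> cmod z \<le> b" using compact_imp_bounded[OF K] by (auto simp: bounded_iff)
  define R where "R = max 1 (b + cmod a)"
  have R1: "1 \<le> R" by (simp add: R_def)
  have R2: "cmod (z - a) \<le> R" if "z \<in> K" for z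
    using b[OF that] norm_triangle_ineq4[of z a] by (simp add: R_def)
  note R = R1 R2
  have Km: "K \<in> sets borel" using K by (simp add: borel_compact)
  show ?thesis
    unfolding set_integrable_def
  proof (rule Bochner_Integration.integrable_bound)
    show "integrable lborel (\<lambda>z. max 0 (ln (1 / cmod (z - a))) + ln R * indicator K z)"
      using ln_plus_integral(1)[of 1 a] emeasure_compact_finite[OF K] Km
      by (intro Bochner_Integration.integrable_add integrable_mult_right) auto
    show "AE z in lborel. norm (indicator K z *\<^sub>R ln (cmod (z - a))) \<le> norm (max 0 (ln (1 / cmod (z - a))) + ln R * indicator K z)"
    proof (rule AE_I2)
      fix z
      have lR: "0 \<le> ln R" using R(1) by simp
      show "norm (indicator K z *\<^sub>R ln (cmod (z - a))) \<le> norm (max 0 (ln (1 / cmod (z - a))) + ln R * indicator K z)"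
      proof (cases "z \<in> K \<and> z \<noteq> a")
        case True
        then have "0 < cmod (z - a)" "cmod (z - a) \<le> R" "0 < R" using R by auto
        then have "ln (cmod (z - a)) \<le> ln R" "ln (1 / cmod (z - a)) = - ln (cmod (z - a))" by (simp_all add: ln_div)
        then show ?thesis using True lR by auto
      qed (use lR in \<open>auto simp: indicator_def\<close>)
    qed
  qed (use Km in measurable)
qed

lemma AE_cmod_neq: "AE y in lborel. cmod (y - a) \<noteq> s"
proof -
  have "sphere a s \<in> null_sets lborel"
    using negligible_sphere[of a s] by (auto simp: null_sets_completion_iff negligible_iff_null_sets)
  then have "AE y in lborel. y \<notin> sphere a s" by (rule AE_not_in)
  then show ?thesis by eventually_elim (simp add: dist_norm norm_minus_commute)
qed

text \<open>The logarithm is the fundamental solution. By \<open>circ_mean_ln\<close>, circle mean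
  minus value is the truncated pole \<open>P\<close>, of total mass pi * s^2 / 2; times 4/s^2 it is
  a kernel of mass 2 pi on the disc of radius s about \<open>a\<close>, so the limit is 2 pi
  \<phi>(a). The integrable \<open>w\<close> has to agree with the logarithm only near the support
  of \<phi>.\<close>

lemma laplacian_ln:
  assumes \<phi>: "smooth_compact_support V \<phi>" and K: "compact K" "\<And>z. z \<notin> K \<Longrightarrow> \<phi> z = 0"
    and w: "integrable lborel w" and s0: "0 < s0"
    and wln: "\<And>y z. y \<in> K \<Longrightarrow> dist y z \<le> s0 \<Longrightarrow> w z = ln (cmod (z - a))"
  shows "(\<integral>z. w z * laplacian \<phi> z \<partial>lborel) = 2 * pi * \<phi> a"
proof -
  let ?G = "\<lambda>s. 4 / s\<^sup>2 * (\<integral>y. \<phi> y * ((\<integral>x. w (y + of_real s * x) \<partial>circ) - w y) \<partial>lborel)"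
  have wm[measurable]: "w \<in> borel_measurable borel" using w by auto
  obtain B where fm[measurable]: "\<phi> \<in> borel_measurable borel" and B: "\<And>z. \<bar>\<phi> z\<bar> \<le> B"
    using smooth_compact_support_facts[OF \<phi>] by metis
  have ck: "C_k 1 \<phi>" using \<phi> unfolding smooth_compact_support_def by blast
  obtain C where C: "0 \<le> C" "\<And>z h. \<bar>\<phi> (z + h) - \<phi> z\<bar> \<le> C * cmod h"
    by (rule C_k_Lipschitz[OF ck K]) (assumption | rule that; assumption)+
  have bd: "\<bar>?G s - 2 * pi * \<phi> a\<bar> \<le> 2 * pi * C * s" if s: "0 < s" "s < s0" for s
  proof -
    define P where "P y = max 0 (ln (s / cmod (y - a)))" for y
    have P: "integrable lborel P" "(\<integral>y. P y \<partial>lborel) = pi * s\<^sup>2 / 2"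
      using ln_plus_integral[OF s(1), of a] by (simp_all add: P_def[abs_def])
    have "(\<integral>y. \<phi> y * ((\<integral>x. w (y + of_real s * x) \<partial>circ) - w y) \<partial>lborel) = (\<integral>y. \<phi> y * P y \<partial>lborel)"
    proof (rule integral_cong_AE)
      show "AE y in lborel. \<phi> y * ((\<integral>x. w (y + of_real s * x) \<partial>circ) - w y) = \<phi> y * P y"
        using AE_cmod_neq[of a s] AE_lborel_singleton[of a]
      proof eventually_elim
        case (elim y)
        show ?case
        proof (cases "y \<in> K")
          case True
          have "(\<integral>x. w (y + of_real s * x) \<partial>circ) = (\<integral>x. ln (cmod (y - a + of_real s * x)) \<partial>circ)"
          proof (rule integral_cong_AE)
            show "AE x in circ. w (y + of_real s * x) = ln (cmod (y - a + of_real s * x))"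
              using AE_circ
            proof eventually_elim
              case (elim x)
              then have "w (y + of_real s * x) = ln (cmod (y + of_real s * x - a))"
                using s by (intro wln[OF True]) (simp add: dist_norm norm_mult)
              then show ?case by (simp add: algebra_simps)
            qed
          qed auto
          also have "\<dots> = ln (max (cmod (y - a)) s)" using circ_mean_ln[OF s(1) elim(1)] .
          finally have "(\<integral>x. w (y + of_real s * x) \<partial>circ) - w y = ln (max (cmod (y - a)) s) - ln (cmod (y - a))"
            using wln[OF True, of y] s0 by simp
          also have "\<dots> = P y"
          proof -
            have y: "0 < cmod (y - a)" using elim(2) by simp
            show ?thesis
            proof (cases "cmod (y - a) < s")
              case True
              then have "ln (cmod (y - a)) < ln s" using y s by (intro ln_less_cancel_iff[THEN iffD2])
              then show ?thesis using True y s by (simp add: P_def ln_div)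
            next
              case False
              then have "ln s \<le> ln (cmod (y - a))" using y s by (intro ln_le_cancel_iff[THEN iffD2]) auto
              then show ?thesis using False y s by (simp add: P_def ln_div max_def)
            qed
          qed
          finally show ?thesis by simp
        qed (use K in simp)
      qed
    qed (auto simp: P_def)
    then have "?G s - 2 * pi * \<phi> a = 4 / s\<^sup>2 * ((\<integral>y. \<phi> y * P y \<partial>lborel) - \<phi> a * (\<integral>y. P y \<partial>lborel))"
      using s by (simp add: P(2) field_simps)
    also have "(\<integral>y. \<phi> y * P y \<partial>lborel) - \<phi> a * (\<integral>y. P y \<partial>lborel) = (\<integral>y. (\<phi> y - \<phi> a) * P y \<partial>lborel)"
    proof -
      have "integrable lborel (\<lambda>y. \<phi> y * P y)"
        using integrable_mult_bounded[OF P(1) _ B] by (simp add: mult.commute)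
      then show ?thesis using P(1) by (simp add: left_diff_distrib)
    qed
    also have "\<bar>4 / s\<^sup>2 * (\<integral>y. (\<phi> y - \<phi> a) * P y \<partial>lborel)\<bar> \<le> 4 / s\<^sup>2 * (C * s * (pi * s\<^sup>2 / 2))"
    proof -
      have "\<bar>\<integral>y. (\<phi> y - \<phi> a) * P y \<partial>lborel\<bar> \<le> (\<integral>y. \<bar>(\<phi> y - \<phi> a) * P y\<bar> \<partial>lborel)"
        by (rule integral_abs_bound)
      also have "\<dots> \<le> (\<integral>y. C * s * P y \<partial>lborel)"
      proof (rule integral_mono)
        have "\<bar>\<phi> y - \<phi> a\<bar> \<le> 2 * B" for y using B[of y] B[of a] by linarith
        then show "integrable lborel (\<lambda>y. \<bar>(\<phi> y - \<phi> a) * P y\<bar>)"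
          using integrable_mult_bounded[OF P(1), of "\<lambda>y. \<phi> y - \<phi> a" "2 * B"] by (simp add: mult.commute)
        show "integrable lborel (\<lambda>y. C * s * P y)" using P(1) by simp
        fix y
        have P0: "0 \<le> P y" by (simp add: P_def)
        show "\<bar>(\<phi> y - \<phi> a) * P y\<bar> \<le> C * s * P y"
        proof (cases "cmod (y - a) < s")
          case True
          have "\<bar>\<phi> y - \<phi> a\<bar> \<le> C * cmod (y - a)" using C(2)[of a "y - a"] by simp
          also have "\<dots> \<le> C * s" using True C(1) by (intro mult_left_mono) auto
          finally show ?thesis using P0 by (simp add: abs_mult mult_right_mono)
        next
          case False
          then have c: "0 < cmod (y - a)" "s \<le> cmod (y - a)" using s by linarith+
          have pos: "0 < s / cmod (y - a)" using c(1) s(1) by (rule divide_pos_pos[rotated])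
          have "s / cmod (y - a) \<le> 1" using c by (simp only: divide_le_eq_1_pos)
          then have "ln (s / cmod (y - a)) \<le> 0" by (rule iffD2[OF ln_le_zero_iff[OF pos]])
          then have "P y = 0" by (simp add: P_def)
          then show ?thesis by simp
        qed
      qed
      also have "\<dots> = C * s * (pi * s\<^sup>2 / 2)" using P(2) by simp
      finally have "4 / s\<^sup>2 * \<bar>\<integral>y. (\<phi> y - \<phi> a) * P y \<partial>lborel\<bar> \<le> 4 / s\<^sup>2 * (C * s * (pi * s\<^sup>2 / 2))"
        by (intro mult_left_mono) auto
      then show ?thesis by (simp only: abs_mult) simp
    qed
    also have "\<dots> = 2 * pi * C * s" using s by (simp add: power2_eq_square)
    finally show ?thesis .
  qed
  have "((\<lambda>s. ?G s - 2 * pi * \<phi> a) \<longlongrightarrow> 0) (at_right 0)"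
  proof (rule Lim_null_comparison)
    have "\<forall>\<^sub>F s in at_right 0. s \<in> {0<..<s0}" by (rule eventually_at_right_real[OF s0])
    then show "\<forall>\<^sub>F s in at_right 0. norm (?G s - 2 * pi * \<phi> a) \<le> 2 * pi * C * s"
    proof eventually_elim
      case (elim s)
      then show ?case using bd[of s] by (simp only: real_norm_def) simp
    qed
    show "((\<lambda>s. 2 * pi * C * s) \<longlongrightarrow> 0) (at_right 0)" by (auto intro!: tendsto_eq_intros)
  qed
  then have "(?G \<longlongrightarrow> 2 * pi * \<phi> a) (at_right 0)" by (rule LIM_zero_cancel)
  then show ?thesis
    by (rule tendsto_unique[OF trivial_limit_at_right_real integral_laplacian_limit[OF w \<phi>]])
qed

text \<open>The mean value property makes every approximating integral in
  \<open>integral_laplacian_limit\<close> equal to 0 for small radii.\<close>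

lemma laplacian_ln_holomorphic:
  assumes \<phi>: "smooth_compact_support V \<phi>" and K: "\<And>z. z \<notin> K \<Longrightarrow> \<phi> z = 0"
    and w: "integrable lborel w" and s0: "0 < s0"
    and wln: "\<And>y z. y \<in> K \<Longrightarrow> dist y z < s0 \<Longrightarrow> z \<in> S \<and> w z = ln (cmod (g z))"
    and g: "g holomorphic_on S" "\<And>z. z \<in> S \<Longrightarrow> g z \<noteq> 0"
  shows "(\<integral>z. w z * laplacian \<phi> z \<partial>lborel) = 0"
proof -
  let ?G = "\<lambda>s. 4 / s\<^sup>2 * (\<integral>y. \<phi> y * ((\<integral>x. w (y + of_real s * x) \<partial>circ) - w y) \<partial>lborel)"
  have wm[measurable]: "w \<in> borel_measurable borel" using w by auto
  have z: "?G s = 0" if s: "0 < s" "s < s0" for s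
  proof -
    have "\<phi> y * ((\<integral>x. w (y + of_real s * x) \<partial>circ) - w y) = 0" for y
    proof (cases "y \<in> K")
      case True
      have bS: "ball y s0 \<subseteq> S" using wln[OF True] by auto
      have "(\<integral>x. w (y + of_real s * x) \<partial>circ) = ln (cmod (g y))"
      proof (rule circ_mean_ln_holomorphic[of g y s0 s, OF _ _ s])
        show "g holomorphic_on ball y s0" using g(1) bS by (rule holomorphic_on_subset)
        show "\<And>z. z \<in> ball y s0 \<Longrightarrow> g z \<noteq> 0" using bS g(2) by auto
        show "w (y + of_real s * x) = ln (cmod (g (y + of_real s * x)))" if "cmod x = 1" for x
          using wln[OF True, of "y + of_real s * x"] s that by (simp add: dist_norm norm_mult)
      qed measurable
      then show ?thesis using wln[OF True, of y] s0 by simp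
    qed (use K in simp)
    then show ?thesis by (simp only:) simp
  qed
  have "(?G \<longlongrightarrow> 0) (at_right 0)"
  proof (rule tendsto_eventually)
    have "\<forall>\<^sub>F s in at_right 0. s \<in> {0<..<s0}" by (rule eventually_at_right_real[OF s0])
    then show "\<forall>\<^sub>F s in at_right 0. ?G s = 0"
    proof eventually_elim
      case (elim s)
      then show ?case using z[of s] by (simp only: greaterThanLessThan_iff)
    qed
  qed
  then show ?thesis
    by (rule tendsto_unique[OF trivial_limit_at_right_real integral_laplacian_limit[OF w \<phi>]])
qed

text \<open>All zeros are divided out at once. The quotient is holomorphic off \<open>A\<close>, and
  near a zero \<open>a\<close> it coincides with the local zero-free factor divided by the
  polynomial of the other zeros, which fills the removable singularity.\<close>

lemma holomorphic_factor_zeros: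
  fixes m :: "complex \<Rightarrow> nat"
  assumes F: "F holomorphic_on V" "open V" and A: "finite A" "A = {z \<in> V. F z = 0}"
    and loc: "\<And>a. a \<in> A \<Longrightarrow> \<exists>r>0. \<exists>h. ball a r \<subseteq> V \<and> h holomorphic_on ball a r \<and>
        (\<forall>z\<in>ball a r. F z = h z * (z - a) ^ m a \<and> h z \<noteq> 0)"
  obtains g where "g holomorphic_on V" "\<And>z. z \<in> V \<Longrightarrow> g z \<noteq> 0"
    "\<And>z. z \<in> V \<Longrightarrow> F z = g z * (\<Prod>a\<in>A. (z - a) ^ m a)"
proof -
  obtain r h where rh: "\<And>a. a \<in> A \<Longrightarrow> 0 < r a \<and> ball a (r a) \<subseteq> V \<and> h a holomorphic_on ball a (r a) \<and>
        (\<forall>z\<in>ball a (r a). F z = h a z * (z - a) ^ m a \<and> h a z \<noteq> 0)"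
    using loc by metis
  define Q where "Q B z = (\<Prod>b\<in>B. (z - b) ^ m b)" for B z
  have Qh: "Q B holomorphic_on S" for B S unfolding Q_def[abs_def] by (intro holomorphic_intros)
  have Q0: "Q B z \<noteq> 0" if "finite B" "z \<notin> B" for B z using that by (auto simp: Q_def)
  have QA: "Q A z = (z - a) ^ m a * Q (A - {a}) z" if "a \<in> A" for a z
    using A(1) that by (simp add: Q_def prod.remove)
  have sep: "z \<notin> A" if "a \<in> A" "z \<in> ball a (r a)" "z \<noteq> a" for a z
    using rh[OF that(1)] that A(2) by auto
  define g where "g z = (if z \<in> A then h z z / Q (A - {z}) z else F z / Q A z)" for z
  have g_near: "g z = h a z / Q (A - {a}) z" if "a \<in> A" "z \<in> ball a (r a)" for a z
  proof (cases "z = a")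
    case False
    then have "z \<notin> A" using sep that by blast
    moreover have "F z = h a z * (z - a) ^ m a" using rh[OF that(1)] that(2) by blast
    ultimately show ?thesis using False by (simp add: g_def QA[OF that(1)])
  qed (use that in \<open>simp add: g_def\<close>)
  have AV: "A \<subseteq> V" using A(2) by auto
  have "g holomorphic_on (V - A) \<union> (\<Union>a\<in>A. ball a (r a))"
  proof (rule holomorphic_on_Un)
    have "(\<lambda>z. F z / Q A z) holomorphic_on V - A"
      using Q0[OF A(1)] by (intro holomorphic_on_divide Qh holomorphic_on_subset[OF F(1)]) auto
    then show "g holomorphic_on V - A" by (rule holomorphic_transform) (simp add: g_def)
    show "g holomorphic_on (\<Union>a\<in>A. ball a (r a))"
    proof (rule holomorphic_on_UN_open)
      fix a assume a: "a \<in> A"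
      have "(\<lambda>z. h a z / Q (A - {a}) z) holomorphic_on ball a (r a)"
      proof (intro holomorphic_on_divide Qh)
        show "h a holomorphic_on ball a (r a)" using rh[OF a] by blast
        show "Q (A - {a}) z \<noteq> 0" if "z \<in> ball a (r a)" for z
          using sep[OF a that] A(1) by (intro Q0) auto
      qed
      then show "g holomorphic_on ball a (r a)" by (rule holomorphic_transform) (simp add: g_near[OF a])
    qed auto
    show "open (V - A)" using F(2) A(1) by (simp add: finite_imp_closed open_Diff)
  qed auto
  moreover have "(V - A) \<union> (\<Union>a\<in>A. ball a (r a)) = V" using AV rh by force
  ultimately have 1: "g holomorphic_on V" by simp
  have 2: "g z \<noteq> 0" if "z \<in> V" for z
  proof (cases "z \<in> A")
    case True
    then show ?thesis using g_near[OF True, of z] rh[OF True] Q0[of "A - {z}" z] A(1) by auto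
  next
    case False
    then show ?thesis using A that Q0[OF A(1) False] by (auto simp: g_def)
  qed
  have 3: "F z = g z * (\<Prod>a\<in>A. (z - a) ^ m a)" if "z \<in> V" for z
  proof (cases "z \<in> A")
    case True
    have "F z = h z z * (z - z) ^ m z" using rh[OF True] by auto
    then show ?thesis using g_near[OF True, of z] rh[OF True] Q0[of "A - {z}" z] A(1) QA[OF True, of z]
      by (simp add: Q_def)
  next
    case False
    then show ?thesis using Q0[OF A(1) False] by (simp add: g_def Q_def)
  qed
  show ?thesis using that 1 2 3 by blast
qed

text \<open>Near a compact set only finitely many zeros occur, so log \<bar>F\<bar> splits into a
  harmonic part and finitely many logarithmic poles. The closed neighbourhood \<open>L\<close>
  leaves room for circles about points of \<open>K\<close>, and the open \<open>V\<close> carries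
  the factorisation.\<close>

lemma ln_holomorphic_decomposition:
  assumes G: "open G" and F: "F holomorphic_on G" and fin: "\<And>K. compact K \<Longrightarrow> K \<subseteq> G \<Longrightarrow> finite {z \<in> K. F z = 0}"
    and K: "compact K" "K \<subseteq> G"
  obtains d L V A g where "0 < d" "compact L" "L \<subseteq> V" "V \<subseteq> G" "\<And>y z. y \<in> K \<Longrightarrow> dist y z \<le> d \<Longrightarrow> z \<in> L"
    "finite A" "A = {z \<in> V. F z = 0}" "g holomorphic_on V" "\<And>z. z \<in> V \<Longrightarrow> g z \<noteq> 0"
    "\<And>z. z \<in> V - A \<Longrightarrow> ln (cmod (F z)) = ln (cmod (g z)) + (\<Sum>a\<in>A. real (nat (zorder F a)) * ln (cmod (z - a)))"
proof -
  have "\<exists>e>0. \<forall>x\<in>K. \<forall>y\<in>- G. e \<le> dist x y"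
    by (rule separate_compact_closed) (use K G in auto)
  then obtain e where e: "0 < e" "\<forall>x\<in>K. \<forall>y\<in>- G. e \<le> dist x y" by (elim exE conjE)
  define d where "d = e / 3"
  have d: "0 < d" "2 * d < e" using e(1) by (auto simp: d_def)
  define L where "L = {x + y | x y. x \<in> K \<and> y \<in> cball 0 d}"
  define L2 where "L2 = {x + y | x y. x \<in> K \<and> y \<in> cball 0 (2 * d)}"
  define V where "V = (\<Union>x\<in>K. ball x (2 * d))"
  have memL: "z \<in> L \<longleftrightarrow> (\<exists>x\<in>K. dist x z \<le> d)" and memL2: "z \<in> L2 \<longleftrightarrow> (\<exists>x\<in>K. dist x z \<le> 2 * d)" for z
  proof -
    have *: "z \<in> {x + y | x y. x \<in> K \<and> y \<in> cball 0 c} \<longleftrightarrow> (\<exists>x\<in>K. dist x z \<le> c)" for c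
    proof
      assume "z \<in> {x + y | x y. x \<in> K \<and> y \<in> cball 0 c}"
      then obtain x y where "z = x + y" "x \<in> K" "cmod y \<le> c" by auto
      then show "\<exists>x\<in>K. dist x z \<le> c" by (intro bexI[of _ x]) (simp_all add: dist_norm)
    next
      assume "\<exists>x\<in>K. dist x z \<le> c"
      then obtain x where "x \<in> K" "dist x z \<le> c" by blast
      then show "z \<in> {x + y | x y. x \<in> K \<and> y \<in> cball 0 c}"
        by (intro CollectI exI[of _ x] exI[of _ "z - x"]) (auto simp: dist_norm norm_minus_commute)
    qed
    show "z \<in> L \<longleftrightarrow> (\<exists>x\<in>K. dist x z \<le> d)" unfolding L_def by (rule *)
    show "z \<in> L2 \<longleftrightarrow> (\<exists>x\<in>K. dist x z \<le> 2 * d)" unfolding L2_def by (rule *)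
  qed
  have L: "compact L" "compact L2" unfolding L_def L2_def by (intro compact_sums K compact_cball)+
  have L2G: "L2 \<subseteq> G"
  proof
    fix z assume "z \<in> L2"
    then obtain x where x: "x \<in> K" "dist x z \<le> 2 * d" using memL2 by blast
    then show "z \<in> G" using e(2) d(2) by force
  qed
  have LV: "L \<subseteq> V" using memL d(1) by (force simp: V_def)
  have VL2: "V \<subseteq> L2" using memL2 by (force simp: V_def)
  have oV: "open V" by (auto simp: V_def)
  define A where "A = {z \<in> V. F z = 0}"
  have A: "finite A" using finite_subset[OF _ fin[OF L(2) L2G], of A] VL2 by (auto simp: A_def)
  have FV: "F holomorphic_on V" using F VL2 L2G by (auto intro: holomorphic_on_subset)
  define m where "m a = nat (zorder F a)" for a
  have loc: "\<exists>r>0. \<exists>h. ball a r \<subseteq> V \<and> h holomorphic_on ball a r \<and>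
        (\<forall>z\<in>ball a r. F z = h z * (z - a) ^ m a \<and> h z \<noteq> 0)" if a: "a \<in> A" for a
  proof -
    have "a \<in> V" using a by (simp add: A_def)
    then obtain r0 where r0: "0 < r0" "ball a r0 \<subseteq> V" by (rule openE[OF oV])
    \<comment> \<open>\<open>zorder_exist_zero\<close> asks for a nonzero value near
      \<open>a\<close>; a whole disc of zeros would be infinite.\<close>
    have "\<not> ball a r0 \<subseteq> A"
    proof
      assume "ball a r0 \<subseteq> A"
      then have "finite (ball a r0)" using A finite_subset by blast
      then show False using finite_imp_not_open[of "ball a r0"] r0(1) by simp
    qed
    then have nz: "\<exists>w\<in>ball a r0. F w \<noteq> 0" using r0(2) by (auto simp: A_def)
    have "F holomorphic_on ball a r0" using FV r0(2) by (rule holomorphic_on_subset)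
    from zorder_exist_zero[OF this _ _ _ nz, of a] r0(1)
    have "\<exists>r. r > 0 \<and> cball a r \<subseteq> ball a r0 \<and> zor_poly F a holomorphic_on cball a r \<and>
      (\<forall>w\<in>cball a r. F w = zor_poly F a w * (w - a) ^ nat (zorder F a) \<and> zor_poly F a w \<noteq> 0)"
      by simp
    then obtain r where r: "r > 0" "cball a r \<subseteq> ball a r0" "zor_poly F a holomorphic_on cball a r"
      "\<forall>w\<in>cball a r. F w = zor_poly F a w * (w - a) ^ nat (zorder F a) \<and> zor_poly F a w \<noteq> 0"
      by (elim exE conjE)
    show ?thesis
    proof (intro exI[of _ r] exI[of _ "zor_poly F a"] conjI)
      show "zor_poly F a holomorphic_on ball a r" using r(3) by (rule holomorphic_on_subset) auto
      have "ball a r \<subseteq> cball a r" by (rule ball_subset_cball)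
      with r(2) r0(2) show "ball a r \<subseteq> V" by blast
      show "\<forall>z\<in>ball a r. F z = zor_poly F a z * (z - a) ^ m a \<and> zor_poly F a z \<noteq> 0" using r(4) by (simp add: m_def)
    qed (use r in auto)
  qed
  obtain g where g: "g holomorphic_on V" "\<And>z. z \<in> V \<Longrightarrow> g z \<noteq> 0" "\<And>z. z \<in> V \<Longrightarrow> F z = g z * (\<Prod>a\<in>A. (z - a) ^ m a)"
    by (rule holomorphic_factor_zeros[OF FV oV A A_def loc]) (assumption | rule that; assumption)+
  have dec: "ln (cmod (F z)) = ln (cmod (g z)) + (\<Sum>a\<in>A. real (nat (zorder F a)) * ln (cmod (z - a)))" if z: "z \<in> V - A" for z
  proof -
    have za: "cmod (z - a) > 0" if "a \<in> A" for a using z that by auto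
    have "cmod (F z) = cmod (g z) * (\<Prod>a\<in>A. cmod (z - a) ^ m a)"
      using g(3)[of z] z by (simp add: norm_mult prod_norm[symmetric] norm_power)
    then have "ln (cmod (F z)) = ln (cmod (g z)) + ln (\<Prod>a\<in>A. cmod (z - a) ^ m a)"
      using g(2)[of z] z za by (simp add: ln_mult_pos prod_pos)
    also have "ln (\<Prod>a\<in>A. cmod (z - a) ^ m a) = (\<Sum>a\<in>A. ln (cmod (z - a) ^ m a))"
      by (rule ln_prod) (use za A in auto)
    also have "\<dots> = (\<Sum>a\<in>A. real (m a) * ln (cmod (z - a)))"
      by (intro sum.cong refl ln_realpow za)
    finally show ?thesis by (simp add: m_def)
  qed
  show ?thesis
  proof (rule that[OF d(1) L(1) LV _ _ A A_def g(1,2) dec])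
    show "V \<subseteq> G" using VL2 L2G by blast
    show "z \<in> L" if "y \<in> K" "dist y z \<le> d" for y z using memL that by blast
  qed
qed

text \<open>Summing the contributions of the decomposition, the zero-free factor gives 0 and each
  zero gives 2 pi times its multiplicity times the value of \<phi>.\<close>

lemma ln_holomorphic_riesz:
  assumes G: "open G" and F: "F holomorphic_on G" and fin: "\<And>K. compact K \<Longrightarrow> K \<subseteq> G \<Longrightarrow> finite {z \<in> K. F z = 0}"
    and K: "compact K" "K \<subseteq> G"
  shows "set_integrable lborel K (\<lambda>z. ln (cmod (F z)))"
    and "smooth_compact_support G \<phi> \<Longrightarrow> (\<And>z. z \<notin> K \<Longrightarrow> \<phi> z = 0) \<Longrightarrow>
      (\<integral>z. ln (cmod (F z)) * laplacian \<phi> z \<partial>lborel) = 2 * pi * (\<Sum>a\<in>{z \<in> K. F z = 0}. real (nat (zorder F a)) * \<phi> a)"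
proof -
  obtain d L V A g where d: "0 < d" and L: "compact L" "L \<subseteq> V" "V \<subseteq> G" "\<And>y z. y \<in> K \<Longrightarrow> dist y z \<le> d \<Longrightarrow> z \<in> L"
    and A: "finite A" "A = {z \<in> V. F z = 0}" and g: "g holomorphic_on V" "\<And>z. z \<in> V \<Longrightarrow> g z \<noteq> 0"
    and dec: "\<And>z. z \<in> V - A \<Longrightarrow> ln (cmod (F z)) = ln (cmod (g z)) + (\<Sum>a\<in>A. real (nat (zorder F a)) * ln (cmod (z - a)))"
    by (rule ln_holomorphic_decomposition[OF G F fin K]) (assumption | rule that; assumption)+
  define m where "m a = real (nat (zorder F a))" for a
  have Lm[measurable]: "L \<in> sets borel" using L(1) by (rule borel_compact)
  define wF where "wF z = indicator L z * ln (cmod (F z))" for z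
  define wg where "wg z = indicator L z * ln (cmod (g z))" for z
  define wa where "wa a z = indicator L z * ln (cmod (z - a))" for a z
  have cF: "continuous_on L F" using F L by (meson holomorphic_on_imp_continuous_on holomorphic_on_subset)
  have cg: "continuous_on L g" using g(1) L(2) by (meson holomorphic_on_imp_continuous_on holomorphic_on_subset)
  have wFm[measurable]: "wF \<in> borel_measurable borel"
  \<comment> \<open>\<open>F\<close> is controlled only on \<open>G\<close>; multiplied by the
    indicator of \<open>L\<close> it becomes Borel on the whole plane without changing
    \<open>wF\<close>.\<close>
  proof -
    have [measurable]: "(\<lambda>z. indicator L z *\<^sub>R F z) \<in> borel_measurable borel"
      by (rule borel_measurable_continuous_on_indicator[OF Lm cF])
    have "(\<lambda>z. indicator L z * ln (cmod (indicator L z *\<^sub>R F z))) \<in> borel_measurable borel" by measurable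
    moreover have "(\<lambda>z. indicator L z * ln (cmod (indicator L z *\<^sub>R F z))) = wF"
      by (auto simp: wF_def fun_eq_iff indicator_def)
    ultimately show ?thesis by simp
  qed
  have wgi: "integrable lborel wg"
  proof -
    have "continuous_on L (\<lambda>z. ln (cmod (g z)))"
      using L(2) g(2) by (intro continuous_intros cg) auto
    from borel_integrable_compact[OF L(1) this] show ?thesis by (simp add: wg_def[abs_def])
  qed
  have wai: "integrable lborel (wa a)" for a
    using ln_set_integrable[OF L(1), of a] by (simp add: set_integrable_def wa_def[abs_def])
  have notA: "AE z in lborel. z \<notin> A" by (rule AE_not_in[OF finite_imp_null_set_lborel[OF A(1)]])
  have AE_dec: "AE z in lborel. wF z = wg z + (\<Sum>a\<in>A. m a * wa a z)"
    using notA
  proof eventually_elim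
    case (elim z)
    show ?case
    proof (cases "z \<in> L")
      case True
      then show ?thesis using dec[of z] elim L(2) by (auto simp: wF_def wg_def wa_def m_def)
    qed (simp add: wF_def wg_def wa_def)
  qed
  have wsi: "integrable lborel (\<lambda>z. wg z + (\<Sum>a\<in>A. m a * wa a z))"
    using wgi wai by auto
  then have wFi: "integrable lborel wF"
    using AE_dec wFm by (subst integrable_cong_AE[OF _ _ AE_dec]) auto
  have KL: "K \<subseteq> L" using L(4) d by force
  have "set_integrable lborel L (\<lambda>z. ln (cmod (F z)))"
    using wFi by (simp add: set_integrable_def wF_def[abs_def])
  then show "set_integrable lborel K (\<lambda>z. ln (cmod (F z)))"
    by (rule set_integrable_subset) (use K KL in \<open>auto intro: borel_compact\<close>)
  assume \<phi>: "smooth_compact_support G \<phi>" and \<phi>K: "\<And>z. z \<notin> K \<Longrightarrow> \<phi> z = 0"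
  obtain B where lm[measurable]: "laplacian \<phi> \<in> borel_measurable borel" and B: "\<And>z. \<bar>laplacian \<phi> z\<bar> \<le> B"
    using smooth_compact_support_facts[OF \<phi>] by metis
  have l0: "laplacian \<phi> z = 0" if "z \<notin> K" for z
    by (rule laplacian_zero_outside[of K]) (use K \<phi>K that in \<open>auto intro: compact_imp_closed\<close>)
  have "(\<integral>z. ln (cmod (F z)) * laplacian \<phi> z \<partial>lborel) = (\<integral>z. wF z * laplacian \<phi> z \<partial>lborel)"
    using l0 KL by (intro Bochner_Integration.integral_cong) (auto simp: wF_def indicator_def)
  also have "\<dots> = (\<integral>z. wg z * laplacian \<phi> z + (\<Sum>a\<in>A. m a * (wa a z * laplacian \<phi> z)) \<partial>lborel)"
  proof (rule integral_cong_AE)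
    show "AE z in lborel. wF z * laplacian \<phi> z = wg z * laplacian \<phi> z + (\<Sum>a\<in>A. m a * (wa a z * laplacian \<phi> z))"
      using AE_dec by eventually_elim (simp add: distrib_right sum_distrib_right mult.assoc)
    have "wg \<in> borel_measurable lborel" "\<And>a. wa a \<in> borel_measurable lborel" using wgi wai by auto
    then show "(\<lambda>z. wg z * laplacian \<phi> z + (\<Sum>a\<in>A. m a * (wa a z * laplacian \<phi> z))) \<in> borel_measurable lborel"
      by measurable
  qed measurable
  also have "\<dots> = (\<integral>z. wg z * laplacian \<phi> z \<partial>lborel) + (\<Sum>a\<in>A. m a * (\<integral>z. wa a z * laplacian \<phi> z \<partial>lborel))"
    using integrable_mult_bounded[OF wgi _ B] integrable_mult_bounded[OF wai _ B]
    by (subst Bochner_Integration.integral_add) auto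
  also have "(\<integral>z. wg z * laplacian \<phi> z \<partial>lborel) = 0"
  proof (rule laplacian_ln_holomorphic[OF \<phi> \<phi>K wgi d _ g])
    show "z \<in> V \<and> wg z = ln (cmod (g z))" if "y \<in> K" "dist y z < d" for y z
      using L(4)[OF that(1), of z] that(2) L(2) by (auto simp: wg_def)
  qed auto
  also have "(\<Sum>a\<in>A. m a * (\<integral>z. wa a z * laplacian \<phi> z \<partial>lborel)) = (\<Sum>a\<in>A. m a * (2 * pi * \<phi> a))"
  proof (intro sum.cong refl arg_cong2[where f = "(*)"])
    fix a
    show "(\<integral>z. wa a z * laplacian \<phi> z \<partial>lborel) = 2 * pi * \<phi> a"
    proof (rule laplacian_ln[OF \<phi> K(1) \<phi>K wai d])
      show "wa a z = ln (cmod (z - a))" if "y \<in> K" "dist y z \<le> d" for y z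
        using L(4)[OF that] by (simp add: wa_def)
    qed auto
  qed
  also have "\<dots> = 2 * pi * (\<Sum>a\<in>A. m a * \<phi> a)" by (simp add: sum_distrib_left mult_ac)
  \<comment> \<open>The factorisation also involves zeros in \<open>V\<close> outside
    \<open>K\<close>, but \<phi> vanishes there.\<close>
  also have "(\<Sum>a\<in>A. m a * \<phi> a) = (\<Sum>a\<in>{z \<in> K. F z = 0}. m a * \<phi> a)"
    by (rule sum.mono_neutral_right) (use A KL L(2) \<phi>K in auto)
  finally show "(\<integral>z. ln (cmod (F z)) * laplacian \<phi> z \<partial>lborel) = 2 * pi * (\<Sum>a\<in>{z \<in> K. F z = 0}. real (nat (zorder F a)) * \<phi> a)"
    by (simp add: m_def)
qed

section \<open>Zeros on the sphere\<close>

text \<open>Halving the radius provides a compact disc inside the domain, on which a nonconstant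
  holomorphic function has finitely many zeros.\<close>

lemma holomorphic_ball_zeros:
  assumes "g holomorphic_on ball c r" "0 < r"
  shows "(\<forall>z\<in>ball c (r / 2). g z = 0) \<or> finite {z \<in> ball c (r / 2). g z = 0}"
proof (cases "g constant_on ball c r")
  case True
  then obtain k where k: "\<And>z. z \<in> ball c r \<Longrightarrow> g z = k" by (auto simp: constant_on_def)
  have "ball c (r / 2) \<subseteq> ball c r" using assms(2) by (intro subset_ball) simp
  then have k': "\<And>z. z \<in> ball c (r / 2) \<Longrightarrow> g z = k" using k by blast
  show ?thesis
  proof (cases "k = 0")
    case False
    then have "{z \<in> ball c (r / 2). g z = 0} = {}" using k' by auto
    then show ?thesis by (simp only: finite.emptyI simp_thms)
  qed (use k' in blast)
next
  case False
  have "cball c (r / 2) \<subseteq> ball c r" using assms(2) by auto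
  then have "finite {z \<in> cball c (r / 2). g z = 0}"
    using assms(1) False by (intro holomorphic_compact_finite_zeros) auto
  then have "finite {z \<in> ball c (r / 2). g z = 0}" by (rule rev_finite_subset) auto
  then show ?thesis by blast
qed

section \<open>Zeros and multiplicities in the two charts\<close>

lemma holomorphic_sphere_chart_balls:
  assumes D: "openin sphere_top D" and f: "holomorphic_sphere f D"
  shows "Some z \<in> D \<Longrightarrow> \<exists>r>0. ball z r \<subseteq> Some -` D \<and> (\<lambda>z. f (Some z)) holomorphic_on ball z r"
    and "None \<in> D \<Longrightarrow> \<exists>r>0. ball 0 r \<subseteq> inv_chart -` D \<and> (\<lambda>w. f (inv_chart (cnj w))) holomorphic_on ball 0 r"
proof -
  assume "Some z \<in> D"
  then have z: "z \<in> Some -` D" by simp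
  have "open (Some -` D)" using D by (simp add: openin_sphere_iff)
  then obtain r where r: "r > 0" "ball z r \<subseteq> Some -` D" using z by (rule openE)
  moreover have "(\<lambda>z. f (Some z)) holomorphic_on ball z r"
  proof (rule holomorphic_on_subset)
    show "(\<lambda>z. f (Some z)) holomorphic_on {z. Some z \<in> D}" using f by (simp add: holomorphic_sphere_def)
  qed (use r in auto)
  ultimately show "\<exists>r>0. ball z r \<subseteq> Some -` D \<and> (\<lambda>z. f (Some z)) holomorphic_on ball z r" by blast
next
  assume "None \<in> D"
  then have z: "0 \<in> inv_chart -` D" by (simp add: inv_chart_def)
  obtain r where r: "r > 0" "ball 0 r \<subseteq> inv_chart -` D" by (rule openE[OF open_inv_chart_vimage[OF D] z])
  moreover have "(\<lambda>w. f (inv_chart (cnj w))) holomorphic_on ball 0 r"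
  proof (rule holomorphic_on_subset)
    show "(\<lambda>w. f (inv_chart (cnj w))) holomorphic_on {w. inv_chart (cnj w) \<in> D}" using f by (simp add: holomorphic_sphere_def)
    show "ball 0 r \<subseteq> {w. inv_chart (cnj w) \<in> D}"
    proof
      fix w :: complex assume "w \<in> ball 0 r"
      then have "cnj w \<in> ball 0 r" by simp
      then show "w \<in> {w. inv_chart (cnj w) \<in> D}" using r(2) by blast
    qed
  qed
  ultimately show "\<exists>r>0. ball 0 r \<subseteq> inv_chart -` D \<and> (\<lambda>w. f (inv_chart (cnj w))) holomorphic_on ball 0 r" by blast
qed

text \<open>The identity theorem on the sphere, again through
  \<open>connected_domain_dichotomy\<close>: locally \<open>f\<close> is 0 or has finitely many
  zeros, and a nonempty open subset of the plane is infinite.\<close>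

lemma locally_finite_zeros:
  assumes D: "sphere_domain D" and f: "holomorphic_sphere f D" and p0: "p0 \<in> D" "f p0 \<noteq> 0" and p: "p \<in> D"
  shows "\<exists>W. openin sphere_top W \<and> p \<in> W \<and> W \<subseteq> D \<and> finite {q \<in> W. f q = 0}"
proof -
  have oD: "openin sphere_top D" using D by (simp add: sphere_domain_def)
  show ?thesis
  proof (rule connected_domain_dichotomy[of D p0 "\<lambda>q. f q = 0" "\<lambda>W. finite {q \<in> W. f q = 0}" p])
    show "sphere_domain D" "p0 \<in> D" "f p0 \<noteq> 0" "p \<in> D" by fact+
  next
    fix p assume p: "p \<in> D"
    show "\<exists>W. openin sphere_top W \<and> p \<in> W \<and> W \<subseteq> D \<and> (finite {q \<in> W. f q = 0} \<or> (\<forall>q\<in>W. f q = 0))"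
    proof (cases p)
      case (Some z)
      then obtain r where r: "r > 0" "ball z r \<subseteq> Some -` D" "(\<lambda>z. f (Some z)) holomorphic_on ball z r"
        using holomorphic_sphere_chart_balls(1)[OF oD f, of z] p by blast
      let ?W = "Some ` ball z (r / 2)"
      have sub: "ball z (r / 2) \<subseteq> ball z r" using r(1) by (intro subset_ball) simp
      have W: "openin sphere_top ?W" "p \<in> ?W" "?W \<subseteq> D"
        using r Some sub by (auto intro!: openin_sphere_Some)
      from holomorphic_ball_zeros[OF r(3,1)] have "finite {q \<in> ?W. f q = 0} \<or> (\<forall>q\<in>?W. f q = 0)"
      proof
        assume "finite {y \<in> ball z (r / 2). f (Some y) = 0}"
        then have "finite (Some ` {y \<in> ball z (r / 2). f (Some y) = 0})" by (rule finite_imageI)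
        then have "finite {q \<in> ?W. f q = 0}" by (rule rev_finite_subset) auto
        then show ?thesis by blast
      qed auto
      then show ?thesis using W by blast
    next
      case None
      then obtain r where r: "r > 0" "ball 0 r \<subseteq> inv_chart -` D" "(\<lambda>w. f (inv_chart (cnj w))) holomorphic_on ball 0 r"
        using holomorphic_sphere_chart_balls(2)[OF oD f] p by blast
      have r2: "0 < r / 2" using r(1) by simp
      let ?W = "inv_chart ` ball 0 (r / 2)"
      have sub: "ball 0 (r / 2) \<subseteq> ball (0::complex) r" using r(1) by (intro subset_ball) simp
      have W: "openin sphere_top ?W" "p \<in> ?W" "?W \<subseteq> D"
        using r None inv_chart_image_ball[OF r2] sub by auto
      have Wc: "q \<in> ?W \<Longrightarrow> \<exists>w\<in>ball 0 (r / 2). q = inv_chart (cnj w)" for q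
      proof -
        assume "q \<in> ?W"
        then obtain w where "w \<in> ball 0 (r / 2)" "q = inv_chart w" by blast
        then show ?thesis by (intro bexI[of _ "cnj w"]) simp_all
      qed
      from holomorphic_ball_zeros[OF r(3,1)] have "finite {q \<in> ?W. f q = 0} \<or> (\<forall>q\<in>?W. f q = 0)"
      proof
        assume "finite {w \<in> ball 0 (r / 2). f (inv_chart (cnj w)) = 0}"
        then have "finite ((\<lambda>w. inv_chart (cnj w)) ` {w \<in> ball 0 (r / 2). f (inv_chart (cnj w)) = 0})" by (rule finite_imageI)
        then have "finite {q \<in> ?W. f q = 0}"
        proof (rule rev_finite_subset)
          show "{q \<in> ?W. f q = 0} \<subseteq> (\<lambda>w. inv_chart (cnj w)) ` {w \<in> ball 0 (r / 2). f (inv_chart (cnj w)) = 0}"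
          proof
            fix q assume q: "q \<in> {q \<in> ?W. f q = 0}"
            then have "q \<in> ?W" "f q = 0" by simp_all
            from Wc[OF this(1)] obtain w where "w \<in> ball 0 (r / 2)" "q = inv_chart (cnj w)" by (elim bexE)
            with \<open>f q = 0\<close> show "q \<in> (\<lambda>w. inv_chart (cnj w)) ` {w \<in> ball 0 (r / 2). f (inv_chart (cnj w)) = 0}"
              by (intro image_eqI[of _ _ w]) simp_all
          qed
        qed
        then show ?thesis by blast
      next
        assume "\<forall>w\<in>ball 0 (r / 2). f (inv_chart (cnj w)) = 0"
        then have "f q = 0" if "q \<in> ?W" for q using Wc[OF that] by (elim bexE) simp
        then show ?thesis by blast
      qed
      then show ?thesis using W by blast
    qed
  next
    fix W W' assume W: "openin sphere_top W" "openin sphere_top W'" "finite {q \<in> W. f q = 0}" "\<forall>q\<in>W'. f q = 0" "Some -` (W \<inter> W') \<noteq> {}"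
    have "open (Some -` (W \<inter> W'))" using openin_Int[OF W(1,2)] by (simp add: openin_sphere_iff)
    moreover have "finite (Some -` {q \<in> W. f q = 0})" using W(3) by (intro finite_vimageI) auto
    then have "finite (Some -` (W \<inter> W'))" by (rule rev_finite_subset) (use W(4) in auto)
    ultimately show False using W(5) finite_imp_not_open by blast
  qed
qed

lemma finite_zeros_on_compact:
  assumes D: "sphere_domain D" and f: "holomorphic_sphere f D" and p0: "p0 \<in> D" "f p0 \<noteq> 0"
    and K: "compactin sphere_top K" "K \<subseteq> D"
  shows "finite {q \<in> K. f q = 0}"
proof -
  let ?U = "{W. openin sphere_top W \<and> finite {q \<in> W. f q = 0}}"
  have cov: "K \<subseteq> \<Union>?U"
  proof
    fix p assume "p \<in> K"
    then have "p \<in> D" using K by blast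
    from locally_finite_zeros[OF D f p0 this] show "p \<in> \<Union>?U" by blast
  qed
  have op: "openin sphere_top W" if "W \<in> ?U" for W using that by simp
  have "\<exists>F. finite F \<and> F \<subseteq> ?U \<and> K \<subseteq> \<Union>F" by (rule compactinD[OF K(1) op cov])
  then obtain F where F: "finite F" "F \<subseteq> ?U" "K \<subseteq> \<Union>F" by (elim exE conjE)
  have "finite (\<Union>W\<in>F. {q \<in> W. f q = 0})" using F by auto
  then show ?thesis by (rule rev_finite_subset) (use F(3) in blast)
qed

text \<open>This makes every term of a sequence on which \<open>f\<close> vanishes an actual zero: a
  point that occurs at least once has positive multiplicity.\<close>

lemma zero_multiplicity_nonzero:
  assumes D: "openin sphere_top D" and f: "holomorphic_sphere f D" and p: "p \<in> D" "f p \<noteq> 0"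
  shows "zero_multiplicity f p = 0"
proof (cases p)
  case (Some z)
  then obtain r where r: "r > 0" "(\<lambda>z. f (Some z)) holomorphic_on ball z r"
    using holomorphic_sphere_chart_balls(1)[OF D f, of z] p by blast
  have "\<exists>w\<in>ball z r. f (Some w) \<noteq> 0" using r(1) p Some by (intro bexI[of _ z]) auto
  from zorder_exist_zero[OF r(2) _ _ _ this, of z] r(1) p Some show ?thesis
    by (simp add: zero_multiplicity_def)
next
  case None
  then obtain r where r: "r > 0" "(\<lambda>w. f (inv_chart (cnj w))) holomorphic_on ball 0 r"
    using holomorphic_sphere_chart_balls(2)[OF D f] p by blast
  have n: "inv_chart (cnj 0) = p" using None by (simp add: inv_chart_def)
  have "\<exists>w\<in>ball 0 r. f (inv_chart (cnj w)) \<noteq> 0" using r(1) p n by (intro bexI[of _ 0]) auto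
  from zorder_exist_zero[OF r(2) _ _ _ this, of 0] r(1) p n None show ?thesis
    by (simp add: zero_multiplicity_def)
qed

text \<open>\<open>v\<close> is arbitrary off \<open>D - D0\<close>; its extension by 0 has sublevel
  sets built from open sublevel sets of the subharmonic extension.\<close>

lemma borel_measurable_sbh_on:
  assumes \<nu>: "radon_on D \<nu>" and D: "openin sphere_top D" and D0: "openin sphere_top D0" and v: "v \<in> sbh (D - D0)"
  shows "(\<lambda>p. e2ennreal (v p) * indicator (D - D0) p) \<in> borel_measurable \<nu>"
proof -
  obtain U V where V: "D - D0 \<subseteq> U" "subharmonic U V" "\<And>p. p \<in> D - D0 \<Longrightarrow> v p = V p"
    using v by (auto simp: sbh_def)
  have sp: "space \<nu> = D" using \<nu> by (simp add: radon_on_def)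
  have "D \<inter> D0 \<in> sets \<nu>" by (rule radon_on_open[OF \<nu>]) (use D D0 in auto)
  then have D0m: "D - D \<inter> D0 \<in> sets \<nu>" "D \<inter> D0 \<in> sets \<nu>" using sp by (metis sets.compl_sets)+
  define g where "g p = (if p \<in> D - D0 then v p else 0)" for p
  have gm: "g \<in> borel_measurable \<nu>"
  proof (rule borel_measurableI_less)
    fix c
    have 1: "D \<inter> {p \<in> U. V p < c} \<in> sets \<nu>"
      by (rule radon_on_open[OF \<nu>]) (use D openin_sphere_sublevel[OF V(2)] in auto)
    have "{p \<in> space \<nu>. g p < c} = (D - D \<inter> D0) \<inter> (D \<inter> {p \<in> U. V p < c}) \<union> (if 0 < c then D \<inter> D0 else {})"
      unfolding sp g_def using V by auto
    moreover have "(D - D \<inter> D0) \<inter> (D \<inter> {p \<in> U. V p < c}) \<in> sets \<nu>" using D0m(1) 1 by (rule sets.Int)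
    ultimately show "{p \<in> space \<nu>. g p < c} \<in> sets \<nu>" using D0m(2) by auto
  qed
  then have "(\<lambda>p. e2ennreal (g p)) \<in> borel_measurable \<nu>" by measurable
  moreover have "e2ennreal (g p) = e2ennreal (v p) * indicator (D - D0) p" for p
    by (auto simp: g_def zero_ereal_def)
  ultimately show ?thesis by simp
qed

text \<open>Pushing \<open>count_space I\<close> forward by \<open>Z\<close> counts repetitions
  automatically. Compact sets get finite mass because they contain finitely many zeros of
  \<open>f\<close>, each repeated finitely often.\<close>

lemma radon_on_zero_counting:
  fixes Z :: "nat \<Rightarrow> complex option" and I D f
  defines "\<nu> \<equiv> distr (count_space I) (sigma D {U. openin sphere_top U \<and> U \<subseteq> D}) Z"
  assumes D: "sphere_domain D" and f: "holomorphic_sphere f D" and p0: "p0 \<in> D" "f p0 \<noteq> 0"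
    and ZD: "\<forall>k\<in>I. Z k \<in> D" and van: "vanishes_on_sequence D f I Z"
  shows "radon_on D \<nu>" "\<And>K. compactin sphere_top K \<Longrightarrow> K \<subseteq> D \<Longrightarrow> finite {k \<in> I. Z k \<in> K}"
    "\<And>k. k \<in> I \<Longrightarrow> f (Z k) = 0"
proof -
  have oD: "openin sphere_top D" using D by (simp add: sphere_domain_def)
  have Z: "Z k \<in> D" if "k \<in> I" for k using ZD that by blast
  have sub: "{U. openin sphere_top U \<and> U \<subseteq> D} \<subseteq> Pow D" by auto
  have sp: "space (sigma D {U. openin sphere_top U \<and> U \<subseteq> D}) = D"
    and st: "sets (sigma D {U. openin sphere_top U \<and> U \<subseteq> D}) = sigma_sets D {U. openin sphere_top U \<and> U \<subseteq> D}"
    using sub by (simp_all add: space_measure_of sets_measure_of)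
  have Zm: "Z \<in> measurable (count_space I) (sigma D {U. openin sphere_top U \<and> U \<subseteq> D})"
    using Z by (simp add: sp)
  show f0: "f (Z k) = 0" if k: "k \<in> I" for k
  proof (rule ccontr)
    assume nz: "f (Z k) \<noteq> 0"
    have "finite {j \<in> I. Z j = Z k}" "int (card {j \<in> I. Z j = Z k}) \<le> zero_multiplicity f (Z k)"
      using van Z[OF k] by (auto simp: vanishes_on_sequence_def)
    moreover have "k \<in> {j \<in> I. Z j = Z k}" using k by simp
    ultimately have "0 < zero_multiplicity f (Z k)" by (smt (verit) card_gt_0_iff empty_iff of_nat_0_less_iff)
    then show False using zero_multiplicity_nonzero[OF oD f Z[OF k] nz] by simp
  qed
  show fin: "finite {k \<in> I. Z k \<in> K}" if K: "compactin sphere_top K" "K \<subseteq> D" for K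
  proof -
    have "finite (\<Union>p\<in>{q \<in> K. f q = 0}. {k \<in> I. Z k = p})"
      using finite_zeros_on_compact[OF D f p0 K] van K(2) by (auto simp: vanishes_on_sequence_def)
    then show ?thesis by (rule rev_finite_subset) (use f0 in auto)
  qed
  have "emeasure \<nu> K < \<infinity>" if K: "compactin sphere_top K" "K \<subseteq> D" for K
  \<comment> \<open>\<open>radon_on\<close> speaks of all compact \<open>K\<close>; for a
    nonmeasurable set \<open>emeasure\<close> is 0 by convention.\<close>
  proof (cases "K \<in> sets \<nu>")
    case True
    then have "emeasure \<nu> K = emeasure (count_space I) (Z -` K \<inter> space (count_space I))"
      unfolding \<nu>_def by (intro emeasure_distr Zm) simp
    also have "Z -` K \<inter> space (count_space I) = {k \<in> I. Z k \<in> K}" by auto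
    also have "emeasure (count_space I) {k \<in> I. Z k \<in> K} < \<infinity>"
      using fin[OF K] by (subst emeasure_count_space_finite) (auto simp: of_nat_less_top)
    finally show ?thesis .
  qed (simp add: emeasure_notin_sets)
  then show "radon_on D \<nu>" by (simp add: radon_on_def \<nu>_def sp st)
qed

text \<open>Grouping the terms by their common value, each zero is counted at most as often as its
  multiplicity; as \<phi> is nonnegative, the sum is at most the weighted sum of
  \<open>ln_holomorphic_riesz\<close>.\<close>

lemma transport_zero_counting_le:
  fixes Z :: "nat \<Rightarrow> complex option" and I D f
  defines "\<nu> \<equiv> distr (count_space I) (sigma D {U. openin sphere_top U \<and> U \<subseteq> D}) Z"
  assumes D: "sphere_domain D" and f: "holomorphic_sphere f D" and p0: "p0 \<in> D" "f p0 \<noteq> 0"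
    and ZD: "\<forall>k\<in>I. Z k \<in> D" and van: "vanishes_on_sequence D f I Z"
    and \<phi>: "smooth_compact_support (Some -` D) \<phi>" "\<And>z. 0 \<le> \<phi> z"
  shows "2 * pi * (\<integral>p. transport Some \<phi> p \<partial>\<nu>) \<le> (\<integral>z. ln (cmod (f (Some z))) * laplacian \<phi> z \<partial>lborel)"
proof -
  have oD: "openin sphere_top D" using D by (simp add: sphere_domain_def)
  have oG: "open (Some -` D)" using oD by (simp add: openin_sphere_iff)
  note rad = radon_on_zero_counting[OF D f p0 ZD van]
  have \<nu>: "radon_on D \<nu>" unfolding \<nu>_def by (rule rad(1))
  obtain K where K: "compact K" "K \<subseteq> Some -` D" "\<And>z. z \<notin> K \<Longrightarrow> \<phi> z = 0"
    and \<phi>m[measurable]: "\<phi> \<in> borel_measurable borel"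
    using smooth_compact_support_facts[OF \<phi>(1)] by metis
  have KD: "Some ` K \<subseteq> D" using K(2) by auto
  note [measurable] = measurable_the[OF \<nu> oD] plane_part(5)[OF \<nu> oD K(1) KD]
  have tr: "transport Some \<phi> p = indicator (Some ` K) p * \<phi> (the p)" for p
    using K(3) by (cases p) (auto simp: transport_def indicator_def)
  define J where "J = {k \<in> I. Z k \<in> Some ` K}"
  have J: "finite J" unfolding J_def by (rule rad(2)[OF compactin_sphere_Some[OF K(1)] KD])
  have Zm: "Z \<in> measurable (count_space I) (sigma D {U. openin sphere_top U \<and> U \<subseteq> D})"
    using ZD by (simp add: space_measure_of_conv)
  have "(\<integral>p. transport Some \<phi> p \<partial>\<nu>) = (\<integral>k. transport Some \<phi> (Z k) \<partial>count_space I)"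
  proof -
    have "(\<lambda>p. transport Some \<phi> p) \<in> borel_measurable \<nu>" unfolding tr by measurable
    then have "(\<lambda>p. transport Some \<phi> p) \<in> borel_measurable (sigma D {U. openin sphere_top U \<and> U \<subseteq> D})"
      by (simp add: \<nu>_def)
    then show ?thesis unfolding \<nu>_def by (rule integral_distr[OF Zm])
  qed
  also have "\<dots> = (\<Sum>k | k \<in> I \<and> transport Some \<phi> (Z k) \<noteq> 0. transport Some \<phi> (Z k))"
    by (rule lebesgue_integral_count_space_finite_support)
      (rule finite_subset[OF _ J], auto simp: J_def tr indicator_def split: if_splits)
  also have "\<dots> = (\<Sum>k\<in>J. \<phi> (the (Z k)))"
    by (rule sum.mono_neutral_cong_left[OF J]) (auto simp: J_def tr indicator_def split: if_splits)
  also have "\<dots> = (\<Sum>a\<in>{z \<in> K. f (Some z) = 0}. \<Sum>k\<in>{k \<in> J. the (Z k) = a}. \<phi> (the (Z k)))"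
  proof (rule sum.group[symmetric, OF J])
    have "Some ` {z \<in> K. f (Some z) = 0} \<subseteq> {q \<in> Some ` K. f q = 0}" by auto
    then have "finite (Some ` {z \<in> K. f (Some z) = 0})"
      using finite_zeros_on_compact[OF D f p0 compactin_sphere_Some[OF K(1)] KD] finite_subset by blast
    then show "finite {z \<in> K. f (Some z) = 0}" by (rule finite_imageD) simp
    show "(\<lambda>k. the (Z k)) ` J \<subseteq> {z \<in> K. f (Some z) = 0}"
    proof
      fix z assume "z \<in> (\<lambda>k. the (Z k)) ` J"
      then obtain k where k: "k \<in> I" "Z k \<in> Some ` K" "z = the (Z k)" by (auto simp: J_def)
      then have "Z k = Some z" "z \<in> K" by auto
      then show "z \<in> {z \<in> K. f (Some z) = 0}" using rad(3)[OF k(1)] by simp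
    qed
  qed
  also have "\<dots> \<le> (\<Sum>a\<in>{z \<in> K. f (Some z) = 0}. real (nat (zorder (\<lambda>z. f (Some z)) a)) * \<phi> a)"
  proof (rule sum_mono)
    fix a assume a: "a \<in> {z \<in> K. f (Some z) = 0}"
    have eq: "{k \<in> J. the (Z k) = a} = {k \<in> I. Z k = Some a}" using a by (auto simp: J_def)
    have "int (card {k \<in> I. Z k = Some a}) \<le> zero_multiplicity f (Some a)"
      using van a K(2) by (auto simp: vanishes_on_sequence_def)
    then have "card {k \<in> I. Z k = Some a} \<le> nat (zorder (\<lambda>z. f (Some z)) a)"
      by (simp add: zero_multiplicity_def)
    then have "real (card {k \<in> I. Z k = Some a}) * \<phi> a \<le> real (nat (zorder (\<lambda>z. f (Some z)) a)) * \<phi> a"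
      using \<phi>(2) by (intro mult_right_mono) auto
    moreover have "(\<Sum>k\<in>{k \<in> J. the (Z k) = a}. \<phi> (the (Z k))) = real (card {k \<in> I. Z k = Some a}) * \<phi> a"
      unfolding eq by simp
    ultimately show "(\<Sum>k\<in>{k \<in> J. the (Z k) = a}. \<phi> (the (Z k))) \<le> real (nat (zorder (\<lambda>z. f (Some z)) a)) * \<phi> a" by (simp only:)
  qed
  finally have le: "(\<integral>p. transport Some \<phi> p \<partial>\<nu>) \<le> (\<Sum>a\<in>{z \<in> K. f (Some z) = 0}. real (nat (zorder (\<lambda>z. f (Some z)) a)) * \<phi> a)" .
  have hol: "(\<lambda>z. f (Some z)) holomorphic_on Some -` D"
    using f by (simp add: holomorphic_sphere_def vimage_def)
  have "(\<integral>z. ln (cmod (f (Some z))) * laplacian \<phi> z \<partial>lborel)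
      = 2 * pi * (\<Sum>a\<in>{z \<in> K. f (Some z) = 0}. real (nat (zorder (\<lambda>z. f (Some z)) a)) * \<phi> a)"
  proof (rule ln_holomorphic_riesz(2)[OF oG hol _ K(1,2) \<phi>(1) K(3)])
    show "finite {z \<in> K'. f (Some z) = 0}" if "compact K'" "K' \<subseteq> Some -` D" for K'
    proof -
      have "finite {q \<in> Some ` K'. f q = 0}"
        by (rule finite_zeros_on_compact[OF D f p0 compactin_sphere_Some[OF that(1)]]) (use that(2) in auto)
      then have "finite (Some -` {q \<in> Some ` K'. f q = 0})" by (intro finite_vimageI) auto
      then show ?thesis by (rule rev_finite_subset) auto
    qed
  qed auto
  then show ?thesis using le by (simp add: mult_left_mono)
qed

section \<open>The two implications\<close>

lemma riesz_measure_radon_on: "riesz_measure D u \<nu> \<Longrightarrow> radon_on D \<nu>"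
  by (simp add: riesz_measure_def radon_on_def)

lemma riesz_measure_test:
  assumes "riesz_measure D u \<nu>" "smooth_compact_support (Some -` D) \<phi>"
  shows "(\<integral>z. real_of_ereal (u (Some z)) * laplacian \<phi> z \<partial>lborel) = 2 * pi * (\<integral>p. transport Some \<phi> p \<partial>\<nu>)"
  using assms by (simp add: riesz_measure_def riesz_in_chart_def has_bochner_integral_iff)

theorem mainTheorem1:
  fixes D D0 :: "complex option set"
    and M :: "complex option \<Rightarrow> ereal"
    and \<nu>M :: "complex option measure"
  assumes "sphere_domain D" and "sphere_domain D0"
    and "D0 \<noteq> {}" and "relatively_compact_in D0 D" and "D \<noteq> UNIV"
    and "subharmonic D M" and "\<exists>p\<in>D. M p \<noteq> -\<infinity>" and "riesz_measure D M \<nu>M"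
  shows "(\<forall>u \<nu>u. subharmonic D u \<and> (\<exists>p\<in>D. u p \<noteq> -\<infinity>) \<and> riesz_measure D u \<nu>u \<and>
             (\<forall>p \<in> D - D0. u p \<le> M p) \<longrightarrow>
           (\<forall>v \<in> sbh0_pos D D0.
              (\<integral>\<^sup>+p\<in>D - D0. e2ennreal (v p) \<partial>\<nu>M) < \<infinity> \<longrightarrow>
              (\<integral>\<^sup>+p\<in>D - D0. e2ennreal (v p) \<partial>\<nu>u) < \<infinity>)) \<and>
         (\<forall>f I Z. holomorphic_sphere f D \<and> (\<exists>p\<in>D. f p \<noteq> 0) \<and>
             (I = {1..} \<or> (\<exists>n. I = {1..n})) \<and> (\<forall>k\<in>I. Z k \<in> D) \<and>
             vanishes_on_sequence D f I Z \<and>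
             (\<forall>p \<in> D - D0. log_abs f p \<le> M p) \<longrightarrow>
           (\<forall>v \<in> sbh0_pos D D0.
              (\<integral>\<^sup>+p\<in>D - D0. e2ennreal (v p) \<partial>\<nu>M) < \<infinity> \<longrightarrow>
              (\<Sum>\<^sub>\<infinity>k \<in> {k \<in> I. Z k \<in> D - D0}. e2ennreal (v (Z k))) < \<infinity>))"
proof -
  have oD: "openin sphere_top D" and oD0: "openin sphere_top D0"
    using assms(1,2) by (simp_all add: sphere_domain_def)
  have oG: "open (Some -` D)" using oD by (simp add: openin_sphere_iff)
  have Mi: "set_integrable lborel K (\<lambda>z. real_of_ereal (M (Some z)))" if "compact K" "K \<subseteq> Some -` D" for K
    by (rule riesz_set_integrable[of D M \<nu>M]) (use that oG assms(8) in \<open>auto simp: riesz_measure_def\<close>)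
  have part1: "(\<integral>\<^sup>+p\<in>D - D0. e2ennreal (v p) \<partial>\<nu>u) < \<infinity>"
    if u: "subharmonic D u" "p0 \<in> D" "u p0 \<noteq> -\<infinity>" "riesz_measure D u \<nu>u" "\<forall>p \<in> D - D0. u p \<le> M p"
      and v: "v \<in> sbh0_pos D D0" "(\<integral>\<^sup>+p\<in>D - D0. e2ennreal (v p) \<partial>\<nu>M) < \<infinity>" for u \<nu>u v p0
  proof (rule test_integral_transfer[of D D0 v \<nu>u \<nu>M "\<lambda>z. real_of_ereal (u (Some z))" "\<lambda>z. real_of_ereal (M (Some z))"])
    show "openin sphere_top D" "D \<noteq> UNIV" "openin sphere_top D0" "D0 \<noteq> {}" "relatively_compact_in D0 D"
      "v \<in> sbh0_pos D D0" "(\<integral>\<^sup>+p\<in>D - D0. e2ennreal (v p) \<partial>\<nu>M) < \<infinity>"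
      by fact+
    show "radon_on D \<nu>u" "radon_on D \<nu>M" using u(4) assms(8) by (auto intro: riesz_measure_radon_on)
    show "set_integrable lborel K (\<lambda>z. real_of_ereal (u (Some z)))" if "compact K" "K \<subseteq> Some -` D" for K
      by (rule riesz_set_integrable[of D u \<nu>u]) (use that oG u(4) in \<open>auto simp: riesz_measure_def\<close>)
    show "set_integrable lborel K (\<lambda>z. real_of_ereal (M (Some z)))" if "compact K" "K \<subseteq> Some -` D" for K
      using Mi that .
    \<comment> \<open>Where \<open>u\<close> is -\<infinity>, \<open>real_of_ereal\<close> returns
      0, which may exceed \<open>M\<close>; off this null set both values are finite and the order
      is preserved.\<close>
    show "AE z in lborel. Some z \<in> D - D0 \<longrightarrow> real_of_ereal (u (Some z)) \<le> real_of_ereal (M (Some z))"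
    proof -
      have "negligible {z. Some z \<in> D \<and> u (Some z) = -\<infinity>}"
        by (rule subharmonic_null_minus_infinity[OF assms(1) u(1-3)])
      then have "AE z in lebesgue. z \<notin> {z. Some z \<in> D \<and> u (Some z) = -\<infinity>}"
        by (intro AE_not_in) (simp add: negligible_iff_null_sets)
      then have "AE z in lborel. z \<notin> {z. Some z \<in> D \<and> u (Some z) = -\<infinity>}" by (simp add: AE_completion_iff)
      then show ?thesis
      proof eventually_elim
        case (elim z)
        show ?case
        proof
          assume z: "Some z \<in> D - D0"
          then have "u (Some z) \<noteq> -\<infinity>" "u (Some z) \<le> M (Some z)" "M (Some z) < \<infinity>"
            using elim u(5) subharmonic_less_top[OF assms(6)] by auto
          then show "real_of_ereal (u (Some z)) \<le> real_of_ereal (M (Some z))"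
            by (cases "u (Some z)"; cases "M (Some z)") auto
        qed
      qed
    qed
    show "2 * pi * (\<integral>p. transport Some \<phi> p \<partial>\<nu>u) \<le> (\<integral>z. real_of_ereal (u (Some z)) * laplacian \<phi> z \<partial>lborel)"
      if "smooth_compact_support (Some -` D) \<phi>" for \<phi>
      using riesz_measure_test[OF u(4) that] by simp
    show "(\<integral>z. real_of_ereal (M (Some z)) * laplacian \<phi> z \<partial>lborel) \<le> 2 * pi * (\<integral>p. transport Some \<phi> p \<partial>\<nu>M)"
      if "smooth_compact_support (Some -` D) \<phi>" for \<phi>
      using riesz_measure_test[OF assms(8) that] by simp
  qed
  have part2: "(\<Sum>\<^sub>\<infinity>k \<in> {k \<in> I. Z k \<in> D - D0}. e2ennreal (v (Z k))) < \<infinity>"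
    if f: "holomorphic_sphere f D" "p0 \<in> D" "f p0 \<noteq> 0" and Z: "\<forall>k\<in>I. Z k \<in> D" and van: "vanishes_on_sequence D f I Z"
      and fM: "\<forall>p \<in> D - D0. log_abs f p \<le> M p"
      and v: "v \<in> sbh0_pos D D0" "(\<integral>\<^sup>+p\<in>D - D0. e2ennreal (v p) \<partial>\<nu>M) < \<infinity>" for f v p0 and I :: "nat set" and Z
  proof -
    define \<nu> where "\<nu> = distr (count_space I) (sigma D {U. openin sphere_top U \<and> U \<subseteq> D}) Z"
    note rad = radon_on_zero_counting[OF assms(1) f Z van, folded \<nu>_def]
    have hol: "(\<lambda>z. f (Some z)) holomorphic_on Some -` D"
      using f by (simp add: holomorphic_sphere_def vimage_def)
    have finK: "finite {z \<in> K. f (Some z) = 0}" if "compact K" "K \<subseteq> Some -` D" for K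
    proof -
      have "finite {q \<in> Some ` K. f q = 0}"
        by (rule finite_zeros_on_compact[OF assms(1) f compactin_sphere_Some[OF that(1)]]) (use that(2) in auto)
      then have "finite (Some -` {q \<in> Some ` K. f q = 0})" by (intro finite_vimageI) auto
      then show ?thesis by (rule rev_finite_subset) auto
    qed
    have fin: "(\<integral>\<^sup>+p\<in>D - D0. e2ennreal (v p) \<partial>\<nu>) < \<infinity>"
    proof (rule test_integral_transfer[of D D0 v \<nu> \<nu>M "\<lambda>z. ln (cmod (f (Some z)))" "\<lambda>z. real_of_ereal (M (Some z))"])
      show "openin sphere_top D" "D \<noteq> UNIV" "openin sphere_top D0" "D0 \<noteq> {}" "relatively_compact_in D0 D"
        "v \<in> sbh0_pos D D0" "(\<integral>\<^sup>+p\<in>D - D0. e2ennreal (v p) \<partial>\<nu>M) < \<infinity>"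
        by fact+
      show "radon_on D \<nu>" "radon_on D \<nu>M" using rad(1) assms(8) by (auto intro: riesz_measure_radon_on)
      show "set_integrable lborel K (\<lambda>z. ln (cmod (f (Some z))))" if "compact K" "K \<subseteq> Some -` D" for K
        by (rule ln_holomorphic_riesz(1)[OF oG hol finK that])
      show "set_integrable lborel K (\<lambda>z. real_of_ereal (M (Some z)))" if "compact K" "K \<subseteq> Some -` D" for K
        using Mi that .
      \<comment> \<open>At a zero \<open>log_abs\<close> is -\<infinity> but the real logarithm is
        not, so the comparison with \<open>M\<close> holds only off the zero set, which is locally
        finite and thus null.\<close>
      have "negligible {z. Some z \<in> D \<and> f (Some z) = 0}"
      proof (rule iffD2[OF locally_negligible_alt], rule ballI)
        fix z assume z: "z \<in> {z. Some z \<in> D \<and> f (Some z) = 0}"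
        then have "Some z \<in> D" by simp
        from locally_finite_zeros[OF assms(1) f this] obtain W where
          W: "openin sphere_top W" "Some z \<in> W" "W \<subseteq> D" "finite {q \<in> W. f q = 0}" by (elim exE conjE)
        let ?Z = "{z. Some z \<in> D \<and> f (Some z) = 0}"
        have "openin (top_of_set ?Z) (?Z \<inter> Some -` W)"
          using W(1) by (intro openin_open_Int) (simp add: openin_sphere_iff)
        moreover have "finite (Some -` {q \<in> W. f q = 0})" using W(4) by (intro finite_vimageI) auto
        then have "finite (?Z \<inter> Some -` W)" by (rule rev_finite_subset) auto
        then have "negligible (?Z \<inter> Some -` W)" by (rule negligible_finite)
        ultimately show "\<exists>U. openin (top_of_set ?Z) U \<and> z \<in> U \<and> negligible U" using z W(2) by blast
      qed
      then have "AE z in lebesgue. z \<notin> {z. Some z \<in> D \<and> f (Some z) = 0}"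
        by (intro AE_not_in) (simp add: negligible_iff_null_sets)
      then have "AE z in lborel. z \<notin> {z. Some z \<in> D \<and> f (Some z) = 0}" by (simp add: AE_completion_iff)
      then show "AE z in lborel. Some z \<in> D - D0 \<longrightarrow> ln (cmod (f (Some z))) \<le> real_of_ereal (M (Some z))"
      proof eventually_elim
        case (elim z)
        show ?case
        proof
          assume z: "Some z \<in> D - D0"
          then have "ereal (ln (cmod (f (Some z)))) \<le> M (Some z)" "M (Some z) < \<infinity>"
            using elim bspec[OF fM z] subharmonic_less_top[OF assms(6)] by (auto simp: log_abs_def)
          then show "ln (cmod (f (Some z))) \<le> real_of_ereal (M (Some z))"
            by (cases "M (Some z)") auto
        qed
      qed
      show "2 * pi * (\<integral>p. transport Some \<phi> p \<partial>\<nu>) \<le> (\<integral>z. ln (cmod (f (Some z))) * laplacian \<phi> z \<partial>lborel)"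
        if "smooth_compact_support (Some -` D) \<phi>" "\<And>z. 0 \<le> \<phi> z" for \<phi>
        unfolding \<nu>_def by (rule transport_zero_counting_le[OF assms(1) f Z van that])
      show "(\<integral>z. real_of_ereal (M (Some z)) * laplacian \<phi> z \<partial>lborel) \<le> 2 * pi * (\<integral>p. transport Some \<phi> p \<partial>\<nu>M)"
        if "smooth_compact_support (Some -` D) \<phi>" for \<phi>
        using riesz_measure_test[OF assms(8) that] by simp
    qed
    have vs: "v \<in> sbh (D - D0)" using v(1) by (simp add: sbh0_pos_def sbh_pos_def)
    have Zm: "Z \<in> measurable (count_space I) (sigma D {U. openin sphere_top U \<and> U \<subseteq> D})"
      using Z by (simp add: space_measure_of_conv)
    have "(\<lambda>p. e2ennreal (v p) * indicator (D - D0) p) \<in> borel_measurable \<nu>"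
      by (rule borel_measurable_sbh_on[OF rad(1) oD oD0 vs])
    then have eq: "(\<integral>\<^sup>+p\<in>D - D0. e2ennreal (v p) \<partial>\<nu>) = (\<integral>\<^sup>+k. e2ennreal (v (Z k)) * indicator (D - D0) (Z k) \<partial>count_space I)"
      unfolding \<nu>_def by (rule nn_integral_distr[OF Zm])
    \<comment> \<open>In \<open>ennreal\<close> an infinite sum is the supremum of its finite
      partial sums, and each of these is at most the integral against the counting measure.\<close>
    have "(\<Sum>\<^sub>\<infinity>k \<in> {k \<in> I. Z k \<in> D - D0}. e2ennreal (v (Z k)))
        = (SUP F\<in>{F. finite F \<and> F \<subseteq> {k \<in> I. Z k \<in> D - D0}}. \<Sum>k\<in>F. e2ennreal (v (Z k)))"
      by (rule nonneg_infsum_complete) simp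
    also have "\<dots> \<le> (\<integral>\<^sup>+p\<in>D - D0. e2ennreal (v p) \<partial>\<nu>)"
    proof (rule SUP_least)
      fix F assume "F \<in> {F. finite F \<and> F \<subseteq> {k \<in> I. Z k \<in> D - D0}}"
      then have F: "finite F" "F \<subseteq> {k \<in> I. Z k \<in> D - D0}" by auto
      have "(\<Sum>k\<in>F. e2ennreal (v (Z k))) = (\<integral>\<^sup>+k. e2ennreal (v (Z k)) * indicator F k \<partial>count_space I)"
        by (subst nn_integral_count_space'[OF F(1)]) (use F(2) in auto)
      also have "\<dots> \<le> (\<integral>\<^sup>+k. e2ennreal (v (Z k)) * indicator (D - D0) (Z k) \<partial>count_space I)"
        using F(2) by (intro nn_integral_mono) (auto simp: indicator_def)
      finally show "(\<Sum>k\<in>F. e2ennreal (v (Z k))) \<le> (\<integral>\<^sup>+p\<in>D - D0. e2ennreal (v p) \<partial>\<nu>)" by (simp only: eq)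
    qed
    finally show ?thesis using fin by (rule le_less_trans)
  qed
  show ?thesis using part1 part2 by blast
qed

end
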